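(* There is a domain $\Omega\subseteq\mathbb{C}$ such that $\partial\Omega$ is Ahlfors $1$-regular, $\beta_{\partial\Omega}(\partial\Omega)<\infty$, and there is $E\subseteq\partial\Omega$ with $\omega_\Omega(E)>0=\mathscr{H}^1(E)$. In particular, $\Omega$ is a uniform domain with $1$-rectifiable and Ahlfors $1$-regular boundary whose harmonic measure has a singular set (a set of positive harmonic measure and zero $\mathscr{H}^1$-measure).
   Context: A domain is a connected open set; $\omega_\Omega$ is harmonic measure of $\Omega$ (positivity of $\omega_\Omega(E)$ does not depend on the pole). $\mathscr{H}^1$ and $\mathscr{H}^1_\infty$ are one-dimensional Hausdorff measure and content. Ahlfors $1$-regular: $C^{-1}r\le\mathscr{H}^1(E\cap B(x,r))\le Cr$ for all $x\in E$, $0<r<\operatorname{diam}E$. $1$-rectifiable: $E$ is covered up to $\mathscr{H}^1$-measure zero by countably many $1$-dimensional Lipschitz graphs. Uniform domain: there is $C\geq 1$ such that every $x,y\in\Omega$ are joined by a curve $\gamma\subseteq\overline\Omega$ with $\ell(\gamma)\le C|x-y|$ and $\min\{\ell(x,z),\ell(y,z)\}\le C\operatorname{dist}(z,\Omega^c)$ for all $z\in\gamma$, where $\ell(a,b)$ is the length of the subarc of $\gamma$ between $a$ and $b$. Christ--David cubes for $X=\partial\Omega$: fix $0<\rho<1/1000$, $c_0=1/500$ and nested maximal $\rho^k$-nets $X_k\subseteq X$, $k\in\mathbb{Z}$. $\mathscr{D}=\bigcup_k\mathscr{D}_k$ is a family of Borel subsets of $X$ such that $X=\bigcup_{Q\in\mathscr{D}_k}Q$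 for every $k$; if $Q\cap Q'\ne\emptyset$ then $Q\subseteq Q'$ or $Q'\subseteq Q$; and for $Q\in\mathscr{D}_k$, with $\ell(Q):=5\rho^k$, there is $\zeta_Q\in X_k$ with $X\cap B(\zeta_Q,c_0\ell(Q))\subseteq Q\subseteq B(\zeta_Q,\ell(Q))$, and $X_k=\{\zeta_Q:Q\in\mathscr{D}_k\}$. Put $B_Q=B(\zeta_Q,\ell(Q))$; $3B$ is the ball concentric with $B$ with triple radius. For a ball $B$ of radius $r_B$ and a line $L$, $\beta_E^{1,2}(B,L)=\big(r_B^{-1}\int_0^1\mathscr{H}^1_\infty(\{x\in B\cap E:\operatorname{dist}(x,L)>tr_B\})\,t\,dt\big)^{1/2}$, $\beta_E^{1,2}(B)=\inf_L\beta_E^{1,2}(B,L)$ over lines $L$, and $\beta_{\partial\Omega}(\partial\Omega)=\operatorname{diam}\partial\Omega+\sum_{Q\in\mathscr{D}}\beta_{\partial\Omega}^{1,2}(3B_Q)^2\ell(Q)$. *)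

theory Defs
  imports "HOL-Analysis.Analysis"
begin

text \<open>The library's \<^const>\<open>diameter\<close> is 0 on unbounded sets, so an extended diameter is used.\<close>

definition ediam :: "'a::metric_space set \<Rightarrow> ennreal" where
  "ediam S = (SUP x\<in>S. SUP y\<in>S. ennreal (dist x y))"

definition hausdorff_pre1 :: "ennreal \<Rightarrow> 'a::metric_space set \<Rightarrow> ennreal" where
  "hausdorff_pre1 \<delta> S =
     (INF U\<in>{U :: nat \<Rightarrow> 'a set. S \<subseteq> (\<Union>i. U i) \<and> (\<forall>i. ediam (U i) \<le> \<delta>)}. \<Sum>i. ediam (U i))"

definition hausdorff_measure1 :: "'a::metric_space set \<Rightarrow> ennreal" where
  "hausdorff_measure1 S = (SUP \<delta>\<in>{0<..}. hausdorff_pre1 \<delta> S)"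

definition hausdorff_content1 :: "'a::metric_space set \<Rightarrow> ennreal" where
  "hausdorff_content1 S = hausdorff_pre1 top S"

text \<open>The first conjunct rules out the empty set and single points, for which the condition on
  radii is vacuous.\<close>

definition ahlfors_regular1 :: "'a::metric_space set \<Rightarrow> bool" where
  "ahlfors_regular1 S \<longleftrightarrow> 0 < ediam S \<and>
     (\<exists>C>0. \<forall>x\<in>S. \<forall>r>0. ennreal r < ediam S \<longrightarrow>
        ennreal (r / C) \<le> hausdorff_measure1 (S \<inter> ball x r) \<and>
        hausdorff_measure1 (S \<inter> ball x r) \<le> ennreal (C * r))"

text \<open>The factor \<open>c\<close> rotates the graph over the real axis into a graph over an arbitrary line.\<close>

definition lipschitz_graph :: "complex set \<Rightarrow> bool" where
  "lipschitz_graph G \<longleftrightarrow>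
     (\<exists>(c::complex) f K. norm c = 1 \<and> K-lipschitz_on UNIV f \<and> G = range (\<lambda>t. c * Complex t (f t)))"

definition rectifiable1 :: "complex set \<Rightarrow> bool" where
  "rectifiable1 S \<longleftrightarrow>
     (\<exists>G :: nat \<Rightarrow> complex set. (\<forall>i. lipschitz_graph (G i)) \<and> hausdorff_measure1 (S - (\<Union>i. G i)) = 0)"

definition planar_domain :: "complex set \<Rightarrow> bool" where
  "planar_domain \<Omega> \<longleftrightarrow> open \<Omega> \<and> connected \<Omega> \<and> \<Omega> \<noteq> {}"

definition arc_length :: "(real \<Rightarrow> 'a::metric_space) \<Rightarrow> real \<Rightarrow> real \<Rightarrow> ennreal" where
  "arc_length \<gamma> a b =
     (SUP (n, p)\<in>{(n :: nat, p :: nat \<Rightarrow> real). mono p \<and> range p \<subseteq> {a..b}}.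
        \<Sum>i<n. ennreal (dist (\<gamma> (p i)) (\<gamma> (p (Suc i)))))"

definition uniform_domain :: "complex set \<Rightarrow> bool" where
  "uniform_domain \<Omega> \<longleftrightarrow> planar_domain \<Omega> \<and>
     (\<exists>C\<ge>1. \<forall>x\<in>\<Omega>. \<forall>y\<in>\<Omega>. \<exists>\<gamma>. path \<gamma> \<and> pathstart \<gamma> = x \<and> pathfinish \<gamma> = y \<and>
        path_image \<gamma> \<subseteq> closure \<Omega> \<and>
        arc_length \<gamma> 0 1 \<le> ennreal (C * dist x y) \<and>
        (\<forall>t\<in>{0..1}. \<forall>w\<in>- \<Omega>.
           min (arc_length \<gamma> 0 t) (arc_length \<gamma> t 1) \<le> ennreal (C * dist (\<gamma> t) w)))"

text \<open>
  Real-valued subharmonic functions: upper semicontinuous with the sub-mean-value inequality on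
  closed discs. Integrability over circles is automatic for these functions and is stated because
  the Lebesgue integral of a non-integrable function is 0 by convention.
\<close>

definition subharmonic_on :: "complex set \<Rightarrow> (complex \<Rightarrow> real) \<Rightarrow> bool" where
  "subharmonic_on \<Omega> v \<longleftrightarrow>
     (\<forall>z\<in>\<Omega>. \<forall>a>v z. \<forall>\<^sub>F w in at z. v w < a) \<and>
     (\<forall>z. \<forall>r>0. cball z r \<subseteq> \<Omega> \<longrightarrow>
        set_integrable lborel {0..2*pi} (\<lambda>t. v (z + of_real r * cis t)) \<and>
        v z \<le> (LINT t:{0..2*pi}|lborel. v (z + of_real r * cis t)) / (2 * pi))"

text \<open>
  The Perron solution of the Dirichlet problem on \<open>\<Omega>\<close> with bounded boundary data \<open>f\<close>. Admitting
  the value \<open>-\<infinity>\<close> would not change it, since a competitor may be replaced by its maximum with a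
  lower bound of \<open>f\<close>. For unbounded \<open>\<Omega>\<close> no condition is imposed at infinity other than boundedness
  above: when the boundary is non-polar (in particular, when it is Ahlfors regular), infinity is
  either a removable or a negligible point of the boundary in the Riemann sphere.
\<close>

definition perron_solution :: "complex set \<Rightarrow> (complex \<Rightarrow> real) \<Rightarrow> complex \<Rightarrow> ereal" where
  "perron_solution \<Omega> f z =
     (SUP v\<in>{v. subharmonic_on \<Omega> v \<and> bdd_above (v ` \<Omega>) \<and>
                (\<forall>\<zeta>\<in>frontier \<Omega>. Limsup (at \<zeta> within \<Omega>) (\<lambda>w. ereal (v w)) \<le> ereal (f \<zeta>))}.
        ereal (v z))"

text \<open>
  Harmonic measure of \<open>E\<close> with pole \<open>z\<close>, for Borel \<open>E \<subseteq> frontier \<Omega>\<close> and non-polar boundary. Bounded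
  Borel boundary functions are then resolutive, so that the lower and upper Perron solutions of
  the indicator of \<open>E\<close> coincide.
\<close>

definition harmonic_measure :: "complex set \<Rightarrow> complex \<Rightarrow> complex set \<Rightarrow> ereal" where
  "harmonic_measure \<Omega> z E = perron_solution \<Omega> (indicat_real E) z"

definition maximal_net :: "'a::metric_space set \<Rightarrow> real \<Rightarrow> 'a set \<Rightarrow> bool" where
  "maximal_net X r N \<longleftrightarrow> N \<subseteq> X \<and>
     (\<forall>x\<in>N. \<forall>y\<in>N. x \<noteq> y \<longrightarrow> r \<le> dist x y) \<and> (\<forall>y\<in>X. \<exists>x\<in>N. dist x y < r)"

definition cube_side :: "real \<Rightarrow> int \<Rightarrow> real" where
  "cube_side \<rho> k = 5 * \<rho> powi k"

text \<open>
  \<open>N k\<close> is the net and \<open>D k\<close> the set of cubes of generation \<open>k\<close>; \<open>c k Q\<close> is the centre of the cube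
  \<open>Q\<close>. The same set may be a cube of several generations (for bounded \<open>X\<close>, the set \<open>X\<close> itself is),
  with a different side length in each, so a cube is identified by the pair of its generation and
  the underlying set. The cubes of one generation are pairwise disjoint; hence \<open>c k\<close> is a bijection
  from \<open>D k\<close> onto \<open>N k\<close>.
\<close>

definition christ_david_cubes ::
  "real \<Rightarrow> 'a::metric_space set \<Rightarrow> (int \<Rightarrow> 'a set) \<Rightarrow> (int \<Rightarrow> 'a set set) \<Rightarrow> (int \<Rightarrow> 'a set \<Rightarrow> 'a) \<Rightarrow> bool" where
  "christ_david_cubes \<rho> X N D c \<longleftrightarrow>
     (\<forall>k. maximal_net X (\<rho> powi k) (N k)) \<and>
     (\<forall>k. N k \<subseteq> N (k + 1)) \<and>
     (\<forall>k. \<forall>Q\<in>D k. Q \<in> sets borel \<and> Q \<subseteq> X) \<and>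
     (\<forall>k. X = \<Union>(D k)) \<and>
     (\<forall>k. disjoint (D k)) \<and>
     (\<forall>k l. \<forall>Q\<in>D k. \<forall>Q'\<in>D l. Q \<inter> Q' \<noteq> {} \<longrightarrow> Q \<subseteq> Q' \<or> Q' \<subseteq> Q) \<and>
     (\<forall>k. \<forall>Q\<in>D k. X \<inter> ball (c k Q) (1/500 * cube_side \<rho> k) \<subseteq> Q \<and> Q \<subseteq> ball (c k Q) (cube_side \<rho> k)) \<and>
     (\<forall>k. N k = c k ` D k)"

text \<open>The content below is at most that of a ball of radius \<open>r\<close>, so \<^const>\<open>enn2real\<close> loses nothing.\<close>

definition beta_line :: "'a::euclidean_space set \<Rightarrow> 'a \<Rightarrow> real \<Rightarrow> 'a set \<Rightarrow> real" where
  "beta_line S x r L =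
     sqrt (1 / r * enn2real (\<integral>\<^sup>+t\<in>{0..1}.
        (hausdorff_content1 {y \<in> ball x r \<inter> S. infdist y L > t * r} * ennreal t) \<partial>lborel))"

definition beta_number :: "'a::euclidean_space set \<Rightarrow> 'a \<Rightarrow> real \<Rightarrow> real" where
  "beta_number S x r = (INF L\<in>{L. affine L \<and> aff_dim L = 1}. beta_line S x r L)"

definition beta_total ::
  "real \<Rightarrow> 'a::euclidean_space set \<Rightarrow> (int \<Rightarrow> 'a set set) \<Rightarrow> (int \<Rightarrow> 'a set \<Rightarrow> 'a) \<Rightarrow> ennreal" where
  "beta_total \<rho> X D c = ediam X +
     (\<Sum>\<^sub>\<infinity>(k, Q)\<in>(SIGMA k:UNIV. D k).
        ennreal ((beta_number X (c k Q) (3 * cube_side \<rho> k))\<^sup>2 * cube_side \<rho> k))"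

end

theory Submission
  imports Defs "HOL-Complex_Analysis.Complex_Analysis" "HOL-Library.Sublist"
begin

text \<open>
  The domain is the complement of a compact set built from nested discs. A disc of radius \<open>r\<close> contains
  2200 well separated discs of radius \<open>r / 2200\<close>, of which 2100 lie on inner circles and 100 on an outer
  circle that shields them. Along each sequence of nested discs one counts the outer minus the inner
  steps; a disc at which the count would become negative is replaced by a solid square. The points that
  are never captured by a square form a Cantor set, the singular set \<open>E\<close>.

  Most children are inner, so the total radius of the surviving discs decays geometrically, and the squares
  carry all the length. This gives \<open>\<H>\<^sup>1(E) = 0\<close>, Ahlfors regularity and rectifiability, and also
  the convergence of the beta sum, since at a given scale a boundary point is non-flat only in a surviving
  disc of that scale or near the corner of a larger square.

  Because of the shielding, there is a potential that is large at the inner children of a disc and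
  slightly negative at worst elsewhere. Superposing its rescaled copies, weighted by 4 to the power of
  minus the count, yields a superharmonic function that is at least \<open>-1\<close>, at least 3 near all squares and
  at most 1 at a far point. By comparison, the squares do not carry all of the harmonic measure.
\<close>

section \<open>One-dimensional Hausdorff measure\<close>

text \<open>Read as a random walk, the count has opposite drifts for two measures. For length, the
  2200 children of ratio 1/2200 share the radius of their parent equally, so a step is inner with
  probability 21/22 and capture is almost certain. For Brownian motion the outer circle intercepts
  almost everything, so the walk moves mostly upwards and escapes with positive probability. Outer
  children alone would carry too little length for regularity, while a pattern in which nothing is
  ever captured would have total radius 1 in every generation, none of it flat, and a divergent beta
  sum. The weight 4 turns the upward drift into an inequality that survives every step. The kernel
  is at least -1/20 everywhere and at least 32/100 at inner children; multiplied by 10 it costs less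
  than 3/4 at an outer step and gains more than 3 at an inner one. Its negative charges are 1/100 at
  each outer child, small against the weight 1/4 of the kernel placed there next, so the
  superposition stays superharmonic. Harmonic measure being a supremum, one explicit competitor
  bounds it from below.\<close>

lemma ediam_mono: "S \<subseteq> T \<Longrightarrow> ediam S \<le> ediam T"
  unfolding ediam_def by (intro SUP_mono) (meson SUP_subset_mono order_refl subsetD)

lemma ediam_leI: "(\<And>x y. x \<in> S \<Longrightarrow> y \<in> S \<Longrightarrow> dist x y \<le> d) \<Longrightarrow> ediam S \<le> ennreal d"
  unfolding ediam_def by (intro SUP_least ennreal_leI) auto

lemma ediam_empty [simp]: "ediam {} = 0"
  by (simp add: ediam_def bot_ennreal)

lemma dist_le_ediam: "x \<in> S \<Longrightarrow> y \<in> S \<Longrightarrow> ennreal (dist x y) \<le> ediam S"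
  unfolding ediam_def by (meson SUP_upper2 order_refl)

lemma hausdorff_pre1_le:
  "S \<subseteq> (\<Union>i. U i) \<Longrightarrow> (\<And>i. ediam (U i) \<le> \<delta>) \<Longrightarrow> hausdorff_pre1 \<delta> S \<le> (\<Sum>i::nat. ediam (U i))"
  unfolding hausdorff_pre1_def by (rule INF_lower) auto

lemma hausdorff_pre1_greatest:
  "(\<And>U. S \<subseteq> (\<Union>i::nat. U i) \<Longrightarrow> (\<And>i. ediam (U i) \<le> \<delta>) \<Longrightarrow> b \<le> (\<Sum>i. ediam (U i)))
    \<Longrightarrow> b \<le> hausdorff_pre1 \<delta> S"
  unfolding hausdorff_pre1_def by (rule INF_greatest) auto

lemma hausdorff_pre1_mono: "S \<subseteq> T \<Longrightarrow> hausdorff_pre1 \<delta> S \<le> hausdorff_pre1 \<delta> T"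
  by (rule hausdorff_pre1_greatest) (auto intro: hausdorff_pre1_le)

lemma hausdorff_pre1_antimono: "\<delta> \<le> \<delta>' \<Longrightarrow> hausdorff_pre1 \<delta>' S \<le> hausdorff_pre1 \<delta> S"
  by (rule hausdorff_pre1_greatest) (auto intro!: hausdorff_pre1_le intro: order_trans)

lemma hausdorff_pre1_le_measure: "\<delta> > 0 \<Longrightarrow> hausdorff_pre1 \<delta> S \<le> hausdorff_measure1 S"
  unfolding hausdorff_measure1_def by (intro SUP_upper) auto

lemma hausdorff_measure1_le:
  "(\<And>\<delta>. \<delta> > 0 \<Longrightarrow> hausdorff_pre1 (ennreal \<delta>) S \<le> b) \<Longrightarrow> hausdorff_measure1 S \<le> b"
  unfolding hausdorff_measure1_def
proof (intro SUP_least)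
  fix \<delta> :: ennreal assume *: "\<And>\<delta>. \<delta> > 0 \<Longrightarrow> hausdorff_pre1 (ennreal \<delta>) S \<le> b" "\<delta> \<in> {0<..}"
  \<comment> \<open>The scale may be \<open>top\<close>; a positive real scale below it has the
    larger premeasure.\<close>
  define d where "d = (if \<delta> = top then 1 else enn2real \<delta>)"
  have "d > 0" "ennreal d \<le> \<delta>"
    using *(2) by (auto simp: d_def enn2real_positive_iff top.not_eq_extremum)
  then show "hausdorff_pre1 \<delta> S \<le> b"
    using *(1)[of d] hausdorff_pre1_antimono[of "ennreal d" \<delta> S] by (meson order_trans)
qed

lemma hausdorff_measure1_mono: "S \<subseteq> T \<Longrightarrow> hausdorff_measure1 S \<le> hausdorff_measure1 T"
  unfolding hausdorff_measure1_def by (intro SUP_mono) (use hausdorff_pre1_mono in blast)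

lemma hausdorff_measure1_seq:
  "hausdorff_measure1 S = (SUP n. hausdorff_pre1 (ennreal (1 / Suc n)) S)"
proof (rule antisym)
  show "hausdorff_measure1 S \<le> (SUP n. hausdorff_pre1 (ennreal (1 / Suc n)) S)"
  proof (rule hausdorff_measure1_le)
    fix \<delta> :: real assume "\<delta> > 0"
    then obtain n where "1 / Suc n < \<delta>"
      using nat_approx_posE by blast
    then show "hausdorff_pre1 (ennreal \<delta>) S \<le> (SUP n. hausdorff_pre1 (ennreal (1 / Suc n)) S)"
      by (intro SUP_upper2[of n] hausdorff_pre1_antimono ennreal_leI) auto
  qed
  show "(SUP n. hausdorff_pre1 (ennreal (1 / Suc n)) S) \<le> hausdorff_measure1 S"
    by (intro SUP_least hausdorff_pre1_le_measure) auto
qed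

lemma hausdorff_pre1_countable_subadd:
  "hausdorff_pre1 \<delta> (\<Union>i::nat. A i) \<le> (\<Sum>i. hausdorff_pre1 \<delta> (A i))"
proof (cases "(\<Sum>i. hausdorff_pre1 \<delta> (A i)) = top")
  case False
  then have fin: "hausdorff_pre1 \<delta> (A i) < top" for i
    using ennreal_suminf_lessD top.not_eq_extremum by blast
  show ?thesis
  proof (rule ennreal_le_epsilon)
    fix e :: real assume e: "0 < e"
    have "\<exists>U. A i \<subseteq> (\<Union>j::nat. U j) \<and> (\<forall>j. ediam (U j) \<le> \<delta>) \<and>
        (\<Sum>j. ediam (U j)) \<le> hausdorff_pre1 \<delta> (A i) + ennreal (e * (1/2) ^ Suc i)" for i
    proof -
      have "hausdorff_pre1 \<delta> (A i) < hausdorff_pre1 \<delta> (A i) + ennreal (e * (1/2) ^ Suc i)"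
        using fin[of i] e by simp
      then show ?thesis
        unfolding hausdorff_pre1_def[of \<delta> "A i"] Inf_less_iff
        by (auto dest: less_imp_le)
    qed
    then obtain U where U: "\<And>i. A i \<subseteq> (\<Union>j::nat. U i j)" "\<And>i j. ediam (U i j) \<le> \<delta>"
        "\<And>i. (\<Sum>j. ediam (U i j)) \<le> hausdorff_pre1 \<delta> (A i) + ennreal (e * (1/2) ^ Suc i)"
      by metis
    define V where "V = (\<lambda>n. case prod_decode n of (i, j) \<Rightarrow> U i j)"
    have "(\<Union>i. A i) \<subseteq> (\<Union>n. V n)"
    proof
      fix x assume "x \<in> (\<Union>i. A i)"
      then obtain i j where "x \<in> U i j" using U(1) by blast
      then have "x \<in> V (prod_encode (i, j))" by (simp add: V_def)
      then show "x \<in> (\<Union>n. V n)" by blast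
    qed
    moreover have "ediam (V n) \<le> \<delta>" for n
      by (auto simp: V_def U(2) split: prod.split)
    ultimately have "hausdorff_pre1 \<delta> (\<Union>i. A i) \<le> (\<Sum>n. ediam (V n))"
      by (rule hausdorff_pre1_le)
    also have "\<dots> = (\<Sum>i. \<Sum>j. ediam (U i j))"
    proof -
      have "(\<Sum>i. (\<lambda>(i, j). ediam (U i j)) (prod_decode i)) = (\<Sum>i. \<Sum>j. ediam (U i j))"
        by (rule suminf_ennreal_2dimen) simp
      then show ?thesis by (simp add: V_def case_prod_unfold)
    qed
    also have "\<dots> \<le> (\<Sum>i. hausdorff_pre1 \<delta> (A i) + ennreal (e * (1/2) ^ Suc i))"
      by (intro suminf_le U(3) summableI)
    also have "\<dots> = (\<Sum>i. hausdorff_pre1 \<delta> (A i)) + (\<Sum>i. ennreal (e * (1/2) ^ Suc i))"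
      by (intro suminf_add[symmetric] summableI)
    also have "(\<Sum>i. ennreal (e * (1/2) ^ Suc i)) = ennreal e"
    proof -
      have "(\<lambda>i. e * (1/2) ^ Suc i) sums (e * 1)"
        by (intro sums_mult power_half_series)
      then show ?thesis using e by (intro sums_unique[symmetric] sums_ennreal[THEN iffD2]) auto
    qed
    finally show "hausdorff_pre1 \<delta> (\<Union>i. A i) \<le> (\<Sum>i. hausdorff_pre1 \<delta> (A i)) + ennreal e" .
  qed
qed simp

lemma hausdorff_measure1_countable_subadd:
  "hausdorff_measure1 (\<Union>i::nat. A i) \<le> (\<Sum>i. hausdorff_measure1 (A i))"
proof (rule hausdorff_measure1_le)
  fix \<delta> :: real assume "\<delta> > 0"
  then have "(\<Sum>i. hausdorff_pre1 (ennreal \<delta>) (A i)) \<le> (\<Sum>i. hausdorff_measure1 (A i))"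
    by (intro suminf_le summableI hausdorff_pre1_le_measure) simp
  then show "hausdorff_pre1 (ennreal \<delta>) (\<Union>i. A i) \<le> (\<Sum>i. hausdorff_measure1 (A i))"
    using hausdorff_pre1_countable_subadd order_trans by blast
qed

lemma hausdorff_measure1_empty [simp]: "hausdorff_measure1 {} = 0"
proof -
  have "hausdorff_measure1 ({} :: 'a set) \<le> 0"
  proof (rule hausdorff_measure1_le)
    fix \<delta> :: real
    show "hausdorff_pre1 (ennreal \<delta>) ({} :: 'a set) \<le> 0"
      using hausdorff_pre1_le[of "{}" "\<lambda>_. {}" "ennreal \<delta>"] by simp
  qed
  then show ?thesis by simp
qed

lemma hausdorff_measure1_Un: "hausdorff_measure1 (A \<union> B) \<le> hausdorff_measure1 A + hausdorff_measure1 B"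
proof -
  define C where "C = (\<lambda>n::nat. if n = 0 then A else if n = 1 then B else {})"
  have "A \<union> B = (\<Union>n. C n)"
    unfolding C_def by (simp add: set_eq_iff) (metis zero_neq_one)
  then have "hausdorff_measure1 (A \<union> B) \<le> (\<Sum>n. hausdorff_measure1 (C n))"
    using hausdorff_measure1_countable_subadd by metis
  also have "\<dots> = (\<Sum>n\<in>{0,1}. hausdorff_measure1 (C n))"
    by (rule suminf_finite) (auto simp: C_def)
  also have "\<dots> = hausdorff_measure1 A + hausdorff_measure1 B"
    by (simp add: C_def)
  finally show ?thesis .
qed

lemma hausdorff_measure1_UN:
  "finite I \<Longrightarrow> hausdorff_measure1 (\<Union>i\<in>I. A i) \<le> (\<Sum>i\<in>I. hausdorff_measure1 (A i))"
  by (induction rule: finite_induct) (auto intro: order_trans[OF hausdorff_measure1_Un] add_left_mono)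

lemma hausdorff_pre1_finite_cover:
  assumes "finite I" "S \<subseteq> (\<Union>i\<in>I. U i)" "\<And>i. i \<in> I \<Longrightarrow> ediam (U i) \<le> \<delta>"
  shows "hausdorff_pre1 \<delta> S \<le> (\<Sum>i\<in>I. ediam (U i))"
proof -
  obtain h where h: "bij_betw h {..<card I} I"
    using ex_bij_betw_nat_finite[OF assms(1)] by (auto simp: lessThan_atLeast0)
  define V where "V = (\<lambda>n. if n < card I then U (h n) else {})"
  have "hausdorff_pre1 \<delta> S \<le> (\<Sum>n. ediam (V n))"
  proof (rule hausdorff_pre1_le)
    show "S \<subseteq> (\<Union>n. V n)"
    proof
      fix x assume "x \<in> S"
      then obtain i where "i \<in> I" "x \<in> U i" using assms(2) by blast
      moreover have "i \<in> h ` {..<card I}" using h \<open>i \<in> I\<close> by (simp add: bij_betw_def)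
      then obtain n where "n < card I" "h n = i" by auto
      ultimately have "x \<in> V n" by (simp add: V_def)
      then show "x \<in> (\<Union>n. V n)" by blast
    qed
    show "ediam (V n) \<le> \<delta>" for n
      using h assms(3) by (auto simp: V_def bij_betw_def)
  qed
  also have "\<dots> = (\<Sum>n<card I. ediam (V n))"
    by (rule suminf_finite) (auto simp: V_def)
  also have "\<dots> = (\<Sum>n<card I. ediam (U (h n)))"
    by (simp add: V_def)
  also have "\<dots> = (\<Sum>i\<in>I. ediam (U i))"
    by (rule sum.reindex_bij_betw[OF h])
  finally show ?thesis .
qed

text \<open>Covering sets of diameter below \<open>d\<close> meet at most one piece, so a fine cover
  of \<open>S\<close> splits into covers of the pieces. This superadditivity serves both the lower
  regularity bound and the packing count for the beta numbers.\<close>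

lemma hausdorff_measure1_separated:
  assumes I: "finite I" and "d > 0"
    and sep: "\<And>i j x y. i \<in> I \<Longrightarrow> j \<in> I \<Longrightarrow> i \<noteq> j \<Longrightarrow> x \<in> A i \<Longrightarrow> y \<in> A j \<Longrightarrow> d \<le> dist x y"
    and sub: "\<And>i. i \<in> I \<Longrightarrow> A i \<subseteq> S"
  shows "(\<Sum>i\<in>I. hausdorff_measure1 (A i)) \<le> hausdorff_measure1 S"
proof -
  have key: "(\<Sum>i\<in>I. hausdorff_pre1 (ennreal \<delta>) (A i)) \<le> hausdorff_pre1 (ennreal \<delta>) S"
    if \<delta>: "0 < \<delta>" "\<delta> < d" for \<delta> :: real
  proof (rule hausdorff_pre1_greatest)
    fix U :: "nat \<Rightarrow> _" assume U: "S \<subseteq> (\<Union>i. U i)" "\<And>i. ediam (U i) \<le> ennreal \<delta>"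
    have "(\<Sum>i\<in>I. hausdorff_pre1 (ennreal \<delta>) (A i)) \<le> (\<Sum>i\<in>I. \<Sum>n. ediam (U n \<inter> A i))"
    proof (intro sum_mono hausdorff_pre1_le)
      show "A i \<subseteq> (\<Union>n. U n \<inter> A i)" if "i \<in> I" for i using U(1) sub[OF that] by blast
      show "ediam (U n \<inter> A i) \<le> ennreal \<delta>" for n i
        using U(2) ediam_mono[of "U n \<inter> A i" "U n"] by (meson inf_le1 order_trans)
    qed
    also have "\<dots> = (\<Sum>n. \<Sum>i\<in>I. ediam (U n \<inter> A i))"
      by (intro suminf_sum[symmetric] summableI)
    also have "\<dots> \<le> (\<Sum>n. ediam (U n))"
    proof (intro suminf_le summableI)
      fix n
      show "(\<Sum>i\<in>I. ediam (U n \<inter> A i)) \<le> ediam (U n)"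
      proof (cases "\<exists>i\<in>I. U n \<inter> A i \<noteq> {}")
        case True
        then obtain i x where i: "i \<in> I" "x \<in> U n" "x \<in> A i" by blast
        have "U n \<inter> A j = {}" if "j \<in> I" "j \<noteq> i" for j
        proof (rule ccontr)
          assume "U n \<inter> A j \<noteq> {}"
          then obtain y where y: "y \<in> U n" "y \<in> A j" by blast
          have "ennreal (dist x y) \<le> ennreal \<delta>"
            using dist_le_ediam[OF i(2) y(1)] U(2) order_trans by blast
          then have "dist x y \<le> \<delta>" using \<delta>(1) by (simp add: ennreal_le_iff)
          with sep[OF i(1) that(1) _ i(3) y(2)] that \<delta> show False by auto
        qed
        then have "(\<Sum>j\<in>I. ediam (U n \<inter> A j)) = (\<Sum>j\<in>{i}. ediam (U n \<inter> A j))"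
          using i(1) by (intro sum.mono_neutral_right I) auto
        then show ?thesis by (simp add: ediam_mono)
      next
        case False
        then have "(\<Sum>i\<in>I. ediam (U n \<inter> A i)) = 0"
          by (intro sum.neutral) auto
        then show ?thesis by simp
      qed
    qed
    finally show "(\<Sum>i\<in>I. hausdorff_pre1 (ennreal \<delta>) (A i)) \<le> (\<Sum>n. ediam (U n))" .
  qed
  have "(\<Sum>i\<in>I. hausdorff_measure1 (A i))
      = (\<Sum>i\<in>I. SUP n. hausdorff_pre1 (ennreal (1 / Suc n)) (A i))"
    by (simp add: hausdorff_measure1_seq)
  also have "\<dots> = (SUP n. \<Sum>i\<in>I. hausdorff_pre1 (ennreal (1 / Suc n)) (A i))"
    by (rule ennreal_SUP_sum[symmetric])
       (intro monoI hausdorff_pre1_antimono ennreal_leI, auto simp: field_simps)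
  also have "\<dots> \<le> hausdorff_measure1 S"
  proof (rule SUP_least)
    fix n
    obtain m where m: "1 / Suc m < d" using nat_approx_posE[OF \<open>d > 0\<close>] by blast
    define \<delta> where "\<delta> = min (1 / Suc n) (1 / Suc m :: real)"
    have "(\<Sum>i\<in>I. hausdorff_pre1 (ennreal (1 / Suc n)) (A i)) \<le> (\<Sum>i\<in>I. hausdorff_pre1 (ennreal \<delta>) (A i))"
      by (intro sum_mono hausdorff_pre1_antimono ennreal_leI) (simp add: \<delta>_def)
    also have "\<dots> \<le> hausdorff_pre1 (ennreal \<delta>) S"
      by (rule key) (use m in \<open>auto simp: \<delta>_def\<close>)
    also have "\<dots> \<le> hausdorff_measure1 S"
      by (rule hausdorff_pre1_le_measure) (simp add: \<delta>_def)
    finally show "(\<Sum>i\<in>I. hausdorff_pre1 (ennreal (1 / Suc n)) (A i)) \<le> hausdorff_measure1 S" .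
  qed
  finally show ?thesis .
qed

lemma hausdorff_measure1_curve_le:
  fixes f :: "real \<Rightarrow> 'a::metric_space"
  assumes f: "\<And>u v. u \<in> {s..t} \<Longrightarrow> v \<in> {s..t} \<Longrightarrow> dist (f u) (f v) \<le> \<bar>u - v\<bar>" and "s \<le> t"
    and S: "S \<subseteq> f ` {s..t}"
  shows "hausdorff_measure1 S \<le> ennreal (t - s)"
proof (rule hausdorff_measure1_le)
  fix \<delta> :: real assume \<delta>: "\<delta> > 0"
  obtain n :: nat where n: "(t - s) / \<delta> < real n" using reals_Archimedean2 by blast
  have n0: "n > 0"
    using n \<delta> \<open>s \<le> t\<close> by (cases n) (auto simp: divide_less_0_iff not_less)
  define h where "h = (t - s) / n"
  have h: "0 \<le> h" "h \<le> \<delta>" "h * n = t - s"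
    using n n0 \<delta> \<open>s \<le> t\<close> by (auto simp: h_def field_simps)
  define U where "U = (\<lambda>i::nat. f ` ({s + i * h..s + (real i + 1) * h} \<inter> {s..t}))"
  have dU: "ediam (U i) \<le> ennreal h" for i
  proof (rule ediam_leI)
    fix x y assume "x \<in> U i" "y \<in> U i"
    then obtain u v where "x = f u" "y = f v" "u \<in> {s..t}" "v \<in> {s..t}"
        "u \<in> {s + i * h..s + (real i + 1) * h}" "v \<in> {s + i * h..s + (real i + 1) * h}"
      unfolding U_def by blast
    then show "dist x y \<le> h" using f[of u v] by (auto simp: algebra_simps)
  qed
  have "S \<subseteq> (\<Union>i\<in>{..<n}. U i)"
  proof
    fix x assume "x \<in> S"
    then obtain u where u: "u \<in> {s..t}" "x = f u" using S by blast
    show "x \<in> (\<Union>i\<in>{..<n}. U i)"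
    proof (cases "h = 0")
      case True
      then have "u = s" using h u by simp
      then have "x \<in> U 0" using u True by (auto simp: U_def)
      then show ?thesis using n0 by blast
    next
      case False
      then have hp: "h > 0" using h by simp
      \<comment> \<open>The right end point has quotient \<open>n\<close>; the minimum assigns it to
        the last piece.\<close>
      define i where "i = min (nat \<lfloor>(u - s) / h\<rfloor>) (n - 1)"
      have fl: "0 \<le> (u - s) / h" using u hp by simp
      have "u \<in> {s + i * h..s + (real i + 1) * h}"
      proof (cases "nat \<lfloor>(u - s) / h\<rfloor> \<le> n - 1")
        case True
        then have i: "i = nat \<lfloor>(u - s) / h\<rfloor>" by (simp add: i_def)
        have "real i \<le> (u - s) / h" "(u - s) / h < real i + 1"
          using fl unfolding i by (auto simp: le_nat_iff of_nat_nat)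
        then show ?thesis using hp by (auto simp: field_simps)
      next
        case False
        then have i: "i = n - 1" "real i + 1 = n" using n0 by (auto simp: i_def of_nat_diff)
        have "real n \<le> (u - s) / h"
          using False fl by linarith
        then have "real n * h \<le> u - s" using hp by (simp add: field_simps)
        moreover have "real i * h \<le> n * h" using hp by (intro mult_right_mono) (auto simp: i(1))
        ultimately show ?thesis using u h i by (auto simp: mult.commute)
      qed
      then have "x \<in> U i" using u unfolding U_def by blast
      moreover have "i < n" using n0 by (simp add: i_def min_less_iff_disj)
      ultimately show ?thesis by blast
    qed
  qed
  then have "hausdorff_pre1 (ennreal \<delta>) S \<le> (\<Sum>i<n. ediam (U i))"
    using order_trans[OF dU ennreal_leI[OF h(2)]] by (intro hausdorff_pre1_finite_cover) auto
  also have "\<dots> \<le> (\<Sum>i<n. ennreal h)" by (intro sum_mono dU)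
  also have "\<dots> = ennreal (t - s)"
    using h by (simp add: sum_constant ennreal_of_nat_eq_real_of_nat mult.commute flip: ennreal_mult)
  finally show "hausdorff_pre1 (ennreal \<delta>) S \<le> ennreal (t - s)" .
qed

text \<open>A 1-Lipschitz coordinate does not increase diameters: a cover of \<open>S\<close>
  projects into compact intervals of at most the same lengths, and Lebesgue measure is countably
  subadditive.\<close>

lemma hausdorff_measure1_ge_projection:
  fixes p :: "'a::metric_space \<Rightarrow> real"
  assumes p: "\<And>x y. x \<in> S \<Longrightarrow> y \<in> S \<Longrightarrow> \<bar>p x - p y\<bar> \<le> dist x y"
    and st: "{s..t} \<subseteq> p ` S"
  shows "ennreal (t - s) \<le> hausdorff_measure1 S"
proof (cases "s \<le> t")
  case True
  \<comment> \<open>The scale 1 keeps all covering diameters finite.\<close>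
  have "ennreal (t - s) \<le> hausdorff_pre1 1 S"
  proof (rule hausdorff_pre1_greatest)
    fix U :: "nat \<Rightarrow> 'a set" assume U: "S \<subseteq> (\<Union>i. U i)" "\<And>i. ediam (U i) \<le> 1"
    have "\<exists>J. p ` (U i \<inter> S) \<subseteq> J \<and> J \<in> sets lborel \<and> emeasure lborel J \<le> ediam (U i)" for i
    proof (cases "U i \<inter> S = {}")
      case False
      then obtain x0 where x0: "x0 \<in> U i" "x0 \<in> S" by blast
      define d where "d = enn2real (ediam (U i))"
      have ed: "ennreal d = ediam (U i)"
        using U(2)[of i] by (auto simp: d_def ennreal_enn2real_if top_unique)
      have d: "\<bar>p x - p y\<bar> \<le> d" if "x \<in> U i \<inter> S" "y \<in> U i \<inter> S" for x y
        using dist_le_ediam[of x "U i" y] that p[of x y] unfolding ed[symmetric]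
        by (simp add: d_def ennreal_le_iff)
      define m where "m = Inf (p ` (U i \<inter> S))"
      have bb: "bdd_below (p ` (U i \<inter> S))"
        using d x0 by (intro bdd_belowI2[of _ "p x0 - d"]) (fastforce simp: abs_le_iff)
      have "p ` (U i \<inter> S) \<subseteq> {m..m + d}"
      proof clarify
        fix x assume x: "x \<in> U i" "x \<in> S"
        have "m \<le> p x" unfolding m_def using x by (intro cInf_lower bb) auto
        moreover have "p x - d \<le> m" unfolding m_def
        proof (rule cInf_greatest)
          show "p ` (U i \<inter> S) \<noteq> {}" using x0 by blast
          fix v assume "v \<in> p ` (U i \<inter> S)"
          then obtain y where y: "v = p y" "y \<in> U i \<inter> S" by blast
          then show "p x - d \<le> v" using d[of x y] x by auto
        qed
        ultimately show "p x \<in> {m..m + d}" by auto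
      qed
      moreover have "emeasure lborel {m..m + d} \<le> ediam (U i)"
        unfolding ed[symmetric] by (simp add: d_def)
      ultimately show ?thesis by (intro exI[of _ "{m..m + d}"]) auto
    qed (auto intro!: exI[of _ "{}"])
    then obtain J where J: "\<And>i. p ` (U i \<inter> S) \<subseteq> J i" "\<And>i. J i \<in> sets lborel"
        "\<And>i. emeasure lborel (J i) \<le> ediam (U i)"
      by metis
    have "{s..t} \<subseteq> (\<Union>i. J i)"
    proof
      fix u assume "u \<in> {s..t}"
      then obtain x where "x \<in> S" "u = p x" using st by blast
      then show "u \<in> (\<Union>i. J i)" using U(1) J(1) by blast
    qed
    then have "emeasure lborel {s..t} \<le> emeasure lborel (\<Union>i. J i)"
      using J(2) by (intro emeasure_mono) auto
    also have "\<dots> \<le> (\<Sum>i. emeasure lborel (J i))"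
      using J(2) by (intro emeasure_subadditive_countably) auto
    also have "\<dots> \<le> (\<Sum>i. ediam (U i))" by (intro suminf_le J(3) summableI)
    finally show "ennreal (t - s) \<le> (\<Sum>i. ediam (U i))" using True by simp
  qed
  also have "\<dots> \<le> hausdorff_measure1 S" by (rule hausdorff_pre1_le_measure) simp
  finally show ?thesis .
qed (simp add: ennreal_neg)

lemma hausdorff_content1_le_ediam: "hausdorff_content1 S \<le> ediam S"
  unfolding hausdorff_content1_def
  using hausdorff_pre1_finite_cover[of "{()}" S "\<lambda>_. S" top] by simp

lemma hausdorff_content1_empty [simp]: "hausdorff_content1 {} = 0"
  using hausdorff_content1_le_ediam[of "{}"] by simp

section \<open>Continuous subharmonic functions\<close>

definition circle_mean :: "(complex \<Rightarrow> real) \<Rightarrow> complex \<Rightarrow> real \<Rightarrow> real" where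
  "circle_mean v z r = (LINT t:{0..2*pi}|lborel. v (z + of_real r * cis t)) / (2 * pi)"

text \<open>A local condition whose threshold may depend on the point. It is checked wherever a
  convenient formula holds nearby, and \<open>submean_local_to_global\<close> later upgrades it to
  all discs.\<close>

definition submean_at :: "(complex \<Rightarrow> real) \<Rightarrow> complex \<Rightarrow> bool" where
  "submean_at v z \<longleftrightarrow> (\<exists>e>0. \<forall>r. 0 < r \<and> r < e \<longrightarrow> v z \<le> circle_mean v z r)"

lemma circle_integrable:
  fixes v :: "complex \<Rightarrow> real"
  assumes "continuous_on (sphere z r) v" "0 \<le> r"
  shows "set_integrable lborel {0..2*pi} (\<lambda>t. v (z + of_real r * cis t))"
proof -
  have "continuous_on {0..2*pi} (\<lambda>t. v (z + of_real r * cis t))"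
    by (rule continuous_on_compose2[OF assms(1)])
       (use assms(2) in \<open>auto simp: dist_norm norm_mult intro!: continuous_intros\<close>)
  then show ?thesis by (rule borel_integrable_atLeastAtMost')
qed

lemma circle_mean_eq_integral:
  assumes "continuous_on (sphere z r) v" "0 \<le> r"
  shows "circle_mean v z r = integral {0..2*pi} (\<lambda>t. v (z + of_real r * cis t)) / (2 * pi)"
  unfolding circle_mean_def using set_borel_integral_eq_integral(2)[OF circle_integrable[OF assms]] by simp

lemma circle_mean_mono:
  assumes "continuous_on (sphere z r) v" "continuous_on (sphere z r) w" "0 \<le> r"
    and "\<And>x. x \<in> sphere z r \<Longrightarrow> v x \<le> w x"
  shows "circle_mean v z r \<le> circle_mean w z r"
  unfolding circle_mean_def
  by (intro divide_right_mono set_integral_mono circle_integrable assms)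
     (use assms(3) in \<open>auto simp: dist_norm norm_mult\<close>)

lemma circle_mean_cong:
  assumes "0 \<le> r" "\<And>x. x \<in> sphere z r \<Longrightarrow> v x = w x"
  shows "circle_mean v z r = circle_mean w z r"
proof -
  have "v (z + of_real r * cis t) = w (z + of_real r * cis t)" for t
    by (rule assms(2)) (use assms(1) in \<open>auto simp: dist_norm norm_mult\<close>)
  then show ?thesis by (simp add: circle_mean_def)
qed

lemma circle_mean_const [simp]: "circle_mean (\<lambda>_. c) z r = c"
  by (simp add: circle_mean_def set_integral_const)

lemma circle_mean_add:
  assumes "continuous_on (sphere z r) v" "continuous_on (sphere z r) w" "0 \<le> r"
  shows "circle_mean (\<lambda>x. v x + w x) z r = circle_mean v z r + circle_mean w z r"
  unfolding circle_mean_def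
  by (simp add: set_integral_add(2)[OF circle_integrable[OF assms(1,3)] circle_integrable[OF assms(2,3)]]
      add_divide_distrib)

lemma circle_mean_cmult: "circle_mean (\<lambda>x. c * v x) z r = c * circle_mean v z r"
  by (simp add: circle_mean_def)

lemma circle_mean_affine:
  "circle_mean (\<lambda>x. v ((x - p) / of_real a)) z r = circle_mean v ((z - p) / of_real a) (r / a)"
proof -
  have "(z + of_real r * cis t - p) / of_real a = (z - p) / of_real a + of_real (r / a) * cis t" for t
    by (simp add: diff_divide_distrib add_divide_distrib)
  then show ?thesis by (simp add: circle_mean_def)
qed

text \<open>Cauchy's integral formula: on the circle the kernel cancels against the derivative of
  the parametrisation up to the factor \<open>\<i>\<close>.\<close>

lemma circle_mean_holomorphic:
  assumes "f holomorphic_on cball z r" "0 < r"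
  shows "circle_mean (\<lambda>w. Re (f w)) z r = Re (f z)"
proof -
  have "((\<lambda>u. f u / (u - z)) has_contour_integral (2 * of_real pi * \<i> * f z)) (part_circlepath z r 0 (2*pi))"
    using Cauchy_integral_circlepath_simple[OF assms(1), of z] assms(2) by (simp add: circlepath_def)
  then have "((\<lambda>t. f (z + of_real r * cis t) / (z + of_real r * cis t - z) * of_real r * \<i> * cis t)
      has_integral (2 * of_real pi * \<i> * f z)) {0..2*pi}"
    by (subst (asm) has_contour_integral_part_circlepath_iff) auto
  also have "(\<lambda>t. f (z + of_real r * cis t) / (z + of_real r * cis t - z) * of_real r * \<i> * cis t)
      = (\<lambda>t. \<i> * f (z + of_real r * cis t))"
  proof
    have "A / (z + of_real r * C - z) * of_real r * \<i> * C = \<i> * A" if "of_real r * C \<noteq> 0" for A C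
      using that by (simp add: field_simps)
    then show "f (z + of_real r * cis t) / (z + of_real r * cis t - z) * of_real r * \<i> * cis t
        = \<i> * f (z + of_real r * cis t)" for t using assms(2) by simp
  qed
  finally have "((\<lambda>t. \<i> * f (z + of_real r * cis t)) has_integral (2 * of_real pi * \<i> * f z)) {0..2*pi}" .
  from integral_unique[OF has_integral_Im[OF this]]
  have "integral {0..2*pi} (\<lambda>t. Re (f (z + of_real r * cis t))) = 2 * pi * Re (f z)"
    by simp
  moreover have "continuous_on (sphere z r) (\<lambda>w. Re (f w))"
    by (rule continuous_on_subset[OF continuous_on_Re[OF holomorphic_on_imp_continuous_on[OF assms(1)]]]) auto
  ultimately show ?thesis
    using assms(2) by (simp add: circle_mean_eq_integral)
qed

text \<open>The quotient \<open>(w - c) / (z - c)\<close> stays in the right half-plane on the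
  closed disc, where \<open>Ln\<close> is holomorphic; its real part differs from the wanted
  function by a constant.\<close>

lemma circle_mean_ln_norm:
  assumes "0 < r" "r < dist z c"
  shows "circle_mean (\<lambda>w. ln (cmod (w - c))) z r = ln (cmod (z - c))"
proof -
  have zc: "z \<noteq> c" using assms by auto
  define f where "f = (\<lambda>w. Ln ((w - c) / (z - c)) + of_real (ln (cmod (z - c))))"
  have re: "Re ((w - c) / (z - c)) > 0" if "w \<in> cball z r" for w
  proof -
    have "(w - c) / (z - c) = 1 + (w - z) / (z - c)" using zc by (simp add: field_simps)
    moreover have "cmod ((w - z) / (z - c)) < 1"
      using that assms zc by (auto simp: norm_divide dist_norm norm_minus_commute divide_simps)
    then have "\<bar>Re ((w - z) / (z - c))\<bar> < 1"
      using abs_Re_le_cmod le_less_trans by blast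
    ultimately show ?thesis by auto
  qed
  have "f holomorphic_on cball z r"
    unfolding f_def using re zc by (intro holomorphic_intros) (auto simp: complex_nonpos_Reals_iff not_le)
  then have "circle_mean (\<lambda>w. Re (f w)) z r = Re (f z)"
    by (rule circle_mean_holomorphic) fact
  moreover have "Re (f w) = ln (cmod (w - c))" if "w \<in> cball z r" for w
  proof -
    have "w \<noteq> c" using that assms by (auto simp: dist_commute)
    then show ?thesis using zc by (simp add: f_def norm_divide ln_div)
  qed
  ultimately show ?thesis
    using circle_mean_cong[of r z "\<lambda>w. Re (f w)" "\<lambda>w. ln (cmod (w - c))"] assms by auto
qed

section \<open>From local to global sub-mean values\<close>

lemma submean_max_principle:
  assumes cont: "continuous_on (cball z0 R) u" and R: "0 < R"
    and sub: "\<And>z. z \<in> ball z0 R \<Longrightarrow> submean_at u z"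
    and bd: "\<And>z. z \<in> sphere z0 R \<Longrightarrow> u z \<le> m"
    and z1: "z1 \<in> cball z0 R"
  shows "u z1 \<le> m"
proof (rule ccontr)
  assume "\<not> u z1 \<le> m"
  \<comment> \<open>The quadratic perturbation makes the sub-mean inequality strict;
    \<open>\<delta>\<close> is so small that boundary values are not lifted to the value at
    \<open>z1\<close>.\<close>
  define \<delta> where "\<delta> = (u z1 - m) / (2 * R\<^sup>2)"
  have \<delta>: "\<delta> > 0" "\<delta> * R\<^sup>2 < u z1 - m"
    using \<open>\<not> u z1 \<le> m\<close> R by (auto simp: \<delta>_def)
  define w where "w = (\<lambda>z. u z + \<delta> * (cmod (z - z0))\<^sup>2)"
  have cw: "continuous_on (cball z0 R) w"
    unfolding w_def by (intro continuous_intros cont)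
  obtain p where p: "p \<in> cball z0 R" "\<And>z. z \<in> cball z0 R \<Longrightarrow> w z \<le> w p"
    using continuous_attains_sup[OF _ _ cw] R by auto
  have "u z1 \<le> w z1" using \<delta> by (simp add: w_def)
  then have wp: "w p > m + \<delta> * R\<^sup>2" using p(2)[OF z1] \<delta> by linarith
  have "p \<notin> sphere z0 R"
    using wp bd[of p] by (auto simp: w_def dist_norm norm_minus_commute)
  then have pb: "p \<in> ball z0 R" using p(1) by auto
  obtain e where e: "e > 0" "\<And>r. 0 < r \<Longrightarrow> r < e \<Longrightarrow> u p \<le> circle_mean u p r"
    using sub[OF pb] by (auto simp: submean_at_def)
  define r where "r = min (e/2) (R - dist z0 p)"
  have r: "0 < r" "r < e" "r \<le> R - dist z0 p" using e pb by (auto simp: r_def)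
  have cb: "cball p r \<subseteq> cball z0 R"
  proof
    fix x assume "x \<in> cball p r"
    then show "x \<in> cball z0 R" using r(3) dist_triangle[of z0 x p] by auto
  qed
  have sph: "continuous_on (sphere p r) u"
    by (rule continuous_on_subset[OF cont]) (use cb in auto)
  \<comment> \<open>Cross term of the expansion about \<open>p\<close>. It is holomorphic in
    \<open>x\<close> and vanishes at \<open>p\<close>, so the circle mean of the quadratic term
    exceeds its value at \<open>p\<close> by exactly \<open>r^2\<close>.\<close>
  define h where "h = (\<lambda>x. 2 * cnj (p - z0) * (x - p))"
  have eq: "(cmod (x - z0))\<^sup>2 = ((cmod (p - z0))\<^sup>2 + r\<^sup>2) + Re (h x)" if "x \<in> sphere p r" for x
  proof -
    have "(cmod (x - p))\<^sup>2 = r\<^sup>2" using that by (simp add: dist_norm norm_minus_commute)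
    moreover have "(cmod (x - z0))\<^sup>2 = (cmod (p - z0))\<^sup>2 + (cmod (x - p))\<^sup>2 + Re (h x)"
      unfolding cmod_power2 h_def by (simp add: power2_eq_square algebra_simps)
    ultimately show ?thesis by simp
  qed
  have "circle_mean w p r = circle_mean u p r + \<delta> * circle_mean (\<lambda>x. (cmod (x - z0))\<^sup>2) p r"
    unfolding w_def using r(1)
    by (subst circle_mean_add) (auto intro!: sph continuous_intros simp: circle_mean_cmult)
  also have "circle_mean (\<lambda>x. (cmod (x - z0))\<^sup>2) p r
      = circle_mean (\<lambda>x. ((cmod (p - z0))\<^sup>2 + r\<^sup>2) + Re (h x)) p r"
    using r(1) eq by (intro circle_mean_cong) auto
  also have "\<dots> = (cmod (p - z0))\<^sup>2 + r\<^sup>2 + circle_mean (\<lambda>x. Re (h x)) p r"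
    using r(1) by (subst circle_mean_add) (auto intro!: continuous_intros simp: h_def)
  also have "circle_mean (\<lambda>x. Re (h x)) p r = Re (h p)"
    by (rule circle_mean_holomorphic) (auto simp: h_def r intro!: holomorphic_intros)
  finally have "circle_mean w p r = circle_mean u p r + \<delta> * ((cmod (p - z0))\<^sup>2 + r\<^sup>2)"
    by (simp add: h_def)
  moreover have "circle_mean w p r \<le> circle_mean (\<lambda>_. w p) p r"
    using r(1) cb by (intro circle_mean_mono p(2) continuous_on_subset[OF cw]) auto
  ultimately have "circle_mean u p r + \<delta> * ((cmod (p - z0))\<^sup>2 + r\<^sup>2) \<le> u p + \<delta> * (cmod (p - z0))\<^sup>2"
    by (simp add: w_def)
  moreover have "u p \<le> circle_mean u p r" using e(2) r by blast
  moreover have "\<delta> * r\<^sup>2 > 0" using \<delta> r by simp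
  ultimately show False by (simp add: algebra_simps)
qed

text \<open>Real parts of complex polynomials, seen on one circle. The rule \<open>cong\<close>
  forgets the values elsewhere; closure under products depends on it, since \<open>w - z0\<close>
  times its conjugate is constant only on the circle.\<close>

inductive trig_poly :: "complex \<Rightarrow> real \<Rightarrow> (complex \<Rightarrow> real) \<Rightarrow> bool" for z0 R where
  mono: "trig_poly z0 R (\<lambda>w. Re (c * (w - z0) ^ n))"
| add: "trig_poly z0 R g \<Longrightarrow> trig_poly z0 R h \<Longrightarrow> trig_poly z0 R (\<lambda>w. g w + h w)"
| cong: "trig_poly z0 R g \<Longrightarrow> (\<And>w. w \<in> sphere z0 R \<Longrightarrow> g w = h w) \<Longrightarrow> trig_poly z0 R h"

lemma trig_poly_mult_mono:
  assumes "m \<le> n"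
  shows "trig_poly z0 R (\<lambda>w. Re (c * (w - z0) ^ n) * Re (d * (w - z0) ^ m))"
proof (rule trig_poly.cong)
  show "trig_poly z0 R (\<lambda>w. Re (c * d / 2 * (w - z0) ^ (n + m))
      + Re (c * cnj d * of_real (R ^ (2 * m)) / 2 * (w - z0) ^ (n - m)))"
    by (intro trig_poly.intros)
  fix w assume w: "w \<in> sphere z0 R"
  define u where "u = w - z0"
  have uu: "u ^ m * cnj u ^ m = of_real (R ^ (2 * m))"
  proof -
    have "u * cnj u = of_real (R\<^sup>2)"
      unfolding complex_norm_square[symmetric] using w by (simp add: u_def dist_norm norm_minus_commute)
    then show ?thesis by (metis of_real_power power_mult power_mult_distrib)
  qed
  have n: "u ^ n = u ^ (n - m) * u ^ m" using assms by (simp flip: power_add)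
  \<comment> \<open>Product-to-sum formula. In the second term the conjugate powers cancel up to the
    constant \<open>R ^ (2 * m)\<close> and leave the exponent \<open>n - m\<close>, whence the
    assumption \<open>m \<le> n\<close>.\<close>
  have "Re A * Re B = Re (A * B) / 2 + Re (A * cnj B) / 2" for A B
    by (simp add: field_simps)
  then have "Re (c * u ^ n) * Re (d * u ^ m)
      = Re (c * u ^ n * (d * u ^ m)) / 2 + Re (c * u ^ n * cnj (d * u ^ m)) / 2" .
  also have "c * u ^ n * cnj (d * u ^ m) = c * cnj d * (u ^ m * cnj u ^ m) * u ^ (n - m)"
    by (simp add: n)
  also have "c * u ^ n * (d * u ^ m) = c * d * u ^ (n + m)" by (simp add: power_add)
  finally show "Re (c * d / 2 * (w - z0) ^ (n + m))
      + Re (c * cnj d * of_real (R ^ (2 * m)) / 2 * (w - z0) ^ (n - m))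
      = Re (c * (w - z0) ^ n) * Re (d * (w - z0) ^ m)"
    unfolding u_def[symmetric] uu by simp
qed

lemma trig_poly_mult:
  assumes "trig_poly z0 R g" "trig_poly z0 R h"
  shows "trig_poly z0 R (\<lambda>w. g w * h w)"
  using assms(1)
proof induction
  case (mono c n)
  show ?case using assms(2)
  proof induction
    case (mono d m)
    show ?case
    proof (cases "m \<le> n")
      case False
      then have "trig_poly z0 R (\<lambda>w. Re (d * (w - z0) ^ m) * Re (c * (w - z0) ^ n))"
        by (intro trig_poly_mult_mono) simp
      then show ?thesis by (rule trig_poly.cong) simp
    qed (rule trig_poly_mult_mono)
  next
    case (add g h)
    from trig_poly.add[OF add.IH] show ?case by (rule trig_poly.cong) (simp add: algebra_simps)
  next
    case (cong g h)
    show ?case by (rule trig_poly.cong[OF cong.IH]) (simp add: cong.hyps)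
  qed
next
  case (add g h)
  from trig_poly.add[OF add.IH] show ?case by (rule trig_poly.cong) (simp add: algebra_simps)
next
  case (cong g h)
  show ?case by (rule trig_poly.cong[OF cong.IH]) (simp add: cong.hyps)
qed

lemma real_polynomial_function_trig_poly:
  assumes "real_polynomial_function g"
  shows "trig_poly z0 R g"
  using assms
proof induction
  case (linear f)
  interpret f: bounded_linear f by fact
  have "f w = Re (Complex (f 1) (- f \<i>) * (w - z0) ^ 1) + Re (of_real (f z0) * (w - z0) ^ 0)" for w
  proof -
    have e: "w = Re w *\<^sub>R 1 + Im w *\<^sub>R \<i>" for w
      by (simp add: complex_eq_iff)
    have "f w = Re w * f 1 + Im w * f \<i>" for w
      by (subst e) (simp only: f.add f.scaleR real_scaleR_def)
    from this[of w] this[of z0] show ?thesis by (simp add: algebra_simps)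
  qed
  then show ?case
    by (intro trig_poly.cong[OF trig_poly.add[OF trig_poly.mono[of z0 R "Complex (f 1) (- f \<i>)" 1]
        trig_poly.mono[of z0 R "of_real (f z0)" 0]]]) (rule sym)
next
  case (const c)
  show ?case using trig_poly.mono[of z0 R "of_real c" 0] by simp
next
  case (add f g)
  show ?case by (intro trig_poly.add add.IH)
next
  case (mult f g)
  show ?case by (intro trig_poly_mult mult.IH)
qed

lemma trig_poly_holomorphic:
  "trig_poly z0 R g \<Longrightarrow> \<exists>f. f holomorphic_on UNIV \<and> (\<forall>w\<in>sphere z0 R. g w = Re (f w))"
proof (induction rule: trig_poly.induct)
  case (mono c n)
  show ?case by (intro exI[of _ "\<lambda>w. c * (w - z0) ^ n"] conjI holomorphic_intros) auto
next
  case (add g h)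
  then obtain f f' where "f holomorphic_on UNIV" "f' holomorphic_on UNIV"
      "\<forall>w\<in>sphere z0 R. g w = Re (f w)" "\<forall>w\<in>sphere z0 R. h w = Re (f' w)" by blast
  then show ?case by (intro exI[of _ "\<lambda>w. f w + f' w"]) (auto intro!: holomorphic_intros)
qed auto

text \<open>On a circle, real polynomials in the coordinates are real parts of complex polynomials, so
  the Stone--Weierstrass theorem supplies harmonic majorants of continuous boundary values without
  the Poisson kernel.\<close>

lemma submean_local_to_global:
  assumes cont: "continuous_on (cball z0 R) v" and R: "0 < R"
    and sub: "\<And>z. z \<in> ball z0 R \<Longrightarrow> submean_at v z"
  shows "v z0 \<le> circle_mean v z0 R"
proof (rule field_le_epsilon)
  fix e :: real assume "0 < e"
  have cs: "continuous_on (sphere z0 R) v" by (rule continuous_on_subset[OF cont]) auto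
  obtain g where g: "real_polynomial_function g" "\<And>w. w \<in> sphere z0 R \<Longrightarrow> \<bar>v w - g w\<bar> < e / 2"
    using Stone_Weierstrass_real_polynomial_function[OF compact_sphere cs, of "e/2"] \<open>0 < e\<close> by auto
  obtain f where f: "f holomorphic_on UNIV" "\<And>w. w \<in> sphere z0 R \<Longrightarrow> g w = Re (f w)"
    using trig_poly_holomorphic[OF real_polynomial_function_trig_poly[OF g(1)]] by blast
  have cf: "continuous_on S (\<lambda>w. Re (f w))" for S
    by (rule continuous_on_subset[OF continuous_on_Re[OF holomorphic_on_imp_continuous_on[OF f(1)]]]) simp
  have hf: "circle_mean (\<lambda>w. Re (f w)) z r = Re (f z)" if "0 < r" for z r
    using that by (intro circle_mean_holomorphic holomorphic_on_subset[OF f(1)]) auto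
  have "v z0 - Re (f z0) \<le> e / 2"
  proof (rule submean_max_principle[of z0 R "\<lambda>w. v w - Re (f w)"])
    show "continuous_on (cball z0 R) (\<lambda>w. v w - Re (f w))" by (intro continuous_intros cont cf)
    show "v z - Re (f z) \<le> e / 2" if "z \<in> sphere z0 R" for z using g(2)[OF that] f(2)[OF that] by linarith
    show "submean_at (\<lambda>w. v w - Re (f w)) z" if z: "z \<in> ball z0 R" for z
    proof -
      obtain d where d: "d > 0" "\<And>r. 0 < r \<Longrightarrow> r < d \<Longrightarrow> v z \<le> circle_mean v z r"
        using sub[OF z] by (auto simp: submean_at_def)
      have "v z - Re (f z) \<le> circle_mean (\<lambda>w. v w - Re (f w)) z r"
        if r: "0 < r" "r < min d (R - dist z0 z)" for r
      proof -
        have "sphere z r \<subseteq> cball z0 R"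
        proof
          fix x assume "x \<in> sphere z r"
          then show "x \<in> cball z0 R" using r dist_triangle[of z0 x z] by auto
        qed
        then have "continuous_on (sphere z r) v" by (rule continuous_on_subset[OF cont])
        then have "circle_mean (\<lambda>w. v w + (-1) * Re (f w)) z r
            = circle_mean v z r + circle_mean (\<lambda>w. (-1) * Re (f w)) z r"
          using r by (intro circle_mean_add continuous_intros cf) auto
        then show ?thesis using d(2)[of r] r hf[of r z] circle_mean_cmult[of "-1"] by simp
      qed
      then show ?thesis unfolding submean_at_def
        using z d(1) by (intro exI[of _ "min d (R - dist z0 z)"]) auto
    qed
  qed (use R in auto)
  moreover have "circle_mean (\<lambda>w. Re (f w)) z0 R \<le> circle_mean (\<lambda>w. v w + e / 2) z0 R"
  proof (intro circle_mean_mono cf continuous_intros cs)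
    fix x assume x: "x \<in> sphere z0 R"
    show "Re (f x) \<le> v x + e / 2" using g(2)[OF x] f(2)[OF x] by linarith
  qed (use R in auto)
  moreover have "circle_mean (\<lambda>w. v w + e / 2) z0 R = circle_mean v z0 R + e / 2"
    using R by (subst circle_mean_add) (auto intro: cs)
  ultimately show "v z0 \<le> circle_mean v z0 R + e" using hf[OF R] by simp
qed

lemma subharmonic_onI:
  assumes "open \<Omega>" "continuous_on \<Omega> v" "\<And>z. z \<in> \<Omega> \<Longrightarrow> submean_at v z"
  shows "subharmonic_on \<Omega> v"
  unfolding subharmonic_on_def
proof (intro conjI ballI allI impI)
  fix z a assume "z \<in> \<Omega>" "v z < a"
  then have "(v \<longlongrightarrow> v z) (at z)"
    using assms(1,2) by (simp add: continuous_on_eq_continuous_at isCont_def)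
  then show "\<forall>\<^sub>F w in at z. v w < a" using \<open>v z < a\<close> by (rule order_tendstoD(2))
next
  fix z r assume r: "0 < (r::real)" "cball z r \<subseteq> \<Omega>"
  have c: "continuous_on (cball z r) v" by (rule continuous_on_subset[OF assms(2) r(2)])
  show "set_integrable lborel {0..2*pi} (\<lambda>t. v (z + of_real r * cis t))"
    using r(1) by (intro circle_integrable continuous_on_subset[OF c]) auto
  show "v z \<le> (LINT t:{0..2*pi}|lborel. v (z + of_real r * cis t)) / (2 * pi)"
    using submean_local_to_global[OF c r(1)] assms(3) r(2) by (force simp: circle_mean_def)
qed

text \<open>Touching from below: circle means are monotone, so the property passes to a larger
  function that agrees at the point. This is how maxima are treated.\<close>

lemma submean_at_ge:
  assumes z: "z \<in> \<Omega>" "open \<Omega>" and c: "continuous_on \<Omega> v" "continuous_on \<Omega> w"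
    and "submean_at w z" "v z = w z" and ev: "\<forall>\<^sub>F x in nhds z. w x \<le> v x"
  shows "submean_at v z"
proof -
  obtain e where e: "e > 0" "\<And>r. 0 < r \<Longrightarrow> r < e \<Longrightarrow> w z \<le> circle_mean w z r"
    using assms(5) by (auto simp: submean_at_def)
  obtain e1 where e1: "e1 > 0" "ball z e1 \<subseteq> \<Omega>" using z openE by blast
  obtain e2 where e2: "e2 > 0" "\<And>x. dist x z < e2 \<Longrightarrow> w x \<le> v x"
    using ev unfolding eventually_nhds_metric by blast
  define d where "d = min e (min e1 e2)"
  have "v z \<le> circle_mean v z r" if r: "0 < r" "r < d" for r
  proof -
    have s: "sphere z r \<subseteq> \<Omega>" using e1(2) r by (auto simp: d_def subset_iff)
    have "v z \<le> circle_mean w z r" using e(2)[of r] r assms(6) by (simp add: d_def)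
    also have "\<dots> \<le> circle_mean v z r"
      using r s by (intro circle_mean_mono continuous_on_subset[OF c(1)] continuous_on_subset[OF c(2)] e2(2))
         (auto simp: d_def dist_commute)
    finally show ?thesis .
  qed
  then show ?thesis unfolding submean_at_def using e e1 e2 by (intro exI[of _ d]) (auto simp: d_def)
qed

lemma submean_at_const: "submean_at (\<lambda>_. c) z"
  unfolding submean_at_def by (intro exI[of _ 1]) simp

section \<open>Positivity of Perron solutions\<close>

text \<open>Continuous members of the lower Perron class, with the limes superior at the boundary
  expressed by real thresholds.\<close>

definition competitor :: "complex set \<Rightarrow> (complex \<Rightarrow> real) \<Rightarrow> (complex \<Rightarrow> real) \<Rightarrow> bool" where
  "competitor \<Omega> f v \<longleftrightarrow> continuous_on \<Omega> v \<and> (\<forall>z\<in>\<Omega>. submean_at v z) \<and> bdd_above (v ` \<Omega>) \<and>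
     (\<forall>\<zeta>\<in>frontier \<Omega>. \<forall>a>f \<zeta>. \<forall>\<^sub>F w in at \<zeta> within \<Omega>. v w < a)"

lemma competitor_le_perron:
  assumes "open \<Omega>" "competitor \<Omega> f v"
  shows "ereal (v z) \<le> perron_solution \<Omega> f z"
  unfolding perron_solution_def
proof (rule SUP_upper, clarsimp, intro conjI ballI)
  show "subharmonic_on \<Omega> v"
    using assms by (intro subharmonic_onI) (auto simp: competitor_def)
  show "bdd_above (v ` \<Omega>)" using assms by (simp add: competitor_def)
  fix \<zeta> assume \<zeta>: "\<zeta> \<in> frontier \<Omega>"
  show "Limsup (at \<zeta> within \<Omega>) (\<lambda>w. ereal (v w)) \<le> ereal (f \<zeta>)"
    unfolding Limsup_le_iff
  proof (intro allI impI)
    fix y assume y: "ereal (f \<zeta>) < y"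
    show "\<forall>\<^sub>F w in at \<zeta> within \<Omega>. ereal (v w) < y"
    proof (cases y)
      case (real a)
      then show ?thesis using assms(2) \<zeta> y by (auto simp: competitor_def)
    qed (use y in auto)
  qed
qed

text \<open>A substitute for Harnack's inequality on a disc. The competitor is raised to
  \<open>b\<close>, which is harmonic in an annulus, equals \<open>\<delta>\<close> on the small
  disc and 0 on the outer circle; nonnegative data permit the truncation at 0.\<close>

lemma competitor_spread:
  assumes op: "open \<Omega>" and f: "\<And>\<zeta>. \<zeta> \<in> frontier \<Omega> \<Longrightarrow> 0 \<le> f \<zeta>"
    and v: "competitor \<Omega> f v" and a: "0 < v a" and R: "0 < R" "cball a R \<subseteq> \<Omega>" and z: "z \<in> ball a R"
  shows "\<exists>u. competitor \<Omega> f u \<and> 0 < u z"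
proof -
  have cv: "continuous_on \<Omega> v" and sv: "\<And>z. z \<in> \<Omega> \<Longrightarrow> submean_at v z" and bv: "bdd_above (v ` \<Omega>)"
    using v by (auto simp: competitor_def)
  have aO: "a \<in> \<Omega>" using R by auto
  then have "isCont v a" using cv op by (simp add: continuous_on_eq_continuous_at)
  then have "\<forall>\<^sub>F x in nhds a. v a / 2 < v x"
    using a unfolding isCont_def tendsto_at_iff_tendsto_nhds by (intro order_tendstoD(1)) auto
  then obtain r0 where r0: "r0 > 0" "\<And>x. dist x a < r0 \<Longrightarrow> v a / 2 < v x"
    unfolding eventually_nhds_metric by blast
  define r where "r = min (r0 / 2) (R / 2)"
  have r: "0 < r" "r < R" "r < r0" using r0(1) R(1) by (auto simp: r_def)
  define \<delta> where "\<delta> = v a / 2"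
  have \<delta>: "\<delta> > 0" "\<And>x. dist x a \<le> r \<Longrightarrow> \<delta> < v x" using a r0(2) r(3) by (auto simp: \<delta>_def)
  define b where "b = (\<lambda>w. \<delta> * (ln R - ln (max (cmod (w - a)) r)) / (ln R - ln r))"
  have lr: "ln R - ln r > 0" using r by simp
  have cb: "continuous_on S b" for S
    unfolding b_def by (intro continuous_intros) (use r lr in auto)
  have b\<delta>: "b w \<le> \<delta>" for w
  proof -
    have "ln r \<le> ln (max (cmod (w - a)) r)" using r by (subst ln_le_cancel_iff) auto
    then show ?thesis using lr \<delta> by (simp add: b_def divide_le_eq)
  qed
  define u where "u = (\<lambda>w. max (v w) (max (b w) 0))"
  have cu: "continuous_on \<Omega> u" unfolding u_def by (intro continuous_intros cv cb)
  have b0: "b w \<le> 0" if "dist w a \<ge> R" for w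
  proof -
    have "ln R \<le> ln (max (cmod (w - a)) r)"
      using that R(1) by (subst ln_le_cancel_iff) (auto simp: dist_norm)
    then show ?thesis using lr \<delta> by (simp add: b_def divide_le_0_iff mult_le_0_iff)
  qed
  have "submean_at u w" if w: "w \<in> \<Omega>" for w
  proof -
    have "u w = v w \<or> u w = 0 \<or> u w = b w" by (simp add: u_def max_def)
    then consider "u w = v w" | "u w = 0" | "u w \<noteq> v w" "u w = b w" by blast
    then show ?thesis
    proof cases
      case 1
      show ?thesis
        by (rule submean_at_ge[OF w op cu cv sv[OF w] 1]) (simp add: u_def)
    next
      case 2
      show ?thesis
        by (rule submean_at_ge[OF w op cu _ submean_at_const[of 0] 2]) (auto simp: u_def le_max_iff_disj)
    next
      case 3
      \<comment> \<open>On the small disc \<open>v\<close> exceeds the plateau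
        \<open>\<delta>\<close>, so the concave kink of \<open>b\<close> at radius \<open>r\<close>,
        where the sub-mean inequality fails, stays below the maximum.\<close>
      have "dist w a > r"
      proof (rule ccontr)
        assume "\<not> r < dist w a"
        then have "\<delta> < v w" using \<delta>(2) by simp
        then have "u w = v w" using b\<delta>[of w] \<delta>(1) by (auto simp: u_def)
        with 3 show False by simp
      qed
      have "submean_at b w" unfolding submean_at_def
      proof (intro exI[of _ "dist w a - r"] conjI allI impI)
        show "0 < dist w a - r" using \<open>dist w a > r\<close> by simp
        fix s assume s: "0 < s \<and> s < dist w a - r"
        define c0 where "c0 = \<delta> * ln R / (ln R - ln r)"
        define c1 where "c1 = - (\<delta> / (ln R - ln r))"
        have beq: "b x = c0 + c1 * ln (cmod (x - a))" if "x = w \<or> x \<in> sphere w s" for x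
        proof -
          have "dist x a > r" using that s \<open>dist w a > r\<close> dist_triangle[of w a x] by auto
          then show ?thesis by (simp add: b_def c0_def c1_def dist_norm max_def right_diff_distrib diff_divide_distrib)
        qed
        have nz: "x \<noteq> a" if "x \<in> sphere w s" for x using that s r by auto
        have "circle_mean b w s = circle_mean (\<lambda>x. c0 + c1 * ln (cmod (x - a))) w s"
          using s beq by (intro circle_mean_cong) auto
        also have "\<dots> = c0 + c1 * circle_mean (\<lambda>x. ln (cmod (x - a))) w s"
          using s nz by (subst circle_mean_add) (auto simp: circle_mean_cmult intro!: continuous_intros)
        also have "\<dots> = c0 + c1 * ln (cmod (w - a))"
          using s r by (subst circle_mean_ln_norm) auto
        also have "\<dots> = b w" using beq[of w] by simp
        finally show "b w \<le> circle_mean b w s" by simp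
      qed
      then show ?thesis
        by (rule submean_at_ge[OF w op cu cb _ 3(2)]) (auto simp: u_def le_max_iff_disj)
    qed
  qed
  moreover have "bdd_above (u ` \<Omega>)"
  proof -
    obtain M where M: "\<And>x. x \<in> \<Omega> \<Longrightarrow> v x \<le> M" using bv by (auto simp: bdd_above_def)
    show ?thesis
    proof (rule bdd_aboveI2)
      fix x assume "x \<in> \<Omega>"
      then show "u x \<le> max M \<delta>" using M[of x] b\<delta>[of x] \<delta>(1)
        unfolding u_def max_def by (simp split: if_split)
    qed
  qed
  moreover have "\<forall>\<^sub>F w in at \<zeta> within \<Omega>. u w < c" if \<zeta>: "\<zeta> \<in> frontier \<Omega>" and c: "f \<zeta> < c" for \<zeta> c
  proof -
    have "\<zeta> \<notin> cball a R" using \<zeta> R(2) op by (auto simp: frontier_def interior_open)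
    then have "\<forall>\<^sub>F w in at \<zeta> within \<Omega>. w \<in> - cball a R"
      by (intro topological_tendstoD[OF tendsto_ident_at]) (auto simp: open_Compl)
    moreover have "\<forall>\<^sub>F w in at \<zeta> within \<Omega>. v w < c" using v \<zeta> c by (auto simp: competitor_def)
    ultimately show ?thesis
    proof eventually_elim
      case (elim w)
      have "b w \<le> 0" using elim by (intro b0) (auto simp: dist_commute)
      moreover have "0 < c" using f[OF \<zeta>] c by simp
      ultimately show ?case using elim by (auto simp: u_def)
    qed
  qed
  ultimately have "competitor \<Omega> f u" using cu by (auto simp: competitor_def)
  moreover have "0 < u z"
  proof -
    have "ln (max (cmod (z - a)) r) < ln R"
      using z r by (subst ln_less_cancel_iff) (auto simp: dist_norm norm_minus_commute)
    then have "b z > 0" using lr \<delta> by (simp add: b_def)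
    then show ?thesis by (simp add: u_def)
  qed
  ultimately show ?thesis by blast
qed

text \<open>The points at which some competitor is positive form an open set with relatively open
  complement, so connectedness carries positivity from \<open>z0\<close> to every pole.\<close>

lemma perron_solution_pos:
  assumes dom: "planar_domain \<Omega>" and f: "\<And>\<zeta>. \<zeta> \<in> frontier \<Omega> \<Longrightarrow> 0 \<le> f \<zeta>"
    and v: "competitor \<Omega> f v" "0 < v z0" "z0 \<in> \<Omega>" and z: "z \<in> \<Omega>"
  shows "0 < perron_solution \<Omega> f z"
proof -
  have op: "open \<Omega>" and con: "connected \<Omega>" using dom by (auto simp: planar_domain_def)
  define A where "A = {z \<in> \<Omega>. \<exists>u. competitor \<Omega> f u \<and> 0 < u z}"
  have key: "\<exists>R>0. ball x R \<subseteq> \<Omega> \<and> (\<forall>y\<in>ball x R. y \<in> A \<longrightarrow> ball x R \<subseteq> A)" if x: "x \<in> \<Omega>" for x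
  proof -
    obtain R where R: "R > 0" "cball x R \<subseteq> \<Omega>" using op x open_contains_cball by blast
    have "ball x (R / 4) \<subseteq> A" if y: "y \<in> ball x (R / 4)" "y \<in> A" for y
    proof
      fix w assume w: "w \<in> ball x (R / 4)"
      have sub: "cball y (R / 2) \<subseteq> \<Omega>"
      proof
        fix p assume "p \<in> cball y (R / 2)"
        then have "dist x p \<le> R" using y(1) dist_triangle[of x p y] R(1) by auto
        then show "p \<in> \<Omega>" using R(2) by auto
      qed
      obtain u where u: "competitor \<Omega> f u" "0 < u y" using y(2) by (auto simp: A_def)
      have wy: "w \<in> ball y (R / 2)"
        using w y(1) dist_triangle[of y w x] by (auto simp: dist_commute)
      obtain u' where "competitor \<Omega> f u'" "0 < u' w"
        using competitor_spread[OF op f u _ sub wy] R(1) by auto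
      moreover have "w \<in> \<Omega>" using wy sub by auto
      ultimately show "w \<in> A" by (auto simp: A_def)
    qed
    moreover have "ball x (R / 4) \<subseteq> \<Omega>" using R by (auto simp: subset_iff)
    ultimately show ?thesis using R(1) by (intro exI[of _ "R/4"]) simp
  qed
  have "open A" unfolding open_contains_ball
    using key A_def by (metis (no_types, lifting) centre_in_ball mem_Collect_eq)
  moreover have "open (\<Omega> - A)" unfolding open_contains_ball
  proof
    fix x assume x: "x \<in> \<Omega> - A"
    then obtain R where "R > 0" "ball x R \<subseteq> \<Omega>" "\<forall>y\<in>ball x R. y \<in> A \<longrightarrow> ball x R \<subseteq> A" using key by blast
    then show "\<exists>e>0. ball x e \<subseteq> \<Omega> - A" using x by (metis DiffE DiffI centre_in_ball subsetD subsetI)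
  qed
  ultimately have "A \<inter> \<Omega> = {} \<or> (\<Omega> - A) \<inter> \<Omega> = {}"
    by (intro connectedD[OF con]) auto
  moreover have "z0 \<in> A \<inter> \<Omega>" using v by (auto simp: A_def)
  ultimately have "z \<in> A" using z by blast
  then obtain u where u: "competitor \<Omega> f u" "0 < u z" using z by (auto simp: A_def)
  then have "0 < ereal (u z)" by simp
  also have "\<dots> \<le> perron_solution \<Omega> f z" by (rule competitor_le_perron[OF op u(1)])
  finally show ?thesis .
qed

section \<open>A Cantor set with solid squares\<close>

text \<open>Critical ratio for dimension one: the radii of 2200 children add up to the radius of the
  parent.\<close>

definition rr :: real where "rr = 1 / 2200"

lemma rr_pos [simp]: "0 < rr" "0 \<le> rr" and rr_less_1 [simp]: "rr < 1" "rr \<le> 1" and rr_ne_0 [simp]: "rr \<noteq> 0"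
  by (auto simp: rr_def)

lemma rr_power [simp]: "0 < rr ^ n" "rr ^ n \<le> 1"
  by (auto simp: power_le_one)

text \<open>The inner circles, of radii 26/100 to 46/100, lie with their discs inside radius 1/2.
  The gap between 1/2 and 3/4 makes the kernel large at the inner children.\<close>

definition ring_radius :: "nat \<Rightarrow> real" where
  "ring_radius i = (if i = 0 then 3/4 else 1/4 + real i / 100)"

text \<open>The children with index below 100 lie on the outer circle; they shield the 2100 children on
  the 21 inner circles like a Faraday cage.\<close>

definition child_pos :: "nat \<Rightarrow> complex" where
  "child_pos l = of_real (ring_radius (l div 100)) * cis (2 * pi * real l / 100)"

lemma norm_child_pos: "cmod (child_pos l) = ring_radius (l div 100)"
  by (simp add: child_pos_def norm_mult ring_radius_def)

lemma norm_child_pos_bounds: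
  assumes "l < 2200"
  shows "26/100 \<le> cmod (child_pos l)" "cmod (child_pos l) \<le> 3/4"
    "100 \<le> l \<Longrightarrow> cmod (child_pos l) \<le> 46/100" "l < 100 \<Longrightarrow> cmod (child_pos l) = 3/4"
proof -
  have "l div 100 \<le> 21" using assms by (simp add: less_mult_imp_div_less flip: less_Suc_eq_le)
  moreover have "100 \<le> l \<Longrightarrow> 1 \<le> l div 100" by (simp add: div_greater_zero_iff Suc_le_eq)
  ultimately show "26/100 \<le> cmod (child_pos l)" "cmod (child_pos l) \<le> 3/4"
    "100 \<le> l \<Longrightarrow> cmod (child_pos l) \<le> 46/100" "l < 100 \<Longrightarrow> cmod (child_pos l) = 3/4"
    unfolding norm_child_pos ring_radius_def by auto
qed

text \<open>On the smallest circle, of radius 26/100, chords must have length at least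
  \<open>22 * rr\<close>, that is 1/100; the number 74/100000 just suffices. By symmetry and
  monotonicity the angle \<open>2 * pi / 100\<close> is the worst.\<close>

lemma cos_two_pi_div_100: 
  assumes "1 \<le> d" "d \<le> 99"
  shows "cos (2 * pi * d / 100) \<le> 1 - 74/100000"
proof -
  define y where "y = pi / 100"
  have y: "3/100 < y" "y \<le> pi / 6" using pi_gt3 by (auto simp: y_def)
  have "\<exists>\<xi>. 0 < \<xi> \<and> \<xi> < y \<and> sin y - sin 0 = (y - 0) * cos \<xi>"
    by (rule MVT2) (use y in \<open>auto intro!: derivative_eq_intros\<close>)
  then obtain \<xi> where \<xi>: "0 < \<xi>" "\<xi> < y" "sin y = y * cos \<xi>" by auto
  have "cos (pi / 6) \<le> cos \<xi>" using \<xi> y pi_gt3 by (intro cos_monotone_0_pi_le) auto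
  moreover have "5/3 < sqrt 3" by (rule real_less_rsqrt) (simp add: power2_eq_square)
  ultimately have "5/6 < cos \<xi>" by (simp add: cos_30)
  then have "3/100 * (5/6) < sin y" unfolding \<xi>(3) using y by (intro mult_strict_mono) auto
  then have "(3/100 * (5/6))\<^sup>2 < (sin y)\<^sup>2" by (intro power_strict_mono) auto
  moreover have c1: "cos (2 * pi / 100) = 1 - 2 * (sin y)\<^sup>2"
    using cos_double_sin[of y] by (simp add: y_def)
  ultimately have *: "cos (2 * pi / 100) \<le> 1 - 74/100000" by (simp add: power2_eq_square)
  show ?thesis
  proof (cases "d \<le> 50")
    case True
    have "2 * pi * 1 \<le> 2 * pi * d" "pi * d \<le> pi * 50"
      using assms True pi_gt_zero by (intro mult_left_mono; simp)+
    then have "cos (2 * pi * d / 100) \<le> cos (2 * pi / 100)"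
      using pi_gt_zero by (intro cos_monotone_0_pi_le) auto
    with * show ?thesis by simp
  next
    case False
    have "pi + pi * d \<le> 100 * pi" "50 * pi \<le> pi * d"
      using mult_left_mono[of "1 + d" 100 pi] mult_left_mono[of 50 d pi] assms False pi_gt_zero
      by (simp_all add: algebra_simps)
    then have "cos (2 * pi - 2 * pi * d / 100) \<le> cos (2 * pi / 100)"
      using pi_gt_zero by (intro cos_monotone_0_pi_le; linarith)
    moreover have "cos (2 * pi - 2 * pi * d / 100) = cos (2 * pi * d / 100)"
      by (simp add: cos_diff)
    ultimately show ?thesis using * by simp
  qed
qed

text \<open>Points of one circle are separated by the chord bound, different circles by the spacing
  1/100 of the radii. Removing two radii \<open>rr\<close> leaves the factor 20 of the later
  separation estimates.\<close>

lemma dist_child_pos: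
  assumes "l < 2200" "l' < 2200" "l \<noteq> l'"
  shows "22 * rr \<le> dist (child_pos l) (child_pos l')"
proof (cases "l div 100 = l' div 100")
  case True
  have *: "22 * rr \<le> dist (child_pos l) (child_pos l')"
    if "l < 2200" "l' < l" "l div 100 = l' div 100" for l l'
  proof -
    define R where "R = ring_radius (l div 100)"
    define d where "d = real l - real l'"
    have R: "26/100 \<le> R" using norm_child_pos_bounds(1)[OF that(1)] by (simp add: R_def norm_child_pos)
    have "l < l' + 100"
      using that(3) div_mult_mod_eq[of l 100] div_mult_mod_eq[of l' 100] mod_less_divisor[of 100 l] by linarith
    then have d: "1 \<le> d" "d \<le> 99" using that by (auto simp: d_def)
    define \<alpha> \<beta> where "\<alpha> = 2 * pi * real l / 100" and "\<beta> = 2 * pi * real l' / 100"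
    have "dist (child_pos l) (child_pos l') = cmod (of_real R * (cis \<alpha> - cis \<beta>))"
      using that(3) by (simp add: child_pos_def R_def dist_norm \<alpha>_def \<beta>_def algebra_simps)
    then have "(dist (child_pos l) (child_pos l'))\<^sup>2 = R\<^sup>2 * (cmod (cis \<alpha> - cis \<beta>))\<^sup>2"
      by (simp add: norm_mult power_mult_distrib)
    also have "(cmod (cis \<alpha> - cis \<beta>))\<^sup>2 = 2 - 2 * cos (\<alpha> - \<beta>)"
      unfolding cmod_power2 cos_diff using sin_cos_squared_add[of \<alpha>] sin_cos_squared_add[of \<beta>]
      by (simp add: power2_eq_square algebra_simps)
    also have "\<alpha> - \<beta> = 2 * pi * d / 100" by (simp add: \<alpha>_def \<beta>_def d_def algebra_simps diff_divide_distrib)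
    finally have e: "(dist (child_pos l) (child_pos l'))\<^sup>2 = R\<^sup>2 * (2 - 2 * cos (2 * pi * d / 100))" .
    have "(26/100)\<^sup>2 * (148/100000) \<le> R\<^sup>2 * (2 - 2 * cos (2 * pi * d / 100))"
      using R cos_two_pi_div_100[OF d] by (intro mult_mono power_mono) auto
    then have "(22 * rr)\<^sup>2 \<le> (dist (child_pos l) (child_pos l'))\<^sup>2"
      unfolding e by (simp add: rr_def power2_eq_square)
    then show ?thesis by (rule power2_le_imp_le) simp
  qed
  show ?thesis
    using *[of l l'] *[of l' l] assms True by (cases "l' < l") (auto simp: dist_commute)
next
  case False
  have b: "l div 100 \<le> 21" "l' div 100 \<le> 21"
    using assms by (auto simp: less_mult_imp_div_less simp flip: less_Suc_eq_le)
  have "22 * rr \<le> \<bar>ring_radius (l div 100) - ring_radius (l' div 100)\<bar>"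
    using False b unfolding ring_radius_def rr_def by (auto simp: abs_if)
  also have "\<dots> \<le> dist (child_pos l) (child_pos l')"
    unfolding norm_child_pos[symmetric] dist_norm by (rule norm_triangle_ineq3)
  finally show ?thesis .
qed

section \<open>Words, similarities and separation of discs\<close>

fun emb :: "nat list \<Rightarrow> complex \<Rightarrow> complex" where
  "emb [] z = z"
| "emb (l # w) z = child_pos l + of_real rr * emb w z"

text \<open>The first argument is the state of the parent: the number of outer minus the number of inner
  letters on the way to it. An inner child of a parent in state 0 is dead and carries a solid
  square; all other children are live.\<close>

fun live :: "nat \<Rightarrow> nat list \<Rightarrow> bool" where
  "live k [] \<longleftrightarrow> True"
| "live k (l # w) \<longleftrightarrow> l < 2200 \<and> (if l < 100 then live (Suc k) w else 0 < k \<and> live (k - 1) w)"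

fun dead :: "nat \<Rightarrow> nat list \<Rightarrow> bool" where
  "dead k [] \<longleftrightarrow> False"
| "dead k (l # w) \<longleftrightarrow> l < 2200 \<and> (if l < 100 then dead (Suc k) w else if k = 0 then w = [] else dead (k - 1) w)"

definition node :: "nat \<Rightarrow> nat list \<Rightarrow> bool" where
  "node k w \<longleftrightarrow> live k w \<or> dead k w"

definition rad :: "nat list \<Rightarrow> real" where "rad w = rr ^ length w"

definition disc :: "nat list \<Rightarrow> complex set" where "disc w = emb w ` cball 0 1"

lemma rad_pos [simp]: "0 < rad w" "0 \<le> rad w" "rad w \<le> 1"
  by (auto simp: rad_def less_imp_le)

lemma rad_Nil [simp]: "rad [] = 1" by (simp add: rad_def)

lemma emb_append: "emb (u @ v) z = emb u (emb v z)"
  by (induction u) auto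

lemma emb_affine: "emb w z = emb w 0 + of_real (rad w) * z"
proof (induction w)
  case (Cons l w)
  have "emb (l # w) z = child_pos l + of_real rr * (emb w 0 + of_real (rad w) * z)"
    unfolding emb.simps Cons[symmetric] ..
  then show ?case by (simp add: rad_def algebra_simps)
qed simp

lemma dist_emb: "dist (emb w z) (emb w z') = rad w * dist z z'"
  unfolding emb_affine[of w z] emb_affine[of w z'] dist_norm
  by (simp add: norm_mult flip: right_diff_distrib)

lemma emb_image: "emb w ` S = {z. (z - emb w 0) / of_real (rad w) \<in> S}"
proof (intro equalityI subsetI)
  fix z assume "z \<in> {z. (z - emb w 0) / of_real (rad w) \<in> S}"
  moreover have "z = emb w ((z - emb w 0) / of_real (rad w))"
    by (subst emb_affine) (simp add: rad_def)
  ultimately show "z \<in> emb w ` S" by blast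
next
  fix z assume "z \<in> emb w ` S"
  then obtain s where s: "s \<in> S" "z = emb w s" by blast
  have "(z - emb w 0) / of_real (rad w) = s"
    unfolding s(2) emb_affine[of w s] by (simp add: rad_def)
  then show "z \<in> {z. (z - emb w 0) / of_real (rad w) \<in> S}" using s by simp
qed

lemma disc_eq: "disc w = cball (emb w 0) (rad w)"
  unfolding disc_def emb_image
  by (auto simp: dist_norm norm_divide divide_le_eq norm_minus_commute)

lemma node_letters: "node k w \<Longrightarrow> set w \<subseteq> {..<2200}"
  unfolding node_def
  by (induction w arbitrary: k) (auto split: if_splits)

lemma emb_Cons_in_cball:
  assumes "z \<in> cball 0 1"
  shows "child_pos l + of_real rr * z \<in> cball (child_pos l) rr"
  using assms by (simp add: dist_norm norm_mult mult_left_le)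

lemma emb_in_cball:
  assumes "set w \<subseteq> {..<2200}" "z \<in> cball 0 1"
  shows "emb w z \<in> cball 0 1"
  using assms
proof (induction w)
  case (Cons l w)
  then have "emb w z \<in> cball 0 1" by simp
  then have "cmod (of_real rr * emb w z) \<le> rr" by (simp add: norm_mult mult_left_le)
  moreover have "cmod (child_pos l) \<le> 3/4" using Cons.prems norm_child_pos_bounds(2) by simp
  ultimately show ?case
    using norm_triangle_ineq[of "child_pos l" "of_real rr * emb w z"] by (simp add: rr_def)
qed simp

lemma disc_append: "set v \<subseteq> {..<2200} \<Longrightarrow> disc (u @ v) \<subseteq> disc u"
  unfolding disc_def emb_append using emb_in_cball by blast

lemma disc_prefix: "prefix u w \<Longrightarrow> node k w \<Longrightarrow> disc w \<subseteq> disc u"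
  using disc_append node_letters by (fastforce simp: prefix_def)

lemma emb_0_in_disc [simp]: "emb w 0 \<in> disc w"
  by (simp add: disc_def)

lemma dist_emb_parallel:
  assumes "l < 2200" "l' < 2200" "l \<noteq> l'" "set v \<subseteq> {..<2200}" "set v' \<subseteq> {..<2200}"
    and z: "z \<in> disc (u @ l # v)" and z': "z' \<in> disc (u @ l' # v')"
  shows "20 * rr ^ Suc (length u) \<le> dist z z'"
proof -
  obtain x where x: "x \<in> cball 0 1" "z = emb u (child_pos l + of_real rr * emb v x)"
    using z by (auto simp: disc_def emb_append)
  obtain x' where x': "x' \<in> cball 0 1" "z' = emb u (child_pos l' + of_real rr * emb v' x')"
    using z' by (auto simp: disc_def emb_append)
  define p where "p = child_pos l + of_real rr * emb v x"
  define p' where "p' = child_pos l' + of_real rr * emb v' x'"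
  have "dist (child_pos l) p \<le> rr" "dist (child_pos l') p' \<le> rr"
    using emb_Cons_in_cball[OF emb_in_cball[OF assms(4) x(1)], of l]
      emb_Cons_in_cball[OF emb_in_cball[OF assms(5) x'(1)], of l'] by (auto simp: p_def p'_def)
  then have "20 * rr \<le> dist p p'"
    using dist_child_pos[OF assms(1-3)] dist_triangle[of "child_pos l" "child_pos l'" p]
      dist_triangle[of p "child_pos l'" p'] by (simp add: dist_commute)
  then have "rad u * (20 * rr) \<le> rad u * dist p p'" by (intro mult_left_mono) auto
  then show ?thesis unfolding x x' by (simp add: p_def p'_def dist_emb rad_def)
qed

lemma node_parallel_dist:
  assumes w: "node k w" "node k w'" and p: "\<not> prefix w w'" "\<not> prefix w' w"
  obtains m where "m < length w" "m < length w'" "take m w = take m w'"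
    "\<And>z z'. z \<in> disc w \<Longrightarrow> z' \<in> disc w' \<Longrightarrow> 20 * rr ^ Suc m \<le> dist z z'"
proof -
  have "w \<parallel> w'" using p by (intro parallelI) auto
  then obtain u l v l' v' where d: "l \<noteq> l'" "w = u @ l # v" "w' = u @ l' # v'"
    using parallel_decomp by blast
  have s: "set w \<subseteq> {..<2200}" "set w' \<subseteq> {..<2200}" using w node_letters by auto
  show ?thesis
  proof (rule that[of "length u"])
    show "20 * rr ^ Suc (length u) \<le> dist z z'" if "z \<in> disc w" "z' \<in> disc w'" for z z'
      by (rule dist_emb_parallel[of l l' v v' z u z']) (use s d that in auto)
  qed (use d in auto)
qed

text \<open>The words part at a common ancestor, whose children are at least as large as either
  disc, so the gap is large relative to both.\<close>

lemma node_parallel_dist_rad: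
  assumes w: "node k w" "node k w'" and p: "\<not> prefix w w'" "\<not> prefix w' w"
    and z: "z \<in> disc w" "z' \<in> disc w'"
  shows "20 * rad w \<le> dist z z'" "20 * rad w' \<le> dist z z'"
proof -
  obtain m where m: "m < length w" "m < length w'" "20 * rr ^ Suc m \<le> dist z z'"
    using node_parallel_dist[OF w p] z by metis
  then have "rr ^ length w \<le> rr ^ Suc m" "rr ^ length w' \<le> rr ^ Suc m"
    by (intro power_decreasing; simp)+
  then show "20 * rad w \<le> dist z z'" "20 * rad w' \<le> dist z z'" using m(3) by (auto simp: rad_def)
qed

lemma node_disc_inter:
  assumes "node k w" "node k w'" "z \<in> disc w" "z \<in> disc w'"
  shows "prefix w w' \<or> prefix w' w"
  using node_parallel_dist_rad(1)[OF assms(1,2) _ _ assms(3,4)] rad_pos(1)[of w] by force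

subsection \<open>The tree of nodes\<close>

text \<open>Truncation of the subtraction at 0 does no harm: an inner letter in state 0 does not
  occur in a live word.\<close>

fun state :: "nat \<Rightarrow> nat list \<Rightarrow> nat" where
  "state k [] = k"
| "state k (l # w) = state (if l < 100 then Suc k else k - 1) w"

lemma live_append: "live k (u @ v) \<longleftrightarrow> live k u \<and> live (state k u) v"
  by (induction u arbitrary: k) auto

lemma dead_append: "v \<noteq> [] \<Longrightarrow> dead k (u @ v) \<longleftrightarrow> live k u \<and> dead (state k u) v"
  by (induction u arbitrary: k) auto

lemma dead_not_live: "dead k w \<Longrightarrow> \<not> live k w"
  by (induction w arbitrary: k) (auto split: if_splits)

lemma node_append: "node k (u @ v) \<Longrightarrow> v \<noteq> [] \<Longrightarrow> live k u"
  by (auto simp: node_def live_append dead_append)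

lemma node_strict_prefix: "node k w \<Longrightarrow> strict_prefix u w \<Longrightarrow> live k u"
  using node_append by (auto simp: strict_prefix_def prefix_def)

lemma dead_prefix_eq: "dead k w \<Longrightarrow> node k w' \<Longrightarrow> prefix w w' \<Longrightarrow> w = w'"
  using node_strict_prefix dead_not_live by (metis strict_prefixI)

lemma node_dead: "dead k w \<Longrightarrow> node k w" and node_live: "live k w \<Longrightarrow> node k w"
  by (auto simp: node_def)

lemma live_take: "node k w \<Longrightarrow> m < length w \<Longrightarrow> live k (take m w)"
  by (rule node_append[of k "take m w" "drop m w"]) auto

text \<open>Inner letters alone lead to capture after \<open>k + 1\<close> steps; hence every live
  disc contains a square.\<close>

lemma dead_inner: "dead k (replicate (Suc k) 100)"
  by (induction k) auto

section \<open>Counting nodes and conservation of the total radius\<close>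

definition lives :: "nat \<Rightarrow> nat \<Rightarrow> nat list set" where "lives k n = {w. live k w \<and> length w = n}"
definition deads :: "nat \<Rightarrow> nat \<Rightarrow> nat list set" where "deads k n = {w. dead k w \<and> length w = n}"

lemma finite_lives [simp]: "finite (lives k n)" and finite_deads [simp]: "finite (deads k n)"
proof -
  have "finite {w. set w \<subseteq> {..<2200::nat} \<and> length w = n}" by (rule finite_lists_length_eq) simp
  then show "finite (lives k n)" "finite (deads k n)"
    by (auto elim!: finite_subset[rotated] simp: lives_def deads_def dest!: node_live node_dead dest: node_letters)
qed

lemma card_split:
  fixes A B S :: "nat list set"
  assumes S: "\<And>w. w \<in> S \<longleftrightarrow> (\<exists>l v. w = l # v \<and> l < 2200 \<and> (if l < 100 then v \<in> A else v \<in> B))"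
    and "finite A" "finite B"
  shows "card S = 100 * card A + 2100 * card B"
proof -
  define f :: "nat \<times> nat list \<Rightarrow> nat list" where "f = (\<lambda>(l, v). l # v)"
  have "S = f ` ({..<100} \<times> A) \<union> f ` ({100..<2200} \<times> B)"
  proof (intro set_eqI iffI)
    fix w assume "w \<in> S"
    then obtain l v where w: "w = f (l, v)" "l < 2200" "if l < 100 then v \<in> A else v \<in> B"
      by (auto simp: S f_def)
    then show "w \<in> f ` ({..<100} \<times> A) \<union> f ` ({100..<2200} \<times> B)"
      unfolding w(1) by (cases "l < 100") auto
  next
    fix w assume "w \<in> f ` ({..<100} \<times> A) \<union> f ` ({100..<2200} \<times> B)"
    then obtain l v where w: "w = l # v" "l < 100 \<and> v \<in> A \<or> 100 \<le> l \<and> l < 2200 \<and> v \<in> B"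
      by (auto simp: f_def)
    then show "w \<in> S" unfolding S by (intro exI[of _ l] exI[of _ v]) auto
  qed
  moreover have "f ` ({..<100} \<times> A) \<inter> f ` ({100..<2200} \<times> B) = {}" by (auto simp: f_def)
  moreover have "inj_on f Z" for Z by (auto simp: inj_on_def f_def)
  ultimately show ?thesis
    using assms(2,3) by (simp add: card_Un_disjoint card_image card_cartesian_product)
qed

lemma card_lives_Suc:
  "card (lives k (Suc n)) = 100 * card (lives (Suc k) n) + (if k = 0 then 0 else 2100 * card (lives (k - 1) n))"
proof -
  have "card (lives k (Suc n))
      = 100 * card (lives (Suc k) n) + 2100 * card (if k = 0 then {} else lives (k - 1) n)"
  proof (rule card_split)
    show "w \<in> lives k (Suc n) \<longleftrightarrow> (\<exists>l v. w = l # v \<and> l < 2200 \<and>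
        (if l < 100 then v \<in> lives (Suc k) n else v \<in> (if k = 0 then {} else lives (k - 1) n)))" for w
      by (cases w) (auto simp: lives_def)
  qed auto
  then show ?thesis by simp
qed

lemma card_deads_Suc:
  "card (deads k (Suc n)) = 100 * card (deads (Suc k) n)
     + 2100 * (if k = 0 then (if n = 0 then 1 else 0) else card (deads (k - 1) n))"
proof -
  have "card (deads k (Suc n)) = 100 * card (deads (Suc k) n)
      + 2100 * card (if k = 0 then (if n = 0 then {[]} else {}) else deads (k - 1) n)"
  proof (rule card_split)
    show "w \<in> deads k (Suc n) \<longleftrightarrow> (\<exists>l v. w = l # v \<and> l < 2200 \<and>
        (if l < 100 then v \<in> deads (Suc k) n
         else v \<in> (if k = 0 then (if n = 0 then {[]} else {}) else deads (k - 1) n)))" for w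
      by (cases w) (auto simp: deads_def)
  qed auto
  then show ?thesis by simp
qed

text \<open>The total radius of live nodes, equivalently the probability that the walk started at
  \<open>k\<close>, with upward steps of probability 1/22, is not captured by time \<open>n\<close>.
  Correspondingly, \<open>dead_mass\<close> is the probability of capture exactly at time
  \<open>n\<close>.\<close>

definition live_mass :: "nat \<Rightarrow> nat \<Rightarrow> real" where "live_mass k n = real (card (lives k n)) * rr ^ n"
definition dead_mass :: "nat \<Rightarrow> nat \<Rightarrow> real" where "dead_mass k n = real (card (deads k n)) * rr ^ n"

lemma live_mass_0 [simp]: "live_mass k 0 = 1"
proof -
  have "lives k 0 = {[]}" by (auto simp: lives_def)
  then show ?thesis by (simp add: live_mass_def)
qed

lemma dead_mass_0 [simp]: "dead_mass k 0 = 0"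
proof -
  have "deads k 0 = {}" by (auto simp: deads_def)
  then show ?thesis by (simp add: dead_mass_def)
qed

lemma live_mass_Suc:
  "live_mass k (Suc n) = live_mass (Suc k) n / 22 + (if k = 0 then 0 else 21/22 * live_mass (k - 1) n)"
  unfolding live_mass_def card_lives_Suc by (simp add: rr_def algebra_simps)

lemma dead_mass_Suc:
  "dead_mass k (Suc n) = dead_mass (Suc k) n / 22
     + 21/22 * (if k = 0 then (if n = 0 then 1 else 0) else dead_mass (k - 1) n)"
  unfolding dead_mass_def card_deads_Suc by (simp add: rr_def algebra_simps)

lemma mass_nonneg [simp]: "0 \<le> live_mass k n" "0 \<le> dead_mass k n"
  by (auto simp: live_mass_def dead_mass_def less_imp_le)

text \<open>Conservation of radius, as 2200 \<open>rr\<close> = 1: what survives for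
  \<open>n\<close> steps is either captured in the next one or survives it.\<close>

lemma mass_split: "dead_mass k (Suc n) + live_mass k (Suc n) = live_mass k n"
proof (induction n arbitrary: k)
  case 0
  show ?case by (simp add: live_mass_Suc dead_mass_Suc)
next
  case (Suc n)
  show ?case
    unfolding live_mass_Suc[of k] dead_mass_Suc[of k "Suc n"]
    using Suc[of "Suc k"] Suc[of "k - 1"] by auto
qed

lemma dead_mass_sum: "(\<Sum>m\<le>n. dead_mass k m) = 1 - live_mass k n"
proof (induction n)
  case (Suc n)
  then show ?case using mass_split[of k n] by simp
qed simp

text \<open>Weighting a node in state \<open>k\<close> by \<open>2\<^sup>k\<close> gives a total mass that decays geometrically, because
  \<open>2 / 22 + 21 / 44 < 1\<close>.\<close>

lemma live_mass_le: "live_mass k n \<le> 2 ^ k * (25/44) ^ n"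
proof (induction n arbitrary: k)
  case (Suc n)
  have "live_mass k (Suc n) \<le> 2 ^ Suc k * (25/44) ^ n / 22 + 21/22 * (2 ^ k / 2 * (25/44) ^ n)"
  proof (cases k)
    case 0
    moreover have "0 \<le> (25/44 :: real) ^ n" by simp
    ultimately show ?thesis using Suc[of "Suc k"] by (simp add: live_mass_Suc del: zero_le_power)
  next
    case (Suc j)
    then show ?thesis using Suc.IH[of "Suc k"] Suc.IH[of j] by (simp add: live_mass_Suc)
  qed
  also have "\<dots> = 2 ^ k * (25/44) ^ Suc n" by simp
  finally show ?case .
qed simp

lemma ex_dead_mass_ge_half: "\<exists>n. 1/2 \<le> (\<Sum>m\<le>n. dead_mass k m)"
proof -
  have "(\<lambda>n. 2 ^ k * (25/44) ^ n :: real) \<longlonglongrightarrow> 2 ^ k * 0"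
    by (intro tendsto_mult tendsto_const LIMSEQ_power_zero) auto
  then have "\<forall>\<^sub>F n in sequentially. 2 ^ k * (25/44) ^ n < (1/2 :: real)"
    by (intro order_tendstoD(2)[of _ 0]) auto
  then obtain n where "2 ^ k * (25/44) ^ n < (1/2 :: real)"
    by (auto simp: eventually_sequentially)
  then have "1/2 \<le> (\<Sum>m\<le>n. dead_mass k m)"
    unfolding dead_mass_sum using live_mass_le[of k n] by linarith
  then show ?thesis by blast
qed

subsection \<open>The domain and its boundary\<close>

text \<open>It lies within radius 1/2, so a collar inside its own disc separates it from the rest of
  the solid set.\<close>

definition square :: "complex set" where
  "square = {z. \<bar>Re z\<bar> \<le> 1/4 \<and> \<bar>Im z\<bar> \<le> 1/4}"

definition square_bd :: "complex set" where
  "square_bd = {z \<in> square. \<bar>Re z\<bar> = 1/4 \<or> \<bar>Im z\<bar> = 1/4}"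

definition level :: "nat \<Rightarrow> nat \<Rightarrow> complex set" where
  "level k n = (\<Union>w\<in>lives k n. disc w)"

definition cantor :: "complex set" where
  "cantor = (\<Inter>n. level 0 n)"

definition solid :: "complex set" where
  "solid = cantor \<union> (\<Union>w\<in>{w. dead 0 w}. emb w ` square)"

definition boundary :: "complex set" where
  "boundary = cantor \<union> (\<Union>w\<in>{w. dead 0 w}. emb w ` square_bd)"

lemma norm_square: "z \<in> square \<Longrightarrow> cmod z \<le> 1/2"
  using cmod_le[of z] by (auto simp: square_def)

lemma square_subset: "square \<subseteq> cball 0 1"
  using norm_square by fastforce

lemma emb_square_subset_disc: "emb w ` square \<subseteq> disc w"
  unfolding disc_def using square_subset by blast

lemma square_bd_subset: "square_bd \<subseteq> square"
  by (auto simp: square_bd_def)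

lemma boundary_subset_solid: "boundary \<subseteq> solid"
  using square_bd_subset by (auto simp: boundary_def solid_def)

lemma continuous_on_emb: "continuous_on S (emb w)"
proof -
  have "(\<lambda>z. emb w 0 + of_real (rad w) * z) = emb w" by (rule ext) (rule emb_affine[symmetric])
  moreover have "continuous_on S (\<lambda>z. emb w 0 + of_real (rad w) * z)" by (intro continuous_intros)
  ultimately show ?thesis by metis
qed

lemma compact_disc: "compact (disc w)"
  by (simp add: disc_eq)

lemma compact_square: "compact square"
proof -
  have "closed square"
    unfolding square_def by (intro closed_Collect_conj closed_Collect_le continuous_intros)
  then show ?thesis
    using square_subset bounded_cball bounded_subset compact_eq_bounded_closed by blast
qed

lemma compact_emb_square: "compact (emb w ` square)"
  by (intro compact_continuous_image continuous_on_emb compact_square)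

lemma closed_level: "closed (level k n)"
  unfolding level_def by (intro closed_UN finite_lives) (simp add: compact_imp_closed compact_disc)

lemma level_0 [simp]: "level k 0 = cball 0 1"
proof -
  have "lives k 0 = {[]}" by (auto simp: lives_def)
  then show ?thesis by (simp add: level_def disc_def)
qed

lemma node_disc_level:
  assumes "node k w" "z \<in> disc w" "m < length w"
  shows "z \<in> level k m"
proof -
  have "z \<in> disc (take m w)" using disc_prefix[OF take_is_prefix assms(1)] assms(2) by blast
  then show ?thesis using live_take[OF assms(1,3)] assms(3) by (auto simp: level_def lives_def)
qed

lemma level_mono: "m \<le> n \<Longrightarrow> level k n \<subseteq> level k m"
  using node_disc_level node_live by (fastforce simp: level_def lives_def order_le_less)

lemma level_Cons:
  assumes "l < 2200" "\<zeta> \<in> level k' n" "if l < 100 then k' = Suc k else 0 < k \<and> k' = k - 1"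
  shows "child_pos l + of_real rr * \<zeta> \<in> level k (Suc n)"
proof -
  obtain w z where w: "live k' w" "length w = n" "z \<in> cball 0 1" "\<zeta> = emb w z"
    using assms(2) by (auto simp: level_def lives_def disc_def)
  have lv: "live k (l # w)" using assms w(1) by (auto split: if_splits)
  have "child_pos l + of_real rr * \<zeta> \<in> disc (l # w)"
    unfolding disc_def using w by (intro image_eqI[of _ _ z]) auto
  then show ?thesis using w(2) lv unfolding level_def lives_def by (intro UN_I[of "l # w"]) auto
qed

text \<open>Serves closedness. The squares deeper than \<open>n\<close> are still hidden in the live
  discs of depth \<open>n\<close>, so each stage is a finite union of compact sets.\<close>

lemma solid_eq: "solid = (\<Inter>n. level 0 n \<union> (\<Union>w\<in>(\<Union>m\<le>n. deads 0 m). emb w ` square))"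
proof (intro equalityI subsetI INT_I)
  fix z n assume "z \<in> solid"
  then consider "z \<in> cantor" | w where "dead 0 w" "z \<in> emb w ` square"
    by (auto simp: solid_def)
  then show "z \<in> level 0 n \<union> (\<Union>w\<in>(\<Union>m\<le>n. deads 0 m). emb w ` square)"
  proof cases
    case 2
    show ?thesis
    proof (cases "length w \<le> n")
      case True
      then show ?thesis using 2 by (auto simp: deads_def)
    next
      case False
      then have "z \<in> level 0 n"
        using 2 node_disc_level[OF node_dead[OF 2(1)], of z n] emb_square_subset_disc by auto
      then show ?thesis by simp
    qed
  qed (auto simp: cantor_def)
next
  fix z assume z: "z \<in> (\<Inter>n. level 0 n \<union> (\<Union>w\<in>(\<Union>m\<le>n. deads 0 m). emb w ` square))"
  show "z \<in> solid"
  proof (cases "\<exists>w. dead 0 w \<and> z \<in> emb w ` square")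
    case False
    then have "z \<in> level 0 n" for n using z by (auto simp: deads_def)
    then show ?thesis by (auto simp: solid_def cantor_def)
  qed (auto simp: solid_def)
qed

lemma closed_solid: "closed solid"
proof -
  have "closed (level 0 n \<union> (\<Union>w\<in>(\<Union>m\<le>n. deads 0 m). emb w ` square))" for n
    by (intro closed_Un closed_level closed_UN ballI finite_UN_I)
       (auto simp: compact_imp_closed compact_emb_square)
  then show ?thesis unfolding solid_eq by (intro closed_INT) auto
qed

lemma closed_cantor: "closed cantor"
  unfolding cantor_def by (intro closed_INT ballI closed_level)

lemma solid_Int_dead_disc:
  assumes "z \<in> solid" "dead 0 w" "z \<in> disc w"
  shows "z \<in> emb w ` square"
proof -
  consider "z \<in> cantor" | w' where "dead 0 w'" "z \<in> emb w' ` square"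
    using assms(1) by (auto simp: solid_def)
  then show ?thesis
  proof cases
    case 1
    then obtain w' where w': "live 0 w'" "length w' = length w" "z \<in> disc w'"
      by (auto simp: cantor_def level_def lives_def)
    then have "prefix w w' \<or> prefix w' w"
      using node_disc_inter[of 0 w w' z] assms node_dead node_live by blast
    then have "w = w'" using w'(2) by (auto simp: prefix_def)
    then show ?thesis using w'(1) assms(2) dead_not_live by blast
  next
    case 2
    then have "prefix w w' \<or> prefix w' w"
      using node_disc_inter[of 0 w w' z] assms node_dead emb_square_subset_disc by blast
    then have "w = w'" using dead_prefix_eq node_dead assms(2) 2(1) by metis
    then show ?thesis using 2 by simp
  qed
qed

lemma solid_Int_live_disc:
  assumes "z \<in> solid" "live 0 w" "z \<in> disc w"
  obtains l where "l < 2200" "node 0 (w @ [l])" "z \<in> disc (w @ [l])"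
proof -
  have "\<exists>w'. node 0 w' \<and> z \<in> disc w' \<and> strict_prefix w w'"
  proof -
    consider "z \<in> cantor" | w' where "dead 0 w'" "z \<in> emb w' ` square"
      using assms(1) by (auto simp: solid_def)
    then show ?thesis
    proof cases
      case 1
      then obtain w' where w': "live 0 w'" "length w' = Suc (length w)" "z \<in> disc w'"
        unfolding cantor_def level_def lives_def by blast
      then have "prefix w w' \<or> prefix w' w"
        using node_disc_inter[of 0 w w' z] assms node_live by blast
      then have "strict_prefix w w'" using w'(2) by (auto simp: prefix_def strict_prefix_def)
      then show ?thesis using w' node_live by blast
    next
      case 2
      then have zd: "z \<in> disc w'" using emb_square_subset_disc by blast
      have n: "node 0 w" "node 0 w'" using assms 2 node_live node_dead by auto
      have "w \<noteq> w'" using assms(2) 2(1) dead_not_live by blast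
      then have "\<not> prefix w' w" using dead_prefix_eq[OF 2(1) n(1)] by blast
      then have "prefix w w'" using node_disc_inter[OF n assms(3) zd] by blast
      then have "strict_prefix w w'" using \<open>w \<noteq> w'\<close> by (rule strict_prefixI)
      then show ?thesis using n zd by blast
    qed
  qed
  then obtain w' where w': "node 0 w'" "z \<in> disc w'" "strict_prefix w w'" by blast
  then obtain u where u: "w' = w @ u" "u \<noteq> []" by (auto simp: strict_prefix_def prefix_def)
  then obtain l v where "u = l # v" by (cases u) auto
  with u have d: "w' = w @ l # v" by simp
  have p: "prefix (w @ [l]) w'" by (simp add: d)
  have "node 0 (w @ [l])"
  proof (cases "v = []")
    case False
    then show ?thesis using node_append[of 0 "w @ [l]" v] w'(1) d node_live by simp
  qed (use w'(1) d in simp)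
  moreover have "z \<in> disc (w @ [l])" using disc_prefix[OF p w'(1)] w'(2) by blast
  moreover have "l < 2200" using node_letters[OF w'(1)] by (simp add: d)
  ultimately show ?thesis using that by blast
qed

text \<open>All children keep away from the centre of their parent. This puts holes at every scale
  next to the points of the Cantor set, which are therefore not interior.\<close>

lemma emb_0_notin_solid:
  assumes "live 0 w" shows "emb w 0 \<notin> solid"
proof
  assume "emb w 0 \<in> solid"
  then obtain l where l: "l < 2200" "emb w 0 \<in> disc (w @ [l])"
    using solid_Int_live_disc[OF _ assms emb_0_in_disc] by blast
  then obtain z where z: "z \<in> cball 0 1" "emb w 0 = emb w (child_pos l + of_real rr * z)"
    by (auto simp: disc_def emb_append)
  then have "dist 0 (child_pos l + of_real rr * z) = 0"
    using dist_emb[of w 0 "child_pos l + of_real rr * z"] rad_pos(1)[of w] by simp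
  then have "child_pos l = - (of_real rr * z)" by (simp add: eq_neg_iff_add_eq_0)
  then have "cmod (child_pos l) \<le> rr" using z(1) by (simp add: norm_mult mult_left_le)
  then show False using norm_child_pos_bounds(1)[OF l(1)] by (simp add: rr_def)
qed

lemma frontier_solid: "frontier solid = boundary"
proof (intro equalityI subsetI)
  fix z assume z: "z \<in> frontier solid"
  then have zs: "z \<in> solid" "z \<notin> interior solid"
    using closed_solid by (auto simp: frontier_def)
  show "z \<in> boundary"
  proof (rule ccontr)
    assume nb: "z \<notin> boundary"
    then obtain w where w: "dead 0 w" "z \<in> emb w ` square" "z \<notin> emb w ` square_bd"
      using zs by (auto simp: solid_def boundary_def)
    define U where "U = {s. \<bar>Re s\<bar> < 1/4 \<and> \<bar>Im s\<bar> < 1/4}"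
    have "open (emb w ` U)"
      unfolding emb_image U_def mem_Collect_eq
      by (intro open_Collect_conj open_Collect_less continuous_intros) (auto simp: rad_def)
    moreover have "z \<in> emb w ` U"
      using w(2,3) by (force simp: U_def square_def square_bd_def)
    moreover have "emb w ` U \<subseteq> solid"
      using w(1) by (force simp: U_def square_def solid_def)
    ultimately show False using zs(2) interiorI by blast
  qed
next
  fix z assume z: "z \<in> boundary"
  have "\<exists>y. y \<notin> solid \<and> dist y z < e" if e: "e > 0" for e
  proof -
    consider "z \<in> cantor" | w s where "dead 0 w" "s \<in> square_bd" "z = emb w s"
      using z by (auto simp: boundary_def)
    then show ?thesis
    proof cases
      case 1
      obtain n where n: "rr ^ n < e" using real_arch_pow_inv[OF e, of rr] by auto
      obtain w where w: "live 0 w" "length w = n" "z \<in> disc w"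
        using 1 unfolding cantor_def level_def lives_def by blast
      have "dist (emb w 0) z \<le> rr ^ n" using w by (simp add: disc_eq rad_def)
      then show ?thesis using emb_0_notin_solid[OF w(1)] n by (intro exI[of _ "emb w 0"]) auto
    next
      case 2
      define d where "d = min 1 e"
      have d: "0 < d" "d \<le> 1" "d \<le> e" using e by (auto simp: d_def)
      \<comment> \<open>Dilation from the centre by a factor of at most 2 leaves the square but,
        because \<open>cmod s \<le> 1/2\<close>, not the disc, where the square is all there is of
        the solid set.\<close>
      define y where "y = emb w (of_real (1 + d) * s)"
      have s: "s \<in> square" "cmod s \<le> 1/2" using 2(2) square_bd_subset norm_square by auto
      have "1/4 < (1 + d) * (1/4)" using d by simp
      moreover have "\<bar>Re s\<bar> = 1/4 \<or> \<bar>Im s\<bar> = 1/4" using 2(2) by (simp add: square_bd_def)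
      moreover have "(1 + d) * \<bar>Re s\<bar> \<le> 1/4 \<and> (1 + d) * \<bar>Im s\<bar> \<le> 1/4" if "of_real (1 + d) * s \<in> square"
        using that d(1) by (simp add: square_def abs_mult)
      ultimately have "of_real (1 + d) * s \<notin> square" by (metis not_le)
      moreover have cb: "of_real (1 + d) * s \<in> cball 0 1"
      proof -
        have "cmod (of_real (1 + d) * s) \<le> 2 * (1/2)"
          unfolding norm_mult norm_of_real using d s by (intro mult_mono) auto
        then show ?thesis by simp
      qed
      ultimately have "y \<notin> emb w ` square"
      proof (intro notI)
        assume n: "of_real (1 + d) * s \<notin> square" and "y \<in> emb w ` square"
        then obtain s' where s': "s' \<in> square" "y = emb w s'" by blast
        then have "rad w * dist s' (of_real (1 + d) * s) = 0"
          unfolding y_def using dist_emb[of w s' "of_real (1 + d) * s"] by simp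
        then have "s' = of_real (1 + d) * s" using rad_pos(1)[of w] by simp
        then show False using n s' by blast
      qed
      moreover have "y \<in> disc w" using cb by (auto simp: y_def disc_def)
      ultimately have "y \<notin> solid" using solid_Int_dead_disc[OF _ 2(1)] by blast
      moreover have "dist y z < e"
      proof -
        have "dist y z = rad w * (d * cmod s)"
        proof -
          have "of_real (1 + d) * s - s = of_real d * s" by (simp add: algebra_simps)
          then show ?thesis using d unfolding y_def 2(3) dist_emb by (simp add: dist_norm norm_mult)
        qed
        also have "\<dots> \<le> 1 * (d * (1/2))" using d s by (intro mult_mono mult_nonneg_nonneg) auto
        also have "\<dots> < e" using d by simp
        finally show ?thesis .
      qed
      ultimately show ?thesis by blast
    qed
  qed
  then have "z \<in> closure (- solid)" unfolding closure_approachable by fastforce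
  then show "z \<in> frontier solid"
    using z boundary_subset_solid closed_solid by (auto simp: frontier_def interior_closure)
qed

lemma not_solid_notin_level: "z \<notin> solid \<Longrightarrow> \<exists>n. z \<notin> level 0 n"
  by (auto simp: solid_def cantor_def)

lemma solid_Int_live_disc_nonempty:
  assumes "live 0 w" shows "\<exists>z\<in>disc w. z \<in> solid"
proof -
  define v where "v = replicate (Suc (state 0 w)) (100::nat)"
  have "dead 0 (w @ v)" using assms dead_append[of v 0 w] dead_inner by (simp add: v_def del: replicate.simps)
  moreover have "emb (w @ v) 0 \<in> emb (w @ v) ` square" by (simp add: square_def)
  ultimately have "emb (w @ v) 0 \<in> solid" by (auto simp: solid_def)
  moreover have "emb (w @ v) 0 \<in> disc w"
    using disc_append[of v w] emb_0_in_disc[of "w @ v"] unfolding v_def by (auto simp del: replicate.simps)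
  ultimately show ?thesis by blast
qed

lemma solid_subset_cball: "solid \<subseteq> cball 0 1"
proof
  fix z assume "z \<in> solid"
  then have "z \<in> level 0 0 \<union> (\<Union>w\<in>(\<Union>m\<le>0. deads 0 m). emb w ` square)"
    unfolding solid_eq by blast
  then show "z \<in> cball 0 1" by (auto simp: deads_def)
qed

section \<open>The superharmonic function\<close>

subsection \<open>The kernel\<close>

text \<open>The potential of a unit charge on the circle of radius \<open>1/2\<close>, which encloses all inner
  children, and of the opposite charge spread over small circles in the outer children. By the product
  formula for roots of unity it is small outside the outer circle, and by the number of outer
  children it is almost nonnegative everywhere.\<close>

definition kern :: "complex \<Rightarrow> real" where
  "kern z = - ln (max (cmod z) (1/2)) + (\<Sum>l<100. ln (max (cmod (z - child_pos l)) (rr / 2))) / 100"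

text \<open>Both sides are monic of degree \<open>n\<close> and share \<open>n\<close> distinct
  roots, so their difference, of smaller degree, vanishes.\<close>

lemma prod_roots_of_unity:
  fixes z :: complex
  assumes "0 < n" "0 < R"
  shows "(\<Prod>k<n. z - of_real R * cis (2 * pi * real k / real n)) = z ^ n - of_real R ^ n"
proof -
  define a where "a = (\<lambda>k. of_real R * cis (2 * pi * real k / real n))"
  define p where "p = (\<Prod>k<n. [:- a k, 1:])"
  define q where "q = monom (1::complex) n - [:of_real R ^ n:]"
  have a: "a k ^ n = of_real R ^ n" if "k < n" for k
  proof -
    have "cis (2 * pi * real k / real n) ^ n = 1"
      using Complex.bij_betw_roots_unity[OF assms(1)] that by (auto simp: bij_betw_def)
    then show ?thesis by (simp add: a_def power_mult_distrib)
  qed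
  have inj: "inj_on a {..<n}"
    using Complex.bij_betw_roots_unity[OF assms(1)] assms(2) by (auto simp: a_def inj_on_def bij_betw_def)
  have degp: "degree p = n" unfolding p_def by (subst degree_prod_sum_eq) auto
  have lcp: "lead_coeff p = 1" unfolding p_def by (simp add: lead_coeff_prod)
  have degq: "degree q \<le> n" unfolding q_def by (intro degree_diff_le) (auto simp: degree_monom_le)
  have "p = q"
  proof (rule ccontr)
    assume "p \<noteq> q"
    then have nz: "p - q \<noteq> 0" by simp
    have "coeff (p - q) n = 0"
      using lcp degp assms(1) by (simp add: q_def coeff_pCons split: nat.split)
    then have "degree (p - q) < n"
      using degree_diff_le[of p n q] degp degq nz by (metis eq_zero_or_degree_less order.refl)
    moreover have "a ` {..<n} \<subseteq> {x. poly (p - q) x = 0}"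
      using a by (auto simp: p_def q_def poly_prod poly_monom)
    then have "card (a ` {..<n}) \<le> card {x. poly (p - q) x = 0}"
      by (intro card_mono poly_roots_finite nz)
    then have "n \<le> degree (p - q)" using card_poly_roots_bound[OF nz] inj by (simp add: card_image)
    ultimately show False by simp
  qed
  then have "poly p z = poly q z" by simp
  then show ?thesis by (simp add: p_def q_def poly_prod poly_monom a_def)
qed

lemma child_pos_outer: "l < 100 \<Longrightarrow> child_pos l = of_real (3/4) * cis (2 * pi * real l / real (100::nat))"
  by (simp add: child_pos_def ring_radius_def)

lemma prod_outer: "(\<Prod>l<100. z - child_pos l) = z ^ 100 - of_real (3/4) ^ 100"
  using prod_roots_of_unity[of 100 "3/4" z] by (simp add: child_pos_outer)

lemma sum_ln_outer:
  assumes "\<And>l. l < 100 \<Longrightarrow> rr / 2 \<le> cmod (z - child_pos l)"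
  shows "(\<Sum>l<100. ln (max (cmod (z - child_pos l)) (rr / 2))) = ln (cmod (z ^ 100 - of_real (3/4) ^ 100))"
proof -
  have p: "0 < cmod (z - child_pos l)" if "l < 100" for l
    using assms[OF that] rr_pos(1) by linarith
  have "(\<Sum>l<100. ln (max (cmod (z - child_pos l)) (rr / 2))) = (\<Sum>l<100. ln (cmod (z - child_pos l)))"
    using assms by (intro sum.cong) (auto simp: max_absorb1)
  also have "\<dots> = ln (\<Prod>l<100. cmod (z - child_pos l))"
    using p by (intro ln_prod[symmetric]) auto
  also have "(\<Prod>l<100. cmod (z - child_pos l)) = cmod (z ^ 100 - of_real (3/4) ^ 100)"
    unfolding prod_norm prod_outer ..
  finally show ?thesis .
qed

text \<open>The principal 100th root \<open>x\<close> of \<open>\<zeta> ^ 100\<close> is close to 1,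
  and \<open>\<zeta>\<close> differs from it by a root of unity.\<close>

lemma near_root_of_unity:
  fixes \<zeta> :: complex
  assumes "cmod (\<zeta> ^ 100 - 1) < 1/8"
  obtains j where "j < 100" "cmod (\<zeta> * cis (- (2 * pi * real j / real (100::nat))) - 1) \<le> 1/200"
proof -
  define u where "u = \<zeta> ^ 100 - 1"
  have u: "cmod u < 1/8" using assms by (simp add: u_def)
  have "cmod (Ln (1 + u)) \<le> 2 * cmod u" by (rule norm_Ln_le) (use u in simp)
  then have L: "cmod (Ln (1 + u) / 100) \<le> 1/400" using u by (simp add: norm_divide)
  define x where "x = exp (Ln (1 + u) / 100)"
  have "u \<noteq> - 1" using u by auto
  then have "1 + u \<noteq> 0" by (simp add: add_eq_0_iff)
  then have x: "x ^ 100 = \<zeta> ^ 100"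
    unfolding x_def by (simp add: u_def flip: exp_of_nat_mult)
  have x0: "x \<noteq> 0" by (simp add: x_def)
  have x1: "cmod (x - 1) \<le> 3/2 * (1/400)"
    using norm_exp_bounds(2)[of "Ln (1 + u) / 100"] L unfolding x_def by linarith
  have "\<zeta> \<noteq> 0" using x x0 by (metis power_eq_0_iff zero_less_numeral)
  then have "(\<zeta> / x) ^ 100 = 1" using x x0 by (simp add: power_divide)
  then obtain j where j: "j < 100" "\<zeta> / x = cis (2 * pi * real j / real (100::nat))"
    using Complex.bij_betw_roots_unity[of 100] by (auto simp: bij_betw_def)
  have "\<zeta> = x * cis (2 * pi * real j / real (100::nat))" using j(2) x0 by (simp add: field_simps)
  then have "\<zeta> * cis (- (2 * pi * real j / real (100::nat))) = x" by (simp add: cis_mult)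
  then show ?thesis using that[OF j(1)] x1 by simp
qed

text \<open>The sum is the product of the distances of \<open>w\<close> to the 99 roots of unity
  other than 1 (up to sign and phase). It is 100 at \<open>w = 1\<close> and loses at most half of
  that nearby.\<close>

lemma norm_geometric_sum_ge:
  fixes w :: complex
  assumes "cmod (w - 1) \<le> 1/200"
  shows "50 \<le> cmod (\<Sum>i<100. w ^ i)"
proof -
  have nw: "cmod w \<le> 1 + 1/200" using assms norm_triangle_ineq[of "w - 1" 1] by simp
  have b: "cmod (w ^ i - 1) \<le> real i / 100" if i: "i < 100" for i
  proof -
    have "cmod (\<Sum>j<i. w ^ j) \<le> (\<Sum>j<i. cmod (w ^ j))" by (rule norm_sum)
    also have "\<dots> \<le> (\<Sum>j<i. 2)"
    proof (rule sum_mono)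
      fix j assume "j \<in> {..<i}"
      then have "cmod (w ^ j) \<le> (1 + 1/200) ^ j" unfolding norm_power by (intro power_mono nw) auto
      also have "\<dots> \<le> (1 + 1/200) ^ 100" using \<open>j \<in> {..<i}\<close> i by (intro power_increasing) auto
      also have "\<dots> \<le> (2::real)" by (simp add: power_divide)
      finally show "cmod (w ^ j) \<le> 2" .
    qed
    finally have "cmod (\<Sum>j<i. w ^ j) \<le> 2 * real i" by simp
    then have "cmod (w - 1) * cmod (\<Sum>j<i. w ^ j) \<le> 1/200 * (2 * real i)"
      using assms by (intro mult_mono) auto
    then show ?thesis by (simp add: power_diff_1_eq norm_mult)
  qed
  have "cmod ((\<Sum>i<100. w ^ i) - 100) = cmod (\<Sum>i<100. w ^ i - 1)" by (simp add: sum_subtractf)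
  also have "\<dots> \<le> (\<Sum>i<100. real i / 100)"
    by (rule order_trans[OF norm_sum]) (intro sum_mono, use b in auto)
  also have "\<dots> \<le> 50" by (simp add: eval_nat_numeral)
  finally show ?thesis using norm_triangle_ineq2[of 100 "100 - (\<Sum>i<100. w ^ i)"]
    by (simp add: norm_minus_commute)
qed

lemma continuous_on_kern: "continuous_on S kern"
  unfolding kern_def by (intro continuous_intros) (auto simp: max_def)

lemma ln_132: "ln (132::real) \<le> 5"
proof -
  have "8/3 \<le> exp (1::real)"
    using exp_ge_one_plus_x_over_n_power_n[of 40 1] by (simp add: power_divide)
  then have "(8/3) ^ 5 \<le> exp (1::real) ^ 5" by (intro power_mono) auto
  moreover have "exp (1::real) ^ 5 = exp 5" using exp_of_nat_mult[of 5 "1::real"] by simp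
  ultimately have "132 \<le> exp (5::real)" by (simp add: power_divide)
  then have "ln 132 \<le> ln (exp (5::real))" by (rule ln_mono) simp
  then show ?thesis by simp
qed

text \<open>In exponential form, the product of the distances to the outer children, cut off at
  \<open>rr / 2\<close>, is at least \<open>\<mu> ^ 100 / 132\<close>. The logarithm of 132 is
  divided by the number of outer children, hence the loss of only 5/100.\<close>

lemma kern_ge: "- (1/20) \<le> kern z"
proof -
  define A where "A = {z. - (1/20) \<le> kern z}"
  have ge: "- (1/20) \<le> kern z" if z: "z \<notin> child_pos ` {..<100}" for z
  proof -
    define \<mu> where "\<mu> = max (cmod z) (3/4)"
    have \<mu>: "3/4 \<le> \<mu>" "cmod z \<le> \<mu>" by (auto simp: \<mu>_def)
    have pos: "0 < cmod (z - child_pos l)" if "l < 100" for l using that z by auto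
    have "\<mu> ^ 100 / 132 \<le> (\<Prod>l<100. max (cmod (z - child_pos l)) (rr / 2))"
    \<comment> \<open>Near an outer centre one factor may be tiny. It is replaced by its cut-off,
      while the other 99 are controlled by the geometric sum. This case fixes the constant:
      \<open>132 * (rr / 2) * 50 = 2 * (3/4)\<close>. Away from the centres, 16 would do.\<close>
    proof (cases "cmod ((z / of_real (3/4)) ^ 100 - 1) < 1/8")
      case True
      then obtain j where j: "j < 100"
          "cmod (z / of_real (3/4) * cis (- (2 * pi * real j / real (100::nat))) - 1) \<le> 1/200"
        using near_root_of_unity by blast
      define w where "w = z / of_real (3/4) * cis (- (2 * pi * real j / real (100::nat)))"
      have w: "cmod (w - 1) \<le> 1/200" using j(2) by (simp add: w_def)
      have zw: "z = child_pos j * w" by (simp add: w_def child_pos_outer[OF j(1)] cis_mult)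
      have cj: "cmod (child_pos j) = 3/4" using norm_child_pos_bounds(4)[of j] j(1) by simp
      have "w \<noteq> 1" using z zw j(1) by auto
      have cj100: "child_pos j ^ 100 = of_real (3/4) ^ 100"
      proof -
        have "cis (2 * pi * real j / real (100::nat)) ^ 100 = 1"
          using Complex.bij_betw_roots_unity[of 100] j(1) by (auto simp: bij_betw_def)
        then show ?thesis by (simp only: child_pos_outer[OF j(1)] power_mult_distrib mult_1_right)
      qed
      have split: "(\<Prod>l<100. f l) = f j * (\<Prod>l\<in>{..<100} - {j}. f l)" for f :: "nat \<Rightarrow> real"
        using j(1) by (simp add: prod.remove[of "{..<100}" j])
      have "cmod (z - child_pos j) * (\<Prod>l\<in>{..<100} - {j}. cmod (z - child_pos l))
          = (\<Prod>l<100. cmod (z - child_pos l))"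
        by (rule split[symmetric])
      also have "\<dots> = cmod (z ^ 100 - of_real (3/4) ^ 100)"
        unfolding prod_norm prod_outer ..
      also have "z ^ 100 - of_real (3/4) ^ 100 = child_pos j ^ 100 * (w ^ 100 - 1)"
        unfolding zw power_mult_distrib cj100[symmetric] by (simp add: algebra_simps)
      also have "cmod \<dots> = (3/4) ^ 100 * (cmod (w - 1) * cmod (\<Sum>i<100. w ^ i))"
        by (simp only: norm_mult norm_power cj power_diff_1_eq[of w 100])
      also have "cmod (z - child_pos j) = 3/4 * cmod (w - 1)"
      proof -
        have "z - child_pos j = child_pos j * (w - 1)" by (simp add: zw algebra_simps)
        then show ?thesis by (simp add: norm_mult cj)
      qed
      finally have "3/4 * cmod (w - 1) * (\<Prod>l\<in>{..<100} - {j}. cmod (z - child_pos l))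
          = (3/4) ^ 100 * (cmod (w - 1) * cmod (\<Sum>i<100. w ^ i))" .
      also have "(3/4 :: real) ^ 100 = 3/4 * (3/4) ^ 99" by (subst power_Suc[symmetric]) simp
      finally have "cmod (w - 1) * (\<Prod>l\<in>{..<100} - {j}. cmod (z - child_pos l))
          = cmod (w - 1) * ((3/4) ^ 99 * cmod (\<Sum>i<100. w ^ i))"
        by (simp only: mult.assoc mult.left_commute[of "cmod (w - 1)"] mult_cancel_left) simp
      then have "(\<Prod>l\<in>{..<100} - {j}. cmod (z - child_pos l)) = (3/4) ^ 99 * cmod (\<Sum>i<100. w ^ i)"
        using \<open>w \<noteq> 1\<close> by simp
      then have lb: "(3/4) ^ 99 * 50 \<le> (\<Prod>l\<in>{..<100} - {j}. cmod (z - child_pos l))"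
        using norm_geometric_sum_ge[OF w] by simp
      have "cmod w \<le> 1 + 1/200" using w norm_triangle_ineq[of "w - 1" 1] by simp
      then have "\<mu> \<le> 3/4 * (1 + 1/200)" by (simp add: \<mu>_def zw norm_mult cj)
      then have "\<mu> ^ 100 \<le> (3/4 * (1 + 1/200)) ^ 100" using \<mu>(1) by (intro power_mono) auto
      also have "\<dots> \<le> 132 * (rr / 2 * ((3/4) ^ 99 * 50))"
      proof -
        have "(1 + 1/200) ^ 100 \<le> (2 :: real)" by (simp add: power_divide)
        then have "(3/4) ^ 100 * (1 + 1/200) ^ 100 \<le> (3/4) ^ 100 * (2 :: real)"
          by (rule mult_left_mono) simp
        moreover have "(3/4 :: real) ^ 100 = 3/4 * (3/4) ^ 99" by (subst power_Suc[symmetric]) simp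
        moreover have "q * x \<le> 132 * (1/2200 / 2 * (p * 50))" if "q * x \<le> q * 2" "q = 3/4 * p" for p q x :: real
          using that by linarith
        ultimately show ?thesis unfolding power_mult_distrib rr_def by metis
      qed
      also have "\<dots> \<le> 132 * (max (cmod (z - child_pos j)) (rr / 2)
          * (\<Prod>l\<in>{..<100} - {j}. max (cmod (z - child_pos l)) (rr / 2)))"
        using lb by (intro mult_left_mono mult_mono order_trans[OF lb] prod_mono)
             (auto simp: le_max_iff_disj)
      finally show ?thesis unfolding split by simp
    next
      case False
      define \<zeta> where "\<zeta> = z / of_real (3/4)"
      have \<zeta>: "1/8 \<le> cmod (\<zeta> ^ 100 - 1)" using False by (simp add: \<zeta>_def)
      have z\<zeta>: "z = of_real (3/4) * \<zeta>" by (simp add: \<zeta>_def)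
      have "max (cmod \<zeta>) 1 ^ 100 \<le> 16 * cmod (\<zeta> ^ 100 - 1)"
      proof (cases "cmod \<zeta> ^ 100 \<le> 2")
        case True
        then have "max (cmod \<zeta>) 1 ^ 100 \<le> 2" by (simp add: max_def)
        then show ?thesis using \<zeta> by linarith
      next
        case F: False
        then have "1 < cmod \<zeta>" by (metis not_le one_le_numeral order_trans norm_ge_zero power_le_one)
        moreover have "cmod \<zeta> ^ 100 - 1 \<le> cmod (\<zeta> ^ 100 - 1)"
          using norm_triangle_ineq2[of "\<zeta> ^ 100" 1] by (simp add: norm_power)
        ultimately show ?thesis using F by (simp add: max_def)
      qed
      moreover have "\<mu> = 3/4 * max (cmod \<zeta>) 1" by (simp add: \<mu>_def z\<zeta> norm_mult max_def)
      ultimately have "\<mu> ^ 100 \<le> (3/4) ^ 100 * (16 * cmod (\<zeta> ^ 100 - 1))"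
        by (simp only: power_mult_distrib) (intro mult_left_mono, auto)
      also have "\<dots> = 16 * cmod (z ^ 100 - of_real (3/4) ^ 100)"
      proof -
        have "z ^ 100 - of_real (3/4) ^ 100 = of_real (3/4) ^ 100 * (\<zeta> ^ 100 - 1)"
          by (simp only: z\<zeta> power_mult_distrib right_diff_distrib mult_1_right)
        then have "cmod (z ^ 100 - of_real (3/4) ^ 100) = (3/4) ^ 100 * cmod (\<zeta> ^ 100 - 1)"
          by (simp only: norm_mult norm_power norm_of_real)
        then show ?thesis by simp
      qed
      also have "\<dots> = 16 * (\<Prod>l<100. cmod (z - child_pos l))" unfolding prod_norm prod_outer ..
      also have "\<dots> \<le> 132 * (\<Prod>l<100. max (cmod (z - child_pos l)) (rr / 2))"
        by (intro mult_mono prod_mono prod_nonneg) auto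
      finally show ?thesis by simp
    qed
    then have "ln (\<mu> ^ 100 / 132) \<le> ln (\<Prod>l<100. max (cmod (z - child_pos l)) (rr / 2))"
      using \<mu>(1) by (subst ln_le_cancel_iff) (auto intro!: prod_pos simp: less_max_iff_disj)
    also have "\<dots> = (\<Sum>l<100. ln (max (cmod (z - child_pos l)) (rr / 2)))"
    proof (rule ln_prod)
      have "0 < max (cmod (z - child_pos l)) (rr / 2)" for l by (simp add: less_max_iff_disj)
      then show "max (cmod (z - child_pos l)) (rr / 2) \<noteq> 0" for l by (metis less_irrefl)
    qed simp
    finally have "100 * ln \<mu> - ln 132 \<le> (\<Sum>l<100. ln (max (cmod (z - child_pos l)) (rr / 2)))"
      using \<mu>(1) by (simp add: ln_div ln_realpow)
    moreover have "ln (max (cmod z) (1/2)) \<le> ln \<mu>"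
      by (subst ln_le_cancel_iff) (use \<mu> in \<open>auto simp: less_max_iff_disj\<close>)
    ultimately show ?thesis using ln_132 by (simp add: kern_def)
  qed
  \<comment> \<open>The outer centres were excluded to allow division by \<open>w - 1\<close>. The
    complement of \<open>A\<close> is open and consists of at most these finitely many points, so it
    is empty.\<close>
  have "closed A" unfolding A_def
    by (intro closed_Collect_le continuous_intros continuous_on_kern)
  then have "open (- A)" by (simp add: open_Compl)
  moreover have "finite (- A)"
    by (rule finite_subset[of _ "child_pos ` {..<100}"]) (use ge in \<open>auto simp: A_def\<close>)
  ultimately have "- A = {}"
    by (metis countable_finite ex_in_conv openE countable_subset uncountable_ball)
  then show ?thesis by (auto simp: A_def)
qed

text \<open>Well inside the outer circle its charges act almost like a uniformly charged circle,
  with potential \<open>ln (3/4)\<close>; against \<open>ln (1/2)\<close> this leaves nearly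
  \<open>ln (3/2)\<close>, which is at least 1/3.\<close>

lemma kern_inner_ge:
  assumes "cmod z \<le> 1/2"
  shows "32/100 \<le> kern z"
proof -
  have "rr / 2 \<le> cmod (z - child_pos l)" if "l < 100" for l
    using norm_child_pos_bounds(4)[of l] that assms norm_triangle_ineq2[of "child_pos l" z]
    by (simp add: norm_minus_commute rr_def)
  then have S: "(\<Sum>l<100. ln (max (cmod (z - child_pos l)) (rr / 2)))
      = ln (cmod (z ^ 100 - of_real (3/4) ^ 100))"
    by (rule sum_ln_outer)
  have "(3/4) ^ 100 - cmod z ^ 100 \<le> cmod (z ^ 100 - of_real (3/4) ^ 100)"
  proof -
    have "cmod (of_real (3/4) ^ 100) - cmod (z ^ 100) \<le> cmod (of_real (3/4) ^ 100 - z ^ 100)"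
      by (rule norm_triangle_ineq2)
    then show ?thesis by (simp only: norm_power norm_of_real norm_minus_commute)
  qed
  moreover have "cmod z ^ 100 \<le> (1/2) ^ 100" using assms by (intro power_mono) auto
  moreover have "(3/4) ^ 100 / 2 \<le> (3/4) ^ 100 - (1/2 :: real) ^ 100" by (simp add: power_divide)
  ultimately have "(3/4) ^ 100 / 2 \<le> cmod (z ^ 100 - of_real (3/4) ^ 100)" by linarith
  then have "ln ((3/4) ^ 100 / 2) \<le> ln (cmod (z ^ 100 - of_real (3/4) ^ 100))"
    by (rule ln_mono) simp
  then have "100 * ln (3/4) - ln 2 \<le> ln (cmod (z ^ 100 - of_real (3/4) ^ 100))"
    by (simp only: ln_div ln_realpow) simp
  then have "ln (3/4) - ln 2 / 100 - ln (1/2) \<le> kern z"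
    using assms unfolding kern_def S by (simp add: max_def)
  moreover have "ln (3/4) - ln (1/2) = ln (3/2 :: real)" by (simp add: ln_div ln_mult[of 2 2, simplified])
  moreover have "1/3 \<le> ln (3/2 :: real)"
  proof -
    have "exp (1/3) \<le> 1 + 1/3 + (1/3 :: real)\<^sup>2" by (rule exp_bound) auto
    then have "exp (1/3) \<le> (3/2 :: real)" by (simp add: power2_eq_square)
    then have "ln (exp (1/3)) \<le> ln (3/2 :: real)" by (rule ln_mono) simp
    then show ?thesis by simp
  qed
  moreover have "ln 2 \<le> (1 :: real)" using ln_2_less_1 by simp
  ultimately show ?thesis by simp
qed

text \<open>The total charge is zero and the 100-fold symmetry of the outer charges cancels the
  lower multipoles, so the true order of decay is 100. Quadratic decay is the form in which the
  superposition uses it.\<close>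

lemma kern_outside:
  assumes "1 \<le> cmod z"
  shows "\<bar>kern z\<bar> \<le> 1 / 10 ^ 8 / (cmod z)\<^sup>2"
proof -
  have "rr / 2 \<le> cmod (z - child_pos l)" if "l < 100" for l
    using norm_child_pos_bounds(4)[of l] that assms norm_triangle_ineq2[of z "child_pos l"]
    by (simp add: rr_def)
  then have S: "(\<Sum>l<100. ln (max (cmod (z - child_pos l)) (rr / 2)))
      = ln (cmod (z ^ 100 - of_real (3/4) ^ 100))"
    by (rule sum_ln_outer)
  have z0: "z \<noteq> 0" using assms by auto
  define u where "u = - ((of_real (3/4) / z) ^ 100)"
  have "cmod u = (3/4) ^ 100 / cmod z ^ 100"
    by (simp add: u_def norm_power norm_divide power_divide)
  also have "\<dots> \<le> (3/4) ^ 100 / cmod z ^ 2"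
    using assms by (intro divide_left_mono power_increasing mult_pos_pos) auto
  also have "\<dots> \<le> 1 / 10 ^ 9 / cmod z ^ 2"
    by (intro divide_right_mono) (auto simp: power_divide)
  finally have u: "cmod u \<le> 1 / 10 ^ 9 / (cmod z)\<^sup>2" .
  also have "\<dots> \<le> 1 / 10 ^ 9"
  proof -
    have "1 \<le> (cmod z)\<^sup>2" using assms by simp
    then show ?thesis by (simp add: divide_simps)
  qed
  finally have u1: "cmod u \<le> 1 / 10 ^ 9" .
  then have "u \<noteq> - 1" by auto
  then have "1 + u \<noteq> 0" by (simp add: add_eq_0_iff)
  have "z ^ 100 - of_real (3/4) ^ 100 = z ^ 100 * (1 + u)"
    using z0 by (simp add: u_def power_divide algebra_simps)
  then have "ln (cmod (z ^ 100 - of_real (3/4) ^ 100)) = 100 * ln (cmod z) + ln (cmod (1 + u))"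
    using z0 \<open>1 + u \<noteq> 0\<close> by (simp add: norm_mult norm_power ln_mult ln_realpow)
  then have "kern z = ln (cmod (1 + u)) / 100"
    using assms unfolding kern_def S by (simp add: max_def add_divide_distrib)
  moreover have "ln (cmod (1 + u)) = Re (Ln (1 + u))" using \<open>1 + u \<noteq> 0\<close> by simp
  moreover have "\<bar>Re (Ln (1 + u))\<bar> \<le> 2 * cmod u"
    using abs_Re_le_cmod norm_Ln_le[of u] u1 order_trans by fastforce
  ultimately have "\<bar>kern z\<bar> \<le> 2 * cmod u / 100" by simp
  also have "\<dots> \<le> cmod u" by simp
  also note u
  also have "1 / 10 ^ 9 / (cmod z)\<^sup>2 \<le> 1 / 10 ^ 8 / (cmod z)\<^sup>2" by (intro divide_right_mono) auto
  finally show ?thesis .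
qed

subsection \<open>Self-similar superposition of kernels\<close>

definition zoom :: "nat \<Rightarrow> complex \<Rightarrow> complex" where
  "zoom l z = (z - child_pos l) / of_real rr"

text \<open>The weight of a node is divided by 4 at outer letters, where the kernel may be slightly
  negative, and multiplied by 4 at inner letters, where it is large. Hence \<open>1 + pot n k\<close> is at
  least the weight along every path, and it exceeds 1 substantially on all dead discs.\<close>

fun pot :: "nat \<Rightarrow> nat \<Rightarrow> complex \<Rightarrow> real" where
  "pot 0 k z = 0"
| "pot (Suc n) k z = 10 * kern z + (\<Sum>l<100. pot n (Suc k) (zoom l z)) / 4
     + (if k = 0 then 0 else 4 * (\<Sum>l\<in>{100..<2200}. pot n (k - 1) (zoom l z)))"

declare pot.simps(2) [simp del]

lemma norm_zoom: "cmod (zoom l z) = dist z (child_pos l) / rr"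
  by (simp add: zoom_def norm_divide dist_norm)

lemma norm_zoom_outside:
  assumes "1 \<le> cmod z" "l < 2200"
  shows "550 * cmod z \<le> cmod (zoom l z)"
proof -
  have "cmod z / 4 \<le> dist z (child_pos l)"
    using norm_child_pos_bounds(2)[OF assms(2)] assms(1) norm_triangle_ineq2[of z "child_pos l"]
    by (simp add: dist_norm)
  then show ?thesis by (simp add: norm_zoom rr_def)
qed

text \<open>Every child is charged with the larger weight 4, and
  \<open>8800 = 4 * 2200\<close>.\<close>

lemma sum_children_le:
  fixes f g :: "nat \<Rightarrow> real"
  assumes "\<And>l. l < 2200 \<Longrightarrow> \<bar>f l\<bar> \<le> b" "\<And>l. l < 2200 \<Longrightarrow> \<bar>g l\<bar> \<le> b"
  shows "\<bar>(\<Sum>l<100. f l) / 4 + (if k = (0::nat) then 0 else 4 * (\<Sum>l\<in>{100..<2200}. g l))\<bar> \<le> 8800 * b"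
proof -
  have b: "0 \<le> b" using assms(1)[of 0] by simp
  have "\<bar>\<Sum>l<100. f l\<bar> \<le> (\<Sum>l<(100::nat). b)"
    by (rule order_trans[OF sum_abs]) (intro sum_mono assms(1), auto)
  moreover have "\<bar>\<Sum>l\<in>{100..<2200}. g l\<bar> \<le> (\<Sum>l\<in>{100..<2200::nat}. b)"
    by (rule order_trans[OF sum_abs]) (intro sum_mono assms(2), auto)
  ultimately show ?thesis using b by auto
qed

text \<open>Zooming multiplies the modulus by at least 550, so quadratic decay gains
  \<open>302500 = 550^2\<close> per generation and beats the factor 8800 of the superposition.
  Linear decay would lose against it.\<close>

lemma decay_child:
  assumes "1 \<le> cmod z" "l < 2200" "0 \<le> c" "\<bar>x\<bar> \<le> c / (cmod (zoom l z))\<^sup>2"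
  shows "\<bar>x\<bar> \<le> c / 302500 / (cmod z)\<^sup>2"
proof -
  have "(550 * cmod z)\<^sup>2 \<le> (cmod (zoom l z))\<^sup>2"
    using norm_zoom_outside[OF assms(1,2)] assms(1) by (intro power_mono) auto
  moreover have "0 < (550 * cmod z)\<^sup>2" using assms(1) by (intro zero_less_power) linarith
  ultimately have "c / (cmod (zoom l z))\<^sup>2 \<le> c / (550 * cmod z)\<^sup>2"
    using assms(3) by (intro frac_le) auto
  also have "\<dots> = c / 302500 / (cmod z)\<^sup>2" by (simp add: power_mult_distrib)
  finally show ?thesis using assms(4) by simp
qed

lemma zoom_outside: "1 \<le> cmod z \<Longrightarrow> l < 2200 \<Longrightarrow> 1 \<le> cmod (zoom l z)"
  using norm_zoom_outside[of z l] by linarith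

lemma pot_outside: "1 \<le> cmod z \<Longrightarrow> \<bar>pot n k z\<bar> \<le> 1 / 10 ^ 6 / (cmod z)\<^sup>2"
proof (induction n arbitrary: k z)
  case (Suc n)
  have z: "1 \<le> cmod z" by fact
  define X where "X = (\<Sum>l<100. pot n (Suc k) (zoom l z)) / 4
     + (if k = 0 then 0 else 4 * (\<Sum>l\<in>{100..<2200}. pot n (k - 1) (zoom l z)))"
  define Q where "Q = 1 / 10 ^ 6 / (cmod z)\<^sup>2"
  have b: "\<bar>pot n j (zoom l z)\<bar> \<le> Q / 302500" if "l < 2200" for j l
    using decay_child[OF z that _ Suc.IH[OF zoom_outside[OF z that]]] by (simp add: Q_def)
  have "\<bar>X\<bar> \<le> 8800 * (Q / 302500)"
    unfolding X_def by (rule sum_children_le) (rule b, assumption)+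
  moreover have "\<bar>kern z\<bar> \<le> Q / 100"
    using kern_outside[OF z] by (simp add: Q_def)
  moreover have "0 \<le> Q" by (simp add: Q_def)
  moreover have "pot (Suc n) k z = 10 * kern z + X" by (simp add: X_def pot.simps)
  ultimately show ?case unfolding Q_def[symmetric] by linarith
qed simp

lemma pot_outside_le: "1 \<le> cmod z \<Longrightarrow> \<bar>pot n k z\<bar> \<le> 1 / 10 ^ 6"
proof -
  assume z: "1 \<le> cmod z"
  then have "1 \<le> (cmod z)\<^sup>2" by simp
  then have "1 / 10 ^ 6 / (cmod z)\<^sup>2 \<le> 1 / 10 ^ 6" by (simp add: divide_simps)
  then show ?thesis using pot_outside[OF z, of n k] by linarith
qed

text \<open>All children but \<open>l\<close> see the point from outside their unit disc and
  together contribute at most \<open>8800 / 10 ^ 6 = 11 / 1250\<close>. An index \<open>l\<close> of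
  at least 2200 expresses that no child is near.\<close>

lemma pot_step:
  assumes "\<And>l'. l' < 2200 \<Longrightarrow> l' \<noteq> l \<Longrightarrow> 1 \<le> cmod (zoom l' z)"
  shows "10 * kern z - 11 / 1250 + (if l < 100 then pot n (Suc k) (zoom l z) / 4
      else if 0 < k \<and> l < 2200 then 4 * pot n (k - 1) (zoom l z) else 0) \<le> pot (Suc n) k z"
proof -
  define f where "f = (\<lambda>l'. if l' = l then 0 else pot n (Suc k) (zoom l' z))"
  define g where "g = (\<lambda>l'. if l' = l then 0 else pot n (k - 1) (zoom l' z))"
  define E where "E = (\<Sum>l<100. f l) / 4 + (if k = 0 then 0 else 4 * (\<Sum>l\<in>{100..<2200}. g l))"
  have "\<bar>E\<bar> \<le> 8800 * (1 / 10 ^ 6)"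
    unfolding E_def by (rule sum_children_le) (auto simp: f_def g_def intro!: pot_outside_le[simplified] assms)
  have "(\<Sum>l'<100. pot n (Suc k) (zoom l' z)) = (if l < 100 then pot n (Suc k) (zoom l z) else 0) + (\<Sum>l<100. f l)"
  proof -
    have "(\<Sum>l'<100. pot n (Suc k) (zoom l' z))
        = (\<Sum>l'<100. (if l' = l then pot n (Suc k) (zoom l z) else 0) + f l')"
      by (intro sum.cong) (auto simp: f_def)
    then show ?thesis by (simp add: sum.distrib)
  qed
  moreover have "(\<Sum>l'\<in>{100..<2200}. pot n (k - 1) (zoom l' z))
      = (if 100 \<le> l \<and> l < 2200 then pot n (k - 1) (zoom l z) else 0) + (\<Sum>l\<in>{100..<2200}. g l)"
  proof -
    have "(\<Sum>l'\<in>{100..<2200}. pot n (k - 1) (zoom l' z))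
        = (\<Sum>l'\<in>{100..<2200}. (if l' = l then pot n (k - 1) (zoom l z) else 0) + g l')"
      by (intro sum.cong) (auto simp: g_def)
    then show ?thesis by (simp add: sum.distrib)
  qed
  ultimately have "pot (Suc n) k z = 10 * kern z + (if l < 100 then pot n (Suc k) (zoom l z) / 4
      else if 0 < k \<and> l < 2200 then 4 * pot n (k - 1) (zoom l z) else 0) + E"
    by (auto simp: E_def pot.simps add_divide_distrib)
  moreover have "- (11 / 1250) \<le> E" using \<open>\<bar>E\<bar> \<le> 8800 * (1 / 10 ^ 6)\<close> by simp
  ultimately show ?thesis by linarith
qed

lemma zoom_other:
  assumes "l < 2200" "l' < 2200" "l' \<noteq> l" "cmod (zoom l z) \<le> 1"
  shows "1 \<le> cmod (zoom l' z)"
proof -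
  have "dist z (child_pos l) \<le> rr" using assms(4) by (simp add: norm_zoom)
  then have "rr \<le> dist z (child_pos l')"
    using dist_child_pos[OF assms(1,2)] assms(3) dist_triangle3[of "child_pos l" "child_pos l'" z] rr_pos(1)
    by linarith
  then show ?thesis by (simp add: norm_zoom)
qed

lemma kern_inner_child:
  assumes "100 \<le> l" "l < 2200" "cmod (zoom l z) \<le> 1"
  shows "32/100 \<le> kern z"
proof (rule kern_inner_ge)
  have "dist z (child_pos l) \<le> rr" using assms(3) by (simp add: norm_zoom)
  then show "cmod z \<le> 1/2"
    using norm_child_pos_bounds(3)[OF assms(2,1)] norm_triangle_ineq2[of z "child_pos l"]
    by (simp add: dist_norm rr_def)
qed

text \<open>The step costs at most \<open>10 / 20 + 11 / 1250\<close>, less than 3/4, which is what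
  the passage from weight 1 to 1/4 can afford.\<close>

lemma pot_child_outer:
  assumes "l < 100" "cmod (zoom l z) \<le> 1"
  shows "1 + pot n (Suc k) (zoom l z) \<le> 4 * (1 + pot (Suc n) k z)"
  using pot_step[of l z n k] zoom_other[of l _ z] assms kern_ge[of z] by simp

text \<open>The gain \<open>10 * 32/100 - 11 / 1250\<close> exceeds 3; this is the reason for the
  factor 10 in front of the kernel.\<close>

lemma pot_child_inner:
  assumes "100 \<le> l" "l < 2200" "cmod (zoom l z) \<le> 1"
  shows "0 < k \<Longrightarrow> 4 * (1 + pot n (k - 1) (zoom l z)) \<le> 1 + pot (Suc n) k z"
    and "k = 0 \<Longrightarrow> 4 \<le> 1 + pot (Suc n) k z"
  using pot_step[of l z n k] zoom_other[of l _ z] assms kern_inner_child[of l z] by simp_all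

lemma pot_ge: "0 \<le> 1 + pot n k z"
proof (induction n arbitrary: k z)
  case (Suc n)
  show ?case
  proof (cases "\<exists>l<2200. cmod (zoom l z) \<le> 1")
    case True
    then obtain l where l: "l < 2200" "cmod (zoom l z) \<le> 1" by blast
    show ?thesis
    proof (cases "l < 100")
      case True
      show ?thesis using pot_child_outer[OF True l(2), of n k] Suc.IH[of "Suc k" "zoom l z"] by argo
    next
      case False
      then have l100: "100 \<le> l" by simp
      show ?thesis
      proof (cases "k = 0")
        case True
        then show ?thesis using pot_child_inner(2)[OF l100 l, of k n] by simp
      next
        case k: False
        then have "4 * (1 + pot n (k - 1) (zoom l z)) \<le> 1 + pot (Suc n) k z"
          using pot_child_inner(1)[OF l100 l, of k n] by simp
        then show ?thesis using Suc.IH[of "k - 1" "zoom l z"] by argo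
      qed
    qed
  next
    case False
    then have "1 \<le> cmod (zoom l z)" if "l < 2200" for l using that by force
    then show ?thesis using pot_step[of 2200 z n k] kern_ge[of z] by simp
  qed
qed simp

lemma zoom_emb: "zoom l (emb (l # w) z) = emb w z"
  by (simp add: zoom_def)

text \<open>Along the path to a dead node the weights multiply to 4 per net inner step, and capture
  from state \<open>k\<close> takes \<open>k + 1\<close> net inner steps.\<close>

lemma pot_dead:
  assumes "dead k w" "z \<in> disc w" "length w \<le> n"
  shows "4 ^ Suc k \<le> 1 + pot n k z"
  using assms
proof (induction n arbitrary: k w z)
  case 0
  then show ?case by simp
next
  case (Suc n)
  then obtain l v where w: "w = l # v" by (cases w) auto
  obtain s where s: "s \<in> cball 0 1" "z = emb w s" using Suc.prems(2) by (auto simp: disc_def)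
  have l: "l < 2200" using Suc.prems(1) by (simp add: w)
  have \<zeta>: "zoom l z = emb v s" unfolding s(2) w by (rule zoom_emb)
  then have \<zeta>d: "zoom l z \<in> disc v" using s(1) by (simp add: disc_def)
  have "set v \<subseteq> {..<2200}" using node_letters[OF node_dead[OF Suc.prems(1)]] by (simp add: w)
  then have \<zeta>1: "cmod (zoom l z) \<le> 1" using emb_in_cball[OF _ s(1), of v] by (simp add: \<zeta>)
  show ?case
  proof (cases "l < 100")
    case True
    then have "4 ^ Suc (Suc k) \<le> 1 + pot n (Suc k) (zoom l z)"
      using Suc.prems by (intro Suc.IH[of "Suc k" v] \<zeta>d) (auto simp: w)
    then show ?thesis using pot_child_outer[OF True \<zeta>1, of n k] by simp
  next
    case False
    then have l100: "100 \<le> l" by simp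
    show ?thesis
    proof (cases "k = 0")
      case True
      then show ?thesis using pot_child_inner(2)[OF l100 l \<zeta>1 True] by simp
    next
      case k: False
      then have "4 ^ Suc (k - 1) \<le> 1 + pot n (k - 1) (zoom l z)"
        using Suc.prems False by (intro Suc.IH[of "k - 1" v] \<zeta>d) (auto simp: w)
      then show ?thesis using pot_child_inner(1)[OF l100 l \<zeta>1, of k n] k by simp
    qed
  qed
qed

lemma pot_diff_outside:
  assumes "1 \<le> cmod z" "n \<le> m"
  shows "\<bar>pot m k z - pot n k z\<bar> \<le> 1 / 10 ^ 6 * (1/2) ^ n / (cmod z)\<^sup>2"
  using assms
proof (induction n arbitrary: m k z)
  case 0
  then show ?case using pot_outside[of z m k] by simp
next
  case (Suc n)
  then obtain m' where m: "m = Suc m'" "n \<le> m'" by (cases m) auto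
  have z: "1 \<le> cmod z" by fact
  define f where "f = (\<lambda>l. pot m' (Suc k) (zoom l z) - pot n (Suc k) (zoom l z))"
  define g where "g = (\<lambda>l. pot m' (k - 1) (zoom l z) - pot n (k - 1) (zoom l z))"
  have b: "\<bar>pot m' j (zoom l z) - pot n j (zoom l z)\<bar> \<le> 1 / 10 ^ 6 * (1/2) ^ n / 302500 / (cmod z)\<^sup>2"
    if "l < 2200" for l j
    by (rule decay_child[OF z that _ Suc.IH[OF zoom_outside[OF z that] m(2)]]) simp
  have "\<bar>(\<Sum>l<100. f l) / 4 + (if k = 0 then 0 else 4 * (\<Sum>l\<in>{100..<2200}. g l))\<bar>
      \<le> 8800 * (1 / 10 ^ 6 * (1/2) ^ n / 302500 / (cmod z)\<^sup>2)"
    by (rule sum_children_le) (auto simp only: f_def g_def intro: b)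
  also have "\<dots> = (8800 / 302500 * 2) * (1 / 10 ^ 6 * (1/2) ^ Suc n / (cmod z)\<^sup>2)" by simp
  also have "\<dots> \<le> 1 * (1 / 10 ^ 6 * (1/2) ^ Suc n / (cmod z)\<^sup>2)"
    by (intro mult_right_mono) auto
  finally have "\<bar>(\<Sum>l<100. f l) / 4 + (if k = 0 then 0 else 4 * (\<Sum>l\<in>{100..<2200}. g l))\<bar>
      \<le> 1 / 10 ^ 6 * (1/2) ^ Suc n / (cmod z)\<^sup>2" by simp
  moreover have "pot m k z - pot (Suc n) k z
      = (\<Sum>l<100. f l) / 4 + (if k = 0 then 0 else 4 * (\<Sum>l\<in>{100..<2200}. g l))"
    by (simp add: m(1) f_def g_def pot.simps sum_subtractf diff_divide_distrib)
  ultimately show ?case by metis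
qed

lemma zoom_notin_level:
  assumes "z \<notin> level k (Suc j)" "l < 2200" "if l < 100 then k' = Suc k else 0 < k \<and> k' = k - 1"
  shows "zoom l z \<notin> level k' j"
proof
  assume "zoom l z \<in> level k' j"
  then have "child_pos l + of_real rr * zoom l z \<in> level k (Suc j)"
    by (rule level_Cons[OF assms(2) _ assms(3)])
  then show False using assms(1) by (simp add: zoom_def)
qed

text \<open>Peeling off \<open>j\<close> letters costs a factor 8800 each; after that the point lies
  outside the unit disc and the geometric decay of the tails takes over. As \<open>level\<close>
  omits dead discs, the estimate holds inside them too.\<close>

lemma pot_diff:
  assumes "z \<notin> level k j" "j \<le> n" "n \<le> m"
  shows "\<bar>pot m k z - pot n k z\<bar> \<le> 8800 ^ j * (1/2) ^ (n - j)"
  using assms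
proof (induction j arbitrary: n m k z)
  case 0
  then have z: "1 \<le> cmod z" by simp
  then have "1 \<le> (cmod z)\<^sup>2" by simp
  then have "1 / 10 ^ 6 * (1/2) ^ n / (cmod z)\<^sup>2 \<le> 1 / 10 ^ 6 * (1/2) ^ n / 1"
    by (intro divide_left_mono) auto
  then have "\<bar>pot m k z - pot n k z\<bar> \<le> 1 / 10 ^ 6 * (1/2) ^ n"
    using pot_diff_outside[OF z 0(3), of k] by simp
  also have "\<dots> \<le> 1 * (1/2) ^ n" by (intro mult_right_mono) auto
  finally show ?case by simp
next
  case (Suc j)
  then obtain n' m' where nm: "n = Suc n'" "m = Suc m'" "j \<le> n'" "n' \<le> m'"
    by (cases n; cases m) auto
  define f where "f = (\<lambda>l. if l < 100 then pot m' (Suc k) (zoom l z) - pot n' (Suc k) (zoom l z) else 0)"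
  define g where "g = (\<lambda>l. if 100 \<le> l \<and> 0 < k then pot m' (k - 1) (zoom l z) - pot n' (k - 1) (zoom l z) else 0)"
  have "\<bar>(\<Sum>l<100. f l) / 4 + (if k = 0 then 0 else 4 * (\<Sum>l\<in>{100..<2200}. g l))\<bar>
      \<le> 8800 * (8800 ^ j * (1/2) ^ (n' - j))"
  proof (rule sum_children_le)
    fix l :: nat assume l: "l < 2200"
    show "\<bar>f l\<bar> \<le> 8800 ^ j * (1/2) ^ (n' - j)"
      using Suc.IH[OF zoom_notin_level[OF Suc.prems(1) l, of "Suc k"] nm(3,4)] by (simp add: f_def)
    show "\<bar>g l\<bar> \<le> 8800 ^ j * (1/2) ^ (n' - j)"
      using Suc.IH[OF zoom_notin_level[OF Suc.prems(1) l, of "k - 1"] nm(3,4)] by (simp add: g_def)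
  qed
  moreover have "(\<Sum>l<100. f l) = (\<Sum>l<100. pot m' (Suc k) (zoom l z)) - (\<Sum>l<100. pot n' (Suc k) (zoom l z))"
    by (simp add: f_def sum_subtractf)
  moreover have "k \<noteq> 0 \<Longrightarrow> (\<Sum>l\<in>{100..<2200}. g l)
      = (\<Sum>l\<in>{100..<2200}. pot m' (k - 1) (zoom l z)) - (\<Sum>l\<in>{100..<2200}. pot n' (k - 1) (zoom l z))"
    by (simp add: g_def sum_subtractf)
  ultimately show ?case
    by (auto simp: nm pot.simps diff_divide_distrib algebra_simps)
qed

lemma continuous_on_pot: "continuous_on S (pot n k)"
proof (induction n arbitrary: k S)
  case 0
  show ?case by simp
next
  case (Suc n)
  have z: "continuous_on S (\<lambda>z. pot n j (zoom l z))" for j l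
    by (rule continuous_on_compose2[OF Suc[of UNIV j]]) (auto simp: zoom_def intro!: continuous_intros)
  show ?case
    unfolding pot.simps by (cases "k = 0") (simp_all, (intro continuous_intros continuous_on_kern z; simp)+)
qed

subsection \<open>Superharmonicity and the limit\<close>

lemma submean_at_add:
  assumes "continuous_on UNIV v" "continuous_on UNIV w" "submean_at v z" "submean_at w z"
  shows "submean_at (\<lambda>x. v x + w x) z"
proof -
  obtain d where d: "d > 0" "\<And>r. 0 < r \<Longrightarrow> r < d \<Longrightarrow> v z \<le> circle_mean v z r"
    using assms(3) by (auto simp: submean_at_def)
  obtain e where e: "e > 0" "\<And>r. 0 < r \<Longrightarrow> r < e \<Longrightarrow> w z \<le> circle_mean w z r"
    using assms(4) by (auto simp: submean_at_def)
  have "v z + w z \<le> circle_mean (\<lambda>x. v x + w x) z r" if "0 < r" "r < min d e" for r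
  proof -
    have "circle_mean (\<lambda>x. v x + w x) z r = circle_mean v z r + circle_mean w z r"
      using that by (intro circle_mean_add continuous_on_subset[OF assms(1)] continuous_on_subset[OF assms(2)]) auto
    then show ?thesis using d(2)[of r] e(2)[of r] that by simp
  qed
  then show ?thesis unfolding submean_at_def using d e by (intro exI[of _ "min d e"]) auto
qed

lemma submean_at_cmult:
  assumes "submean_at v z" "0 \<le> c"
  shows "submean_at (\<lambda>x. c * v x) z"
  using assms unfolding submean_at_def circle_mean_cmult by (meson mult_left_mono)

lemma submean_at_sum:
  assumes "finite I" "\<And>i. i \<in> I \<Longrightarrow> continuous_on UNIV (v i)" "\<And>i. i \<in> I \<Longrightarrow> submean_at (v i) z"
  shows "submean_at (\<lambda>x. \<Sum>i\<in>I. v i x) z"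
  using assms
proof (induction I rule: finite_induct)
  case empty
  show ?case using submean_at_const[of 0] by simp
next
  case (insert i I)
  then have "submean_at (\<lambda>x. v i x + (\<Sum>i\<in>I. v i x)) z"
    by (intro submean_at_add continuous_on_sum) auto
  then show ?case using insert.hyps by simp
qed

lemma submean_at_zoom:
  assumes "submean_at v (zoom l z)"
  shows "submean_at (\<lambda>x. v (zoom l x)) z"
proof -
  obtain d where d: "d > 0" "\<And>r. 0 < r \<Longrightarrow> r < d \<Longrightarrow> v (zoom l z) \<le> circle_mean v (zoom l z) r"
    using assms by (auto simp: submean_at_def)
  have "v (zoom l z) \<le> circle_mean (\<lambda>x. v (zoom l x)) z r" if "0 < r" "r < d * rr" for r
    using d(2)[of "r / rr"] that unfolding zoom_def circle_mean_affine by (simp add: pos_divide_less_eq)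
  then show ?thesis unfolding submean_at_def using d(1) by (intro exI[of _ "d * rr"]) auto
qed

text \<open>Potential of a uniform charge on the circle of radius 1/2. In these terms the negative
  charges of a kernel sit exactly where the kernels of its outer children carry their positive
  ones.\<close>

definition ln_max :: "complex \<Rightarrow> real" where "ln_max z = ln (max (cmod z) (1/2))"

lemma continuous_on_ln_max: "continuous_on S ln_max"
  unfolding ln_max_def by (intro continuous_intros) (auto simp: max_def)

lemma circle_mean_ln_max:
  assumes "0 < r" "r \<le> cmod z - 1/2"
  shows "circle_mean ln_max z r = ln_max z"
proof -
  have "circle_mean ln_max z r = circle_mean (\<lambda>w. ln (cmod (w - 0))) z r"
  proof (rule circle_mean_cong)
    fix w assume "w \<in> sphere z r"
    then have "1/2 \<le> cmod w" using assms norm_triangle_ineq2[of z "z - w"] by (simp add: dist_norm)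
    then show "ln_max w = ln (cmod (w - 0))" by (simp add: ln_max_def)
  qed (use assms in simp)
  also have "\<dots> = ln (cmod (z - 0))" by (rule circle_mean_ln_norm) (use assms in auto)
  also have "\<dots> = ln_max z" using assms by (simp add: ln_max_def)
  finally show ?thesis .
qed

lemma submean_at_ln_max: "submean_at ln_max z"
proof (cases "1/2 \<le> cmod z")
  case True
  then have z0: "z \<noteq> 0" by auto
  have c: "continuous_on (- {0}) (\<lambda>z::complex. ln (cmod z))" by (intro continuous_intros) auto
  have "submean_at (\<lambda>z. ln (cmod z)) z"
    unfolding submean_at_def
    by (intro exI[of _ "cmod z"]) (use z0 circle_mean_ln_norm[of _ z 0] in auto)
  moreover have "\<forall>\<^sub>F x in nhds z. ln (cmod x) \<le> ln_max x"
  proof -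
    have "\<forall>\<^sub>F x in nhds z. x \<in> - {0}" using z0 by (intro eventually_nhds_in_open) auto
    then show ?thesis by eventually_elim (auto simp: ln_max_def less_max_iff_disj)
  qed
  ultimately show ?thesis
    by (intro submean_at_ge[of z "- {0}" ln_max "\<lambda>z. ln (cmod z)"] c continuous_on_ln_max)
       (use z0 True in \<open>auto simp: ln_max_def\<close>)
next
  case False
  have "\<forall>\<^sub>F x in nhds z. ln (1/2) \<le> ln_max x"
    by (intro always_eventually allI) (auto simp: ln_max_def less_max_iff_disj)
  then show ?thesis
    by (intro submean_at_ge[of z UNIV ln_max "\<lambda>_. ln (1/2)"] continuous_on_ln_max submean_at_const)
       (use False in \<open>auto simp: ln_max_def\<close>)
qed

lemma kern_eq: "kern z = - ln_max z + (\<Sum>l<100. ln_max (zoom l z)) / 100 + ln rr"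
proof -
  have "ln (max (cmod (z - child_pos l)) (rr / 2)) = ln_max (zoom l z) + ln rr" for l
  proof -
    have "max (cmod (z - child_pos l)) (rr / 2) = rr * max (cmod (zoom l z)) (1/2)"
      by (simp add: norm_zoom dist_norm max_mult_distrib_left)
    then show ?thesis by (simp add: ln_max_def ln_mult_pos less_max_iff_disj)
  qed
  then show ?thesis unfolding kern_def ln_max_def[symmetric] by (simp add: sum.distrib add_divide_distrib)
qed

text \<open>The charges \<open>\<plusminus>\<close> of consecutive generations partly cancel; only the negative charges on the
  circles of the last generation survive, and these lie in the discs of the live nodes.\<close>

lemma submean_at_minus_pot_ln:
  "z \<notin> level k n \<Longrightarrow> submean_at (\<lambda>z. - pot n k z - 2/5 * ln_max z) z"
proof (induction n arbitrary: k z)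
  case 0
  then have z: "1 < cmod z" by simp
  show ?case unfolding submean_at_def
  proof (intro exI[of _ "1/2"] conjI allI impI)
    fix r :: real assume r: "0 < r \<and> r < 1/2"
    then have "circle_mean ln_max z r = ln_max z" using z by (intro circle_mean_ln_max) auto
    then show "- pot 0 k z - 2/5 * ln_max z \<le> circle_mean (\<lambda>z. - pot 0 k z - 2/5 * ln_max z) z r"
      using circle_mean_cmult[of "- (2/5)" ln_max z r] by simp
  qed simp
next
  case (Suc n)
  define h where "h = (\<lambda>j x. - pot n j x - 2/5 * ln_max x)"
  have ch: "continuous_on UNIV (\<lambda>x. h j (zoom l x))" for j l
  proof -
    have "continuous_on UNIV (h j)"
      unfolding h_def by (intro continuous_intros continuous_on_pot continuous_on_ln_max)
    then show ?thesis
      by (rule continuous_on_compose2) (auto simp: zoom_def intro!: continuous_intros)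
  qed
  have cl: "continuous_on UNIV (\<lambda>x. ln_max (zoom l x))" for l
    by (rule continuous_on_compose2[OF continuous_on_ln_max[of UNIV]]) (auto simp: zoom_def intro!: continuous_intros)
  \<comment> \<open>An outer child receives the charge \<open>10 / 100\<close> from its parent,
    which is 2/5 in units of its weight 1/4: hence the correction \<open>2/5 * ln_max\<close>. What
    remains, \<open>10 - 2/5\<close> at the parent and \<open>4 * 2/5\<close> at inner children, has
    the good sign.\<close>
  define A where "A = (\<lambda>x. 48/5 * ln_max x + - 10 * ln rr)"
  define B where "B = (\<lambda>x. \<Sum>l<100. 1/4 * h (Suc k) (zoom l x))"
  define C where "C = (\<lambda>x. if k = 0 then 0 else \<Sum>l\<in>{100..<2200}. 4 * h (k - 1) (zoom l x) + 8/5 * ln_max (zoom l x))"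
  have cont: "continuous_on UNIV A" "continuous_on UNIV B" "continuous_on UNIV C"
    unfolding A_def B_def C_def
    by ((intro continuous_intros continuous_on_ln_max ch cl) | (cases "k = 0"; simp; intro continuous_intros ch cl))+
  have "submean_at A z"
    unfolding A_def by (intro submean_at_add submean_at_cmult submean_at_ln_max submean_at_const continuous_intros continuous_on_ln_max) simp
  moreover have "submean_at B z"
    unfolding B_def
  proof (intro submean_at_sum submean_at_cmult submean_at_zoom continuous_intros ch)
    fix l :: nat assume "l \<in> {..<100}"
    then show "submean_at (h (Suc k)) (zoom l z)"
      unfolding h_def by (intro Suc.IH zoom_notin_level[OF Suc.prems]) auto
  qed auto
  moreover have "submean_at C z"
  proof (cases "k = 0")
    case True
    then show ?thesis using submean_at_const[of 0 z] by (simp add: C_def)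
  next
    case False
    have "submean_at (\<lambda>x. \<Sum>l\<in>{100..<2200}. 4 * h (k - 1) (zoom l x) + 8/5 * ln_max (zoom l x)) z"
    proof (intro submean_at_sum submean_at_add submean_at_cmult continuous_intros ch cl)
      fix l :: nat assume l: "l \<in> {100..<2200}"
      show "submean_at (\<lambda>x. h (k - 1) (zoom l x)) z"
        using l False by (intro submean_at_zoom) (unfold h_def, intro Suc.IH zoom_notin_level[OF Suc.prems], auto)
      show "submean_at (\<lambda>x. ln_max (zoom l x)) z" by (intro submean_at_zoom submean_at_ln_max)
    qed auto
    then show ?thesis using False by (simp add: C_def)
  qed
  ultimately have "submean_at (\<lambda>x. A x + B x + C x) z"
    by (intro submean_at_add continuous_intros cont)
  moreover have "A x + B x + C x = - pot (Suc n) k x - 2/5 * ln_max x" for x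
    unfolding A_def B_def C_def h_def pot.simps kern_eq
    by (simp add: sum.distrib sum_subtractf sum_negf algebra_simps flip: sum_distrib_left sum_divide_distrib)
  ultimately show ?case by simp
qed

lemma submean_at_minus_pot: "z \<notin> level k n \<Longrightarrow> submean_at (\<lambda>z. - pot n k z) z"
proof -
  assume "z \<notin> level k n"
  then have "submean_at (\<lambda>x. (- pot n k x - 2/5 * ln_max x) + 2/5 * ln_max x) z"
    by (intro submean_at_add submean_at_minus_pot_ln submean_at_cmult submean_at_ln_max continuous_intros
        continuous_on_pot continuous_on_ln_max) auto
  then show ?thesis by simp
qed

definition pot_lim :: "complex \<Rightarrow> real" where "pot_lim z = lim (\<lambda>n. pot n 0 z)"

lemma geometric_eventually_small:
  assumes "0 < e" shows "\<exists>n\<ge>j. 8800 ^ j * (1/2) ^ (n - j) < (e::real)"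
proof -
  obtain m where "(1/2) ^ m < e / 8800 ^ j"
    using real_arch_pow_inv[of "e / 8800 ^ j" "1/2"] assms by auto
  then have "8800 ^ j * (1/2) ^ (m + j - j) < e" by (simp add: pos_less_divide_eq mult.commute)
  then show ?thesis by (intro exI[of _ "m + j"]) auto
qed

lemma pot_LIMSEQ:
  assumes z: "z \<notin> level 0 j"
  shows "(\<lambda>n. pot n 0 z) \<longlonglongrightarrow> pot_lim z"
proof -
  have "Cauchy (\<lambda>n. pot n 0 z)"
  proof (rule CauchyI')
    fix e :: real assume "0 < e"
    then obtain n where n: "n \<ge> j" "8800 ^ j * (1/2) ^ (n - j) < e / 2"
      using geometric_eventually_small[of "e/2" j] by auto
    have "dist (pot m 0 z) (pot m' 0 z) < e" if "m \<ge> n" "m' > m" for m m'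
      using pot_diff[OF z n(1), of m] pot_diff[OF z n(1), of m'] n(2) that
      unfolding dist_real_def by linarith
    then show "\<exists>M. \<forall>m\<ge>M. \<forall>n>m. dist (pot m 0 z) (pot n 0 z) < e" by blast
  qed
  then show ?thesis unfolding pot_lim_def using Cauchy_convergent convergent_LIMSEQ_iff by blast
qed

lemma pot_lim_approx:
  assumes "z \<notin> level 0 j" "j \<le> n"
  shows "\<bar>pot_lim z - pot n 0 z\<bar> \<le> 8800 ^ j * (1/2) ^ (n - j)"
proof (rule LIMSEQ_le_const2)
  show "(\<lambda>m. \<bar>pot m 0 z - pot n 0 z\<bar>) \<longlonglongrightarrow> \<bar>pot_lim z - pot n 0 z\<bar>"
    by (intro tendsto_intros pot_LIMSEQ[OF assms(1)])
  show "\<exists>N. \<forall>m\<ge>N. \<bar>pot m 0 z - pot n 0 z\<bar> \<le> 8800 ^ j * (1/2) ^ (n - j)"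
    using pot_diff[OF assms] by blast
qed

lemma continuous_on_pot_lim: "continuous_on (- level 0 j) pot_lim"
proof (rule uniform_limit_theorem)
  show "uniform_limit (- level 0 j) (\<lambda>n. pot n 0) pot_lim sequentially"
    unfolding uniform_limit_sequentially_iff
  proof (intro allI impI)
    fix e :: real assume "0 < e"
    then obtain n where n: "n \<ge> j" "8800 ^ j * (1/2) ^ (n - j) < e"
      using geometric_eventually_small by blast
    have "dist (pot m 0 x) (pot_lim x) < e" if "m \<ge> n" "x \<in> - level 0 j" for m x
    proof -
      have "(1/2) ^ (m - j) \<le> (1/2 :: real) ^ (n - j)" using that n by (intro power_decreasing) auto
      then have "8800 ^ j * (1/2) ^ (m - j) \<le> 8800 ^ j * (1/2 :: real) ^ (n - j)" by (intro mult_left_mono) auto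
      also note n(2)
      finally have "8800 ^ j * (1/2) ^ (m - j) < e" .
      moreover have "\<bar>pot_lim x - pot m 0 x\<bar> \<le> 8800 ^ j * (1/2) ^ (m - j)"
        by (rule pot_lim_approx) (use that n in auto)
      ultimately show ?thesis unfolding dist_real_def by linarith
    qed
    then show "\<exists>N. \<forall>n\<ge>N. \<forall>x\<in>- level 0 j. dist (pot n 0 x) (pot_lim x) < e" by blast
  qed
qed (auto intro!: always_eventually continuous_on_pot)

lemma submean_at_minus_pot_lim:
  assumes z: "z \<notin> level 0 j"
  shows "submean_at (\<lambda>z. - pot_lim z) z"
proof -
  have op: "open (- level 0 j)" by (simp add: open_Compl closed_level)
  then obtain d where d: "d > 0" "cball z d \<subseteq> - level 0 j"
    using z open_contains_cball by (metis ComplI)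
  show ?thesis unfolding submean_at_def
  proof (intro exI[of _ d] conjI allI impI)
    show "0 < d" by fact
    fix r assume r: "0 < r \<and> r < d"
    then have sub: "cball z r \<subseteq> - level 0 j" using d(2) by (auto simp: subset_iff)
    show "- pot_lim z \<le> circle_mean (\<lambda>z. - pot_lim z) z r"
    proof (rule field_le_epsilon)
      fix e :: real assume "0 < e"
      then obtain n where n: "n \<ge> j" "8800 ^ j * (1/2) ^ (n - j) < e / 2"
        using geometric_eventually_small[of "e/2" j] by auto
      have ap: "\<bar>pot_lim x - pot n 0 x\<bar> \<le> e / 2" if "x \<in> cball z r" for x
        using pot_lim_approx[of x j n] n that sub by force
      have "- pot n 0 z \<le> circle_mean (\<lambda>z. - pot n 0 z) z r"
      proof (rule submean_local_to_global)
        show "submean_at (\<lambda>z. - pot n 0 z) x" if "x \<in> ball z r" for x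
          using that sub level_mono[OF n(1), of 0] ball_subset_cball[of z r] by (intro submean_at_minus_pot) blast
      qed (use r in \<open>auto intro!: continuous_intros continuous_on_pot\<close>)
      also have "\<dots> \<le> circle_mean (\<lambda>z. - pot_lim z + e / 2) z r"
      proof (rule circle_mean_mono)
        show "- pot n 0 x \<le> - pot_lim x + e / 2" if "x \<in> sphere z r" for x
        proof -
          have "\<bar>pot_lim x - pot n 0 x\<bar> \<le> e / 2" using ap that by simp
          then show ?thesis by linarith
        qed
      qed (use r sub in \<open>auto intro!: continuous_intros continuous_on_pot continuous_on_subset[OF continuous_on_pot_lim[of j]]\<close>)
      also have "\<dots> = circle_mean (\<lambda>z. - pot_lim z) z r + e / 2"
        by (subst circle_mean_add)
           (use r sub in \<open>auto intro!: continuous_intros continuous_on_subset[OF continuous_on_pot_lim[of j]]\<close>)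
      finally have *: "- pot n 0 z \<le> circle_mean (\<lambda>z. - pot_lim z) z r + e / 2" .
      show "- pot_lim z \<le> circle_mean (\<lambda>z. - pot_lim z) z r + e"
      proof -
        have "\<bar>pot_lim z - pot n 0 z\<bar> \<le> e / 2" using ap r by simp
        then show ?thesis using * by linarith
      qed
    qed
  qed
qed

lemma harmonic_measure_cantor_pos:
  assumes dom: "planar_domain (- solid)" and z: "z \<in> - solid"
  shows "0 < harmonic_measure (- solid) z cantor"
proof -
  \<comment> \<open>Normalisation: \<open>pot_lim \<ge> -1\<close> becomes \<open>v \<le> 1\<close>,
    the bound 3 near the squares becomes \<open>v \<le> 0\<close>, and
    \<open>pot_lim 2 \<le> 1\<close> leaves \<open>v 2 > 0\<close>.\<close>
  define v where "v = (\<lambda>z. 3/4 + 1/4 * - pot_lim z)"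
  have cont: "continuous_on (- solid) v"
  proof (rule continuous_at_imp_continuous_on, rule ballI)
    fix x assume "x \<in> - solid"
    then obtain j where j: "x \<in> - level 0 j" using not_solid_notin_level[of x] by auto
    have "isCont pot_lim x"
      using continuous_on_pot_lim j by (simp add: continuous_on_eq_continuous_at open_Compl closed_level)
    then show "isCont v x" unfolding v_def by (intro continuous_intros)
  qed
  have ge: "0 \<le> 1 + pot_lim x" if "x \<in> - solid" for x
  proof -
    obtain j where j: "x \<notin> level 0 j" using not_solid_notin_level[of x] \<open>x \<in> - solid\<close> by auto
    show ?thesis
      by (rule LIMSEQ_le_const[OF tendsto_add[OF tendsto_const pot_LIMSEQ[OF j]]]) (use pot_ge in blast)
  qed
  have sub: "submean_at v x" if "x \<in> - solid" for x
  proof -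
    obtain j where j: "x \<notin> level 0 j" using not_solid_notin_level[of x] \<open>x \<in> - solid\<close> by auto
    obtain d where d: "d > 0" "\<And>r. 0 < r \<Longrightarrow> r < d \<Longrightarrow> - pot_lim x \<le> circle_mean (\<lambda>z. - pot_lim z) x r"
      using submean_at_minus_pot_lim[OF j] by (auto simp: submean_at_def)
    have "open (- solid)" using closed_solid by (simp add: open_Compl)
    then obtain e where e: "e > 0" "ball x e \<subseteq> - solid" using \<open>x \<in> - solid\<close> openE by blast
    have cp: "continuous_on (- solid) (\<lambda>z. - pot_lim z)"
    proof -
      have "continuous_on (- solid) (\<lambda>z. 4 * (v z - 3/4))" by (intro continuous_intros cont)
      then show ?thesis by (simp add: v_def)
    qed
    have "v x \<le> circle_mean v x r" if r: "0 < r" "r < min d e" for r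
    proof -
      have s: "sphere x r \<subseteq> - solid" using e(2) r by (auto simp: subset_iff)
      have c: "continuous_on (sphere x r) (\<lambda>z. 1/4 * - pot_lim z)"
        by (rule continuous_on_mult_left[OF continuous_on_subset[OF cp s]])
      have "circle_mean v x r = circle_mean (\<lambda>_. 3/4) x r + circle_mean (\<lambda>z. 1/4 * - pot_lim z) x r"
        unfolding v_def by (rule circle_mean_add[OF continuous_on_const c]) (use r in simp)
      then have "circle_mean v x r = 3/4 + 1/4 * circle_mean (\<lambda>z. - pot_lim z) x r"
        unfolding circle_mean_const circle_mean_cmult .
      then show ?thesis using d(2)[of r] r by (simp add: v_def)
    qed
    then show ?thesis unfolding submean_at_def using d e by (intro exI[of _ "min d e"]) auto
  qed
  have v1: "v x \<le> 1" if "x \<in> - solid" for x using ge[OF that] by (simp add: v_def)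
  have bdry: "\<forall>\<^sub>F x in at \<zeta> within - solid. v x < a" if \<zeta>: "\<zeta> \<in> frontier (- solid)" and a: "indicat_real cantor \<zeta> < a" for \<zeta> a
  proof (cases "\<zeta> \<in> cantor")
    case True
    then have "1 < a" using a by simp
    moreover have "\<forall>\<^sub>F x in at \<zeta> within - solid. x \<in> - solid" by (simp add: eventually_at_filter)
    ultimately show ?thesis using v1 by (auto elim!: eventually_mono intro: le_less_trans)
  next
    case False
    then obtain w s where w: "dead 0 w" "s \<in> square_bd" "\<zeta> = emb w s"
      using \<zeta> frontier_solid by (auto simp: frontier_complement boundary_def)
    have s: "cmod s \<le> 1/2" using w(2) square_bd_subset norm_square by blast
    have a0: "0 < a" using a False by simp
    \<comment> \<open>The bound of \<open>pot_dead\<close> holds on the whole dead disc, which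
      contains a neighbourhood of radius \<open>rad w / 2\<close> of every point of its
      square.\<close>
    have "v x \<le> 0" if x: "x \<in> - solid" "dist x \<zeta> < rad w / 2" for x
    proof -
      have "dist \<zeta> (emb w 0) \<le> rad w / 2"
        using dist_emb[of w s 0] s by (simp add: w(3) mult_left_le)
      then have xd: "x \<in> disc w"
        using x(2) dist_triangle[of x "emb w 0" \<zeta>] by (simp add: disc_eq dist_commute)
      obtain j where j: "x \<notin> level 0 j" using not_solid_notin_level[of x] x(1) by auto
      have "4 \<le> 1 + pot n 0 x" if "length w \<le> n" for n using pot_dead[OF w(1) xd that] by simp
      then have "4 \<le> 1 + pot_lim x"
        by (intro LIMSEQ_le_const[OF tendsto_add[OF tendsto_const pot_LIMSEQ[OF j]]]) blast
      then show ?thesis by (simp add: v_def)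
    qed
    then show ?thesis unfolding eventually_at
      using a0 by (intro exI[of _ "rad w / 2"]) (auto intro: le_less_trans)
  qed
  have comp: "competitor (- solid) (indicat_real cantor) v"
    unfolding competitor_def using cont sub v1 bdry by (auto intro!: bdd_aboveI2[of _ _ 1])
  have 2: "2 \<in> - solid" using solid_subset_cball by auto
  moreover have "0 < v 2"
  proof -
    have j: "2 \<notin> level 0 0" by simp
    have "pot_lim 2 \<le> 1"
    proof (rule LIMSEQ_le_const2[OF pot_LIMSEQ[OF j]])
      have "pot n 0 2 \<le> 1" for n using pot_outside_le[of 2 n 0] by simp
      then show "\<exists>N. \<forall>n\<ge>N. pot n 0 2 \<le> 1" by blast
    qed
    then show ?thesis by (simp add: v_def)
  qed
  ultimately show ?thesis
    unfolding harmonic_measure_def by (intro perron_solution_pos[OF dom _ comp _ _ z]) auto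
qed

section \<open>Uniformity\<close>

subsection \<open>Cigar curves parametrised by length\<close>

lemma arc_length_le:
  assumes "L-lipschitz_on {a..b} \<gamma>" "a \<le> b"
  shows "arc_length \<gamma> a b \<le> ennreal (L * (b - a))"
  unfolding arc_length_def
proof (intro SUP_least, clarify)
  fix n :: nat and p :: "nat \<Rightarrow> real" assume p: "mono p" "range p \<subseteq> {a..b}"
  have L: "0 \<le> L" using assms(1) by (rule lipschitz_on_nonneg)
  have pi: "p i \<in> {a..b}" for i using p(2) by blast
  have "(\<Sum>i<n. ennreal (dist (\<gamma> (p i)) (\<gamma> (p (Suc i))))) \<le> (\<Sum>i<n. ennreal (L * (p (Suc i) - p i)))"
  proof (intro sum_mono ennreal_leI)
    fix i
    have "dist (\<gamma> (p i)) (\<gamma> (p (Suc i))) \<le> L * dist (p i) (p (Suc i))"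
      by (rule lipschitz_onD[OF assms(1) pi pi])
    moreover have "p i \<le> p (Suc i)" using p(1) by (simp add: monoD)
    ultimately show "dist (\<gamma> (p i)) (\<gamma> (p (Suc i))) \<le> L * (p (Suc i) - p i)"
      by (simp add: dist_real_def)
  qed
  also have "\<dots> = ennreal (\<Sum>i<n. L * (p (Suc i) - p i))"
    using L p(1) by (intro sum_ennreal) (simp add: monoD)
  also have "(\<Sum>i<n. L * (p (Suc i) - p i)) = L * (p n - p 0)"
    by (simp add: sum_distrib_left[symmetric] sum_lessThan_telescope)
  also have "ennreal \<dots> \<le> ennreal (L * (b - a))"
  proof (intro ennreal_leI mult_left_mono L)
    show "p n - p 0 \<le> b - a" using pi[of n] pi[of 0] by simp
  qed
  finally show "(\<Sum>i<n. ennreal (dist (\<gamma> (p i)) (\<gamma> (p (Suc i))))) \<le> ennreal (L * (b - a))" .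
qed

text \<open>The curve is 1-Lipschitz, so the parameter dominates the length travelled from
  \<open>x\<close>; true arc length enters only in \<open>uniform_domain_cigar\<close>.\<close>

definition carrot :: "complex \<Rightarrow> complex \<Rightarrow> real \<Rightarrow> bool" where
  "carrot x y T \<longleftrightarrow> 0 \<le> T \<and> (\<exists>\<gamma>. \<gamma> 0 = x \<and> \<gamma> T = y \<and> 1-lipschitz_on {0..T} \<gamma> \<and>
     (\<forall>t\<in>{0..T}. \<forall>e\<in>solid. t \<le> 2 * dist (\<gamma> t) e))"

definition cigar :: "real \<Rightarrow> complex \<Rightarrow> complex \<Rightarrow> real \<Rightarrow> bool" where
  "cigar C x y T \<longleftrightarrow> 0 \<le> T \<and> (\<exists>\<gamma>. \<gamma> 0 = x \<and> \<gamma> T = y \<and> 1-lipschitz_on {0..T} \<gamma> \<and>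
     (\<forall>t\<in>{0..T}. \<forall>e\<in>solid. min t (T - t) \<le> C * dist (\<gamma> t) e))"

lemma uniform_domain_cigar:
  assumes C: "1 \<le> C"
    and cig: "\<And>x y. x \<notin> solid \<Longrightarrow> y \<notin> solid \<Longrightarrow> \<exists>T. T \<le> C * dist x y \<and> cigar C x y T"
  shows "uniform_domain (- solid)"
proof -
  have key: "\<exists>\<gamma>. path \<gamma> \<and> pathstart \<gamma> = x \<and> pathfinish \<gamma> = y \<and> path_image \<gamma> \<subseteq> - solid \<and>
        arc_length \<gamma> 0 1 \<le> ennreal (C * dist x y) \<and>
        (\<forall>t\<in>{0..1}. \<forall>w\<in>solid.
           min (arc_length \<gamma> 0 t) (arc_length \<gamma> t 1) \<le> ennreal (C * dist (\<gamma> t) w))"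
    if xy: "x \<in> - solid" "y \<in> - solid" for x y
  proof -
    obtain T \<gamma> where T: "T \<le> C * dist x y" "0 \<le> T" and \<gamma>: "\<gamma> 0 = x" "\<gamma> T = y" "1-lipschitz_on {0..T} \<gamma>"
      "\<And>t e. t \<in> {0..T} \<Longrightarrow> e \<in> solid \<Longrightarrow> min t (T - t) \<le> C * dist (\<gamma> t) e"
      using cig[of x y] xy unfolding cigar_def by auto
    define g where "g = (\<lambda>t. \<gamma> (T * t))"
    have Tt: "T * t \<in> {0..T}" if "t \<in> {0..1}" for t
      using that T(2) by (auto simp: mult_left_le)
    have lip: "T-lipschitz_on {0..1} g"
    proof (rule lipschitz_onI)
      fix s t :: real assume st: "s \<in> {0..1}" "t \<in> {0..1}"
      have "dist (\<gamma> (T * s)) (\<gamma> (T * t)) \<le> 1 * dist (T * s) (T * t)"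
        by (rule lipschitz_onD[OF \<gamma>(3) Tt[OF st(1)] Tt[OF st(2)]])
      then show "dist (g s) (g t) \<le> T * dist s t"
        using T(2) by (simp add: g_def dist_real_def abs_mult flip: right_diff_distrib)
    qed (fact T(2))
    have al: "arc_length g s t \<le> ennreal (T * (t - s))" if "0 \<le> s" "s \<le> t" "t \<le> 1" for s t
      using that by (intro arc_length_le lipschitz_on_subset[OF lip]) auto
    have "path g" unfolding path_def by (rule lipschitz_on_continuous_on[OF lip])
    moreover have "path_image g \<subseteq> - solid"
    proof
      fix p assume "p \<in> path_image g"
      then obtain t where t: "t \<in> {0..1}" "p = g t" by (auto simp: path_image_def)
      show "p \<in> - solid"
      proof
        assume "p \<in> solid"
        then have m: "min (T * t) (T - T * t) \<le> 0" using \<gamma>(4)[OF Tt[OF t(1)], of p] t(2) by (simp add: g_def)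
        have "min u (T - u) \<le> 0 \<Longrightarrow> u \<in> {0..T} \<Longrightarrow> u = 0 \<or> u = T" for u
          by (auto simp: min_def split: if_splits)
        from this[OF m Tt[OF t(1)]] have "T * t = 0 \<or> T * t = T" .
        then have "p = x \<or> p = y" using \<gamma>(1,2) t(2) by (auto simp: g_def)
        then show False using xy \<open>p \<in> solid\<close> by auto
      qed
    qed
    moreover have "arc_length g 0 1 \<le> ennreal (C * dist x y)"
      using al[of 0 1] T(1) by (auto intro: order_trans ennreal_leI)
    moreover have "min (arc_length g 0 t) (arc_length g t 1) \<le> ennreal (C * dist (g t) w)"
      if t: "t \<in> {0..1}" and w: "w \<in> solid" for t w
    proof -
      have "min (arc_length g 0 t) (arc_length g t 1) \<le> min (ennreal (T * t)) (ennreal (T - T * t))"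
        using al[of 0 t] al[of t 1] t by (intro min.mono) (auto simp: algebra_simps)
      also have "\<dots> = ennreal (min (T * t) (T - T * t))" using Tt[OF t] by (simp add: min_def ennreal_le_iff)
      also have "\<dots> \<le> ennreal (C * dist (g t) w)"
        using \<gamma>(4)[OF Tt[OF t] w] by (intro ennreal_leI) (simp add: g_def)
      finally show ?thesis .
    qed
    ultimately show ?thesis using \<gamma>(1,2)
      by (intro exI[of _ g]) (auto simp: pathstart_def pathfinish_def g_def)
  qed
  have "path_connected (- solid)" unfolding path_connected_def using key by blast
  moreover have "- solid \<noteq> {}" using emb_0_notin_solid[of "[]"] by auto
  ultimately have "planar_domain (- solid)"
    using closed_solid by (auto simp: planar_domain_def open_Compl path_connected_imp_connected)
  then show ?thesis
    unfolding uniform_domain_def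
  proof (intro conjI exI[of _ C] C ballI)
    fix x y assume "x \<in> - solid" "y \<in> - solid"
    from key[OF this] show "\<exists>\<gamma>. path \<gamma> \<and> pathstart \<gamma> = x \<and> pathfinish \<gamma> = y \<and>
        path_image \<gamma> \<subseteq> closure (- solid) \<and> arc_length \<gamma> 0 1 \<le> ennreal (C * dist x y) \<and>
        (\<forall>t\<in>{0..1}. \<forall>w\<in>- (- solid).
           min (arc_length \<gamma> 0 t) (arc_length \<gamma> t 1) \<le> ennreal (C * dist (\<gamma> t) w))"
      using closure_subset by (metis double_complement order_trans)
  qed
qed

lemma cigar_sym:
  assumes "cigar C x y T" shows "cigar C y x T"
proof -
  obtain \<gamma> where T: "0 \<le> T" and \<gamma>: "\<gamma> 0 = x" "\<gamma> T = y" "1-lipschitz_on {0..T} \<gamma>"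
      "\<And>t e. t \<in> {0..T} \<Longrightarrow> e \<in> solid \<Longrightarrow> min t (T - t) \<le> C * dist (\<gamma> t) e"
    using assms by (auto simp: cigar_def)
  have "1-lipschitz_on {0..T} (\<lambda>t. \<gamma> (T - t))"
  proof (rule lipschitz_onI)
    fix s t assume "s \<in> {0..T}" "t \<in> {0..T}"
    then show "dist (\<gamma> (T - s)) (\<gamma> (T - t)) \<le> 1 * dist s t"
      using lipschitz_onD[OF \<gamma>(3), of "T - s" "T - t"] by (simp add: dist_real_def abs_minus_commute)
  qed simp
  moreover have "min t (T - t) \<le> C * dist (\<gamma> (T - t)) e" if "t \<in> {0..T}" "e \<in> solid" for t e
    using \<gamma>(4)[of "T - t" e] that by (simp add: min.commute)
  ultimately show ?thesis unfolding cigar_def using T \<gamma>(1,2) by (intro conjI exI[of _ "\<lambda>t. \<gamma> (T - t)"]) auto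
qed

lemma lipschitz_shift:
  fixes \<gamma> :: "real \<Rightarrow> complex"
  assumes "1-lipschitz_on {0..T} \<gamma>"
  shows "1-lipschitz_on {a..a + T} (\<lambda>t. \<gamma> (t - a))" "1-lipschitz_on {a..a + T} (\<lambda>t. \<gamma> (a + T - t))"
  using lipschitz_onD[OF assms] by (auto intro!: lipschitz_onI simp: dist_real_def) (smt (verit))+

text \<open>At distance \<open>d\<close> from the solid set and parameter \<open>s\<close> of the
  middle piece, the tip of the first carrot gives \<open>l1 \<le> 2 * (d + s)\<close>, hence
  \<open>l1 + s \<le> 2 * d + 3 * s\<close>, and likewise from the other end. This is the constant
  \<open>2 + 3 * C\<close>.\<close>

lemma cigar_join:
  assumes x: "carrot x x' l1" and m: "cigar C x' y' T" and y: "carrot y y' l2" and C: "0 \<le> C"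
  shows "cigar (2 + 3 * C) x y (l1 + T + l2)"
proof -
  obtain \<alpha> where l1: "0 \<le> l1" and \<alpha>: "\<alpha> 0 = x" "\<alpha> l1 = x'" "1-lipschitz_on {0..l1} \<alpha>"
      "\<And>t e. t \<in> {0..l1} \<Longrightarrow> e \<in> solid \<Longrightarrow> t \<le> 2 * dist (\<alpha> t) e"
    using x by (auto simp: carrot_def)
  obtain \<beta> where l2: "0 \<le> l2" and \<beta>: "\<beta> 0 = y" "\<beta> l2 = y'" "1-lipschitz_on {0..l2} \<beta>"
      "\<And>t e. t \<in> {0..l2} \<Longrightarrow> e \<in> solid \<Longrightarrow> t \<le> 2 * dist (\<beta> t) e"
    using y by (auto simp: carrot_def)
  obtain \<gamma> where T: "0 \<le> T" and \<gamma>: "\<gamma> 0 = x'" "\<gamma> T = y'" "1-lipschitz_on {0..T} \<gamma>"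
      "\<And>t e. t \<in> {0..T} \<Longrightarrow> e \<in> solid \<Longrightarrow> min t (T - t) \<le> C * dist (\<gamma> t) e"
    using m by (auto simp: cigar_def)
  define g where "g = (\<lambda>t. if t \<le> l1 then \<alpha> t else if t \<le> l1 + T then \<gamma> (t - l1) else \<beta> (l1 + T + l2 - t))"
  have "1-lipschitz_on {l1..l1 + T + l2} (\<lambda>t. if t \<le> l1 + T then \<gamma> (t - l1) else \<beta> (l1 + T + l2 - t))"
    by (rule lipschitz_on_concat[OF lipschitz_shift(1)[OF \<gamma>(3)] lipschitz_shift(2)[OF \<beta>(3)]])
       (simp add: \<gamma> \<beta>)
  then have lip: "1-lipschitz_on {0..l1 + T + l2} g"
    unfolding g_def by (rule lipschitz_on_concat[OF \<alpha>(3)]) (simp add: \<alpha> \<gamma> T)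
  have "min t (l1 + T + l2 - t) \<le> (2 + 3 * C) * dist (g t) e"
    if t: "t \<in> {0..l1 + T + l2}" and e: "e \<in> solid" for t e
  proof -
    have C2: "2 * d \<le> (2 + 3 * C) * d" if "0 \<le> d" for d using C that by (simp add: distrib_right)
    consider "t \<le> l1" | "l1 < t" "t \<le> l1 + T" | "l1 + T < t" by linarith
    then show ?thesis
    proof cases
      case 1
      then show ?thesis using \<alpha>(4)[of t e] t e C2[of "dist (\<alpha> t) e"] by (auto simp: g_def)
    next
      case 2
      define s where "s = t - l1"
      have s: "s \<in> {0..T}" using 2 by (simp add: s_def)
      define d where "d = dist (\<gamma> s) e"
      have gt: "g t = \<gamma> s" using 2 by (simp add: g_def s_def)
      have sd: "min s (T - s) \<le> C * d" unfolding d_def by (rule \<gamma>(4)[OF s e])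
      have "l1 \<le> 2 * dist x' e" using \<alpha>(4)[of l1 e] l1 e by (simp add: \<alpha>(2))
      moreover have "dist x' e \<le> d + s"
        using lipschitz_onD[OF \<gamma>(3) s, of 0] s T dist_triangle[of x' e "\<gamma> s"]
        by (simp add: \<gamma>(1) d_def dist_real_def dist_commute)
      moreover have "l2 \<le> 2 * dist y' e" using \<beta>(4)[of l2 e] l2 e by (simp add: \<beta>(2))
      moreover have "dist y' e \<le> d + (T - s)"
        using lipschitz_onD[OF \<gamma>(3) s, of T] s T dist_triangle[of y' e "\<gamma> s"]
        by (simp add: \<gamma>(2) d_def dist_real_def dist_commute)
      moreover have "t = l1 + s" "(2 + 3 * C) * d = 2 * d + 3 * (C * d)"
        by (simp_all add: s_def algebra_simps)
      ultimately show ?thesis using sd unfolding gt d_def[symmetric] by linarith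
    next
      case 3
      have "l1 + T + l2 - t \<le> 2 * dist (\<beta> (l1 + T + l2 - t)) e" using 3 t e by (intro \<beta>(4)) auto
      then show ?thesis using 3 T C2[of "dist (\<beta> (l1 + T + l2 - t)) e"] by (auto simp: g_def)
    qed
  qed
  moreover have "g 0 = x" "g (l1 + T + l2) = y"
    using l1 l2 T \<alpha>(1,2) \<beta>(1,2) \<gamma>(1,2) by (auto simp: g_def)
  ultimately show ?thesis unfolding cigar_def using lip l1 l2 T by (intro conjI exI[of _ g]) auto
qed

subsection \<open>Detours around discs\<close>

text \<open>The curve is a Lipschitz graph over the segment: around every disc that comes too close it has a
  tent-shaped bump on the side away from the centre. The bumps are disjoint since the discs are
  well separated.\<close>

lemma detour_graph:
  fixes q :: "'i \<Rightarrow> complex" and s :: real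
  assumes I: "finite I" and \<rho>: "\<And>i. i \<in> I \<Longrightarrow> 0 < \<rho> i"
    and sep: "\<And>i j. i \<in> I \<Longrightarrow> j \<in> I \<Longrightarrow> i \<noteq> j \<Longrightarrow> 20 * \<rho> i \<le> dist (q i) (q j)"
    and far: "\<And>i. i \<in> I \<Longrightarrow> 5 * \<rho> i \<le> cmod (q i)" "\<And>i. i \<in> I \<Longrightarrow> 5 * \<rho> i \<le> cmod (q i - of_real s)"
  obtains \<eta> :: "real \<Rightarrow> real" where "\<eta> 0 = 0" "\<eta> s = 0" "\<And>t t'. \<bar>\<eta> t - \<eta> t'\<bar> \<le> 2 * \<bar>t - t'\<bar>"
    "\<And>t i. i \<in> I \<Longrightarrow> 2 * \<rho> i \<le> cmod (Complex t (\<eta> t) - q i)"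
proof -
  define J where "J = {i \<in> I. \<bar>Im (q i)\<bar> < 2 * \<rho> i}"
  define T where "T = (\<lambda>i t. max 0 (3 * \<rho> i - \<bar>t - Re (q i)\<bar>))"
  define \<sigma> where "\<sigma> = (\<lambda>i. if 0 \<le> Im (q i) then - 1 else 1 :: real)"
  define \<eta> where "\<eta> = (\<lambda>t. \<Sum>i\<in>J. \<sigma> i * T i t)"
  have finJ: "finite J" using I by (simp add: J_def)
  have T0: "0 \<le> T i t" for i t by (simp add: T_def)
  have T1: "\<bar>T i t - T i t'\<bar> \<le> \<bar>t - t'\<bar>" for i t t' by (auto simp: T_def max_def abs_if)
  have disj: "T i t = 0 \<or> T j t = 0" if ij: "i \<in> J" "j \<in> J" "i \<noteq> j" for i j t
  proof (rule ccontr)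
    assume "\<not> (T i t = 0 \<or> T j t = 0)"
    then have "\<bar>t - Re (q i)\<bar> < 3 * \<rho> i" "\<bar>t - Re (q j)\<bar> < 3 * \<rho> j" by (auto simp: T_def max_def split: if_splits)
    moreover have "\<bar>Im (q i)\<bar> < 2 * \<rho> i" "\<bar>Im (q j)\<bar> < 2 * \<rho> j" using ij by (auto simp: J_def)
    moreover have "dist (q i) (q j) \<le> \<bar>Re (q i) - Re (q j)\<bar> + \<bar>Im (q i) - Im (q j)\<bar>"
      using cmod_le[of "q i - q j"] by (simp add: dist_norm)
    \<comment> \<open>Two tents over one parameter would bring the centres closer than 10 times the
      larger radius, against the separation by 20.\<close>
    ultimately have "dist (q i) (q j) < 5 * \<rho> i + 5 * \<rho> j" by linarith
    moreover have "20 * \<rho> i \<le> dist (q i) (q j)" "20 * \<rho> j \<le> dist (q i) (q j)" "0 < \<rho> i"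
      using sep[of i j] sep[of j i] \<rho>[of i] ij by (auto simp: J_def dist_commute)
    ultimately show False by linarith
  qed
  have single: "\<eta> t = \<sigma> i * T i t" if "i \<in> J" "T i t \<noteq> 0" for i t
  proof -
    have "(\<Sum>j\<in>J. \<sigma> j * T j t) = (\<Sum>j\<in>{i}. \<sigma> j * T j t)"
      using disj[OF _ that(1), of _ t] that finJ by (intro sum.mono_neutral_right) auto
    then show ?thesis by (simp add: \<eta>_def)
  qed
  have none: "\<eta> t = 0" if "\<And>i. i \<in> J \<Longrightarrow> T i t = 0" for t
    unfolding \<eta>_def using that by (intro sum.neutral) auto
  have \<sigma>: "\<bar>\<sigma> i * x\<bar> = \<bar>x\<bar>" "\<bar>\<sigma> i * x - \<sigma> i * y\<bar> = \<bar>x - y\<bar>" for i x y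
    by (auto simp: \<sigma>_def)
  \<comment> \<open>A single tent has slope 1; the constant 2 arises when the parameters lie under
    different tents and each is estimated separately.\<close>
  have lip1: "\<bar>\<eta> t - \<eta> t'\<bar> \<le> 2 * \<bar>t - t'\<bar>" if i: "i \<in> J" "T i t \<noteq> 0" for i t t'
  proof (cases "\<exists>j\<in>J. T j t' \<noteq> 0")
    case True
    then obtain j where j: "j \<in> J" "T j t' \<noteq> 0" by blast
    show ?thesis
    proof (cases "i = j")
      case True
      then have "\<bar>\<eta> t - \<eta> t'\<bar> = \<bar>T i t - T i t'\<bar>"
        using single[OF i] single[OF j] \<sigma>(2)[of i "T i t" "T i t'"] by simp
      also have "\<dots> \<le> \<bar>t - t'\<bar>" by (rule T1)
      also have "\<dots> \<le> 2 * \<bar>t - t'\<bar>" by simp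
      finally show ?thesis .
    next
      case False
      then have z: "T i t' = 0" "T j t = 0" using disj[OF i(1) j(1)] i j by auto
      have "\<bar>\<eta> t - \<eta> t'\<bar> \<le> \<bar>T i t\<bar> + \<bar>T j t'\<bar>"
        using \<sigma>(1)[of i "T i t"] \<sigma>(1)[of j "T j t'"] unfolding single[OF i] single[OF j] by linarith
      also have "\<dots> \<le> 2 * \<bar>t - t'\<bar>" using T1[of i t t'] T1[of j t t'] z by simp
      finally show ?thesis .
    qed
  next
    case False
    then have "\<eta> t' = 0" "T i t' = 0" using none i by auto
    then have "\<bar>\<eta> t - \<eta> t'\<bar> = \<bar>T i t - T i t'\<bar>"
      using single[OF i] \<sigma>(1)[of i "T i t"] by simp
    also have "\<dots> \<le> \<bar>t - t'\<bar>" by (rule T1)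
    also have "\<dots> \<le> 2 * \<bar>t - t'\<bar>" by simp
    finally show ?thesis .
  qed
  have lip: "\<bar>\<eta> t - \<eta> t'\<bar> \<le> 2 * \<bar>t - t'\<bar>" for t t'
  proof (cases "\<exists>i\<in>J. T i t \<noteq> 0")
    case True
    then show ?thesis using lip1 by blast
  next
    case False
    then have 0: "\<eta> t = 0" using none by blast
    show ?thesis
    proof (cases "\<exists>i\<in>J. T i t' \<noteq> 0")
      case True
      then show ?thesis using lip1[of _ t' t] by (auto simp: abs_minus_commute)
    next
      case False
      then have "\<eta> t' = 0" using none by blast
      then show ?thesis using 0 by simp
    qed
  qed
  have "\<eta> 0 = 0"
  proof (rule none)
    fix i assume "i \<in> J"
    then show "T i 0 = 0" using far(1)[of i] cmod_le[of "q i"] by (auto simp: J_def T_def)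
  qed
  moreover have "\<eta> s = 0"
  proof (rule none)
    fix i assume "i \<in> J"
    then show "T i s = 0" using far(2)[of i] cmod_le[of "q i - of_real s"] by (auto simp: J_def T_def)
  qed
  moreover have "2 * \<rho> i \<le> cmod (Complex t (\<eta> t) - q i)" if i: "i \<in> I" for t i
  proof (cases "\<exists>j\<in>J. T j t \<noteq> 0")
    case True
    then obtain j where j: "j \<in> J" "T j t \<noteq> 0" by blast
    define d where "d = t - Re (q j)"
    have d: "\<bar>d\<bar> < 3 * \<rho> j" "T j t = 3 * \<rho> j - \<bar>d\<bar>" using j(2) by (auto simp: T_def d_def max_def split: if_splits)
    have \<eta>j: "\<eta> t = \<sigma> j * T j t" by (rule single[OF j])
    have h: "\<bar>\<eta> t - Im (q j)\<bar> = T j t + \<bar>Im (q j)\<bar>" unfolding \<eta>j \<sigma>_def using T0[of j t] by auto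
    show ?thesis
    proof (cases "i = j")
      case True
      \<comment> \<open>The sum of the coordinate distances to the centre is at least
        \<open>3 * \<rho> i\<close>, so the Euclidean distance is at least \<open>3 / sqrt 2\<close>
        times \<open>\<rho> i\<close>, more than twice \<open>\<rho> i\<close>.\<close>
      have "3 * \<rho> i \<le> \<bar>d\<bar> + \<bar>\<eta> t - Im (q j)\<bar>" unfolding h using d True by simp
      then have "(3 * \<rho> i)\<^sup>2 \<le> (\<bar>d\<bar> + \<bar>\<eta> t - Im (q j)\<bar>)\<^sup>2" using \<rho>[OF i] by (intro power_mono) auto
      also have "\<dots> \<le> 2 * (d\<^sup>2 + (\<eta> t - Im (q j))\<^sup>2)"
        using sum_squares_bound[of "\<bar>d\<bar>" "\<bar>\<eta> t - Im (q j)\<bar>"] by (simp add: power2_sum)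
      also have "d\<^sup>2 + (\<eta> t - Im (q j))\<^sup>2 = (cmod (Complex t (\<eta> t) - q i))\<^sup>2"
        using True by (simp add: cmod_power2 d_def)
      finally have "9 * (\<rho> i)\<^sup>2 \<le> 2 * (cmod (Complex t (\<eta> t) - q i))\<^sup>2" by (simp add: power_mult_distrib)
      moreover have "0 \<le> (\<rho> i)\<^sup>2" by simp
      moreover have "(2 * \<rho> i)\<^sup>2 = 4 * (\<rho> i)\<^sup>2" by (simp add: power_mult_distrib)
      ultimately have "(2 * \<rho> i)\<^sup>2 \<le> (cmod (Complex t (\<eta> t) - q i))\<^sup>2" by linarith
      then show ?thesis by (rule power2_le_imp_le) simp
    next
      case False
      have "cmod (Complex t (\<eta> t) - q j) \<le> \<bar>d\<bar> + \<bar>\<eta> t - Im (q j)\<bar>"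
        using cmod_le[of "Complex t (\<eta> t) - q j"] by (simp add: d_def)
      also have "\<dots> \<le> 5 * \<rho> j" unfolding h using d j(1) by (auto simp: J_def)
      finally have "cmod (Complex t (\<eta> t) - q j) \<le> 5 * \<rho> j" .
      moreover have "dist (q i) (q j) \<le> cmod (Complex t (\<eta> t) - q i) + cmod (Complex t (\<eta> t) - q j)"
        using dist_triangle3[of "q i" "q j" "Complex t (\<eta> t)"] by (simp add: dist_norm)
      moreover have "20 * \<rho> i \<le> dist (q i) (q j)" "20 * \<rho> j \<le> dist (q i) (q j)"
        using sep[of i j] sep[of j i] i j(1) False by (auto simp: J_def dist_commute)
      ultimately show ?thesis using \<rho>[OF i] by linarith
    qed
  next
    case False
    then have 0: "\<eta> t = 0" using none by blast
    show ?thesis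
    proof (cases "i \<in> J")
      case True
      then have "3 * \<rho> i \<le> \<bar>t - Re (q i)\<bar>" using False by (auto simp: T_def max_def split: if_splits)
      moreover have "\<bar>t - Re (q i)\<bar> \<le> cmod (Complex t (\<eta> t) - q i)"
        using abs_Re_le_cmod[of "Complex t (\<eta> t) - q i"] by simp
      ultimately show ?thesis using \<rho>[OF i] by linarith
    next
      case False
      then have "2 * \<rho> i \<le> \<bar>Im (q i)\<bar>" using i by (auto simp: J_def)
      then show ?thesis using abs_Im_le_cmod[of "Complex t (\<eta> t) - q i"] 0 by simp
    qed
  qed
  ultimately show ?thesis using that lip by blast
qed

text \<open>A rigid motion moves the segment to the real axis. Since the curve is a graph,
  projecting it to the line through \<open>x\<close> and \<open>y\<close> returns the parameter,
  which gives the last two properties.\<close>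

lemma detour:
  fixes c :: "'i \<Rightarrow> complex" and x y :: complex
  assumes I: "finite I" and \<rho>: "\<And>i. i \<in> I \<Longrightarrow> 0 < \<rho> i"
    and sep: "\<And>i j. i \<in> I \<Longrightarrow> j \<in> I \<Longrightarrow> i \<noteq> j \<Longrightarrow> 20 * \<rho> i \<le> dist (c i) (c j)"
    and far: "\<And>i. i \<in> I \<Longrightarrow> 5 * \<rho> i \<le> dist x (c i)" "\<And>i. i \<in> I \<Longrightarrow> 5 * \<rho> i \<le> dist y (c i)"
  obtains \<gamma> :: "real \<Rightarrow> complex" where "\<gamma> 0 = x" "\<gamma> (dist x y) = y" "\<And>t t'. dist (\<gamma> t) (\<gamma> t') \<le> 3 * \<bar>t - t'\<bar>"
    "\<And>t i. i \<in> I \<Longrightarrow> 2 * \<rho> i \<le> dist (\<gamma> t) (c i)"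
    "\<And>t. t \<le> dist (\<gamma> t) x" "\<And>t. dist x y - t \<le> dist (\<gamma> t) y"
proof -
  define s where "s = dist x y"
  define e where "e = (if x = y then 1 else (y - x) / of_real s)"
  have s: "x \<noteq> y \<Longrightarrow> 0 < s" by (simp add: s_def)
  have e: "cmod e = 1" using s by (auto simp: e_def norm_divide s_def dist_norm norm_minus_commute)
  then have ee: "e * cnj e = 1" by (simp add: complex_norm_square[symmetric])
  have ye: "y = x + e * of_real s"
    using s by (cases "x = y") (auto simp: e_def s_def)
  define q where "q = (\<lambda>i. cnj e * (c i - x))"
  have cq: "c i = x + e * q i" for i using ee by (simp add: q_def mult.assoc[symmetric])
  have ne: "cmod (e * z) = cmod z" for z using e by (simp add: norm_mult)
  have sep': "20 * \<rho> i \<le> dist (q i) (q j)" if "i \<in> I" "j \<in> I" "i \<noteq> j" for i j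
    using sep[OF that] ne[of "q i - q j"] by (simp add: cq dist_norm right_diff_distrib)
  have far1: "5 * \<rho> i \<le> cmod (q i)" if "i \<in> I" for i
    using far(1)[OF that] ne[of "q i"] by (simp add: cq dist_norm)
  have far2: "5 * \<rho> i \<le> cmod (q i - of_real s)" if "i \<in> I" for i
    using far(2)[OF that] ne[of "q i - of_real s"]
    by (simp add: cq dist_norm norm_minus_commute right_diff_distrib) (simp add: ye algebra_simps)
  obtain \<eta> where \<eta>: "\<eta> 0 = 0" "\<eta> s = 0" "\<And>t t'. \<bar>\<eta> t - \<eta> t'\<bar> \<le> 2 * \<bar>t - t'\<bar>"
      "\<And>t i. i \<in> I \<Longrightarrow> 2 * \<rho> i \<le> cmod (Complex t (\<eta> t) - q i)"
    by (rule detour_graph[where I = I and \<rho> = \<rho> and q = q and s = s, OF I \<rho> sep' far1 far2])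
      (assumption | rule that; assumption)+
  define \<gamma> where "\<gamma> = (\<lambda>t. x + e * Complex t (\<eta> t))"
  have dist\<gamma>: "dist (\<gamma> t) (x + e * z) = cmod (Complex t (\<eta> t) - z)" for t z
    using ne[of "Complex t (\<eta> t) - z"] by (simp add: \<gamma>_def dist_norm right_diff_distrib)
  show ?thesis
  proof (rule that[of \<gamma>])
    have "Complex a 0 = of_real a" for a by (simp add: complex_eq_iff)
    then have \<gamma>0: "\<gamma> a = x + e * of_real a" if "\<eta> a = 0" for a using that by (simp add: \<gamma>_def)
    show "\<gamma> 0 = x" using \<gamma>0[OF \<eta>(1)] by simp
    show "\<gamma> (dist x y) = y" unfolding s_def[symmetric] \<gamma>0[OF \<eta>(2)] by (rule ye[symmetric])
    show "dist (\<gamma> t) (\<gamma> t') \<le> 3 * \<bar>t - t'\<bar>" for t t'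
    proof -
      have "dist (\<gamma> t) (\<gamma> t') = cmod (Complex t (\<eta> t) - Complex t' (\<eta> t'))"
        using dist\<gamma>[of t "Complex t' (\<eta> t')"] by (simp add: \<gamma>_def)
      also have "\<dots> \<le> \<bar>t - t'\<bar> + \<bar>\<eta> t - \<eta> t'\<bar>"
        using cmod_le[of "Complex t (\<eta> t) - Complex t' (\<eta> t')"] by simp
      finally show ?thesis using \<eta>(3)[of t t'] by simp
    qed
    show "2 * \<rho> i \<le> dist (\<gamma> t) (c i)" if "i \<in> I" for t i
      unfolding cq dist\<gamma> by (rule \<eta>(4)[OF that])
    show "t \<le> dist (\<gamma> t) x" for t
      using dist\<gamma>[of t 0] abs_Re_le_cmod[of "Complex t (\<eta> t)"] by simp
    show "dist x y - t \<le> dist (\<gamma> t) y" for t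
    proof -
      have "dist (\<gamma> t) y = cmod (Complex t (\<eta> t) - of_real s)"
        using dist\<gamma>[of t "of_real s"] by (simp add: ye[symmetric])
      moreover have "\<bar>t - s\<bar> \<le> cmod (Complex t (\<eta> t) - of_real s)"
        using abs_Re_le_cmod[of "Complex t (\<eta> t) - of_real s"] by simp
      ultimately show ?thesis by (simp add: s_def)
    qed
  qed
qed

subsection \<open>Joining points of the domain\<close>

lemma rad_Suc: "rad (u @ [l]) = rr * rad u"
  by (simp add: rad_def)

text \<open>A solid point outside the disc lies in the disc of an incomparable node, to which the
  separation applies.\<close>

lemma solid_far_from_node:
  assumes w: "node 0 w" and e: "e \<in> solid" "e \<notin> disc w" and z: "z \<in> disc w"
  shows "20 * rad w \<le> dist z e"
proof -
  have "\<exists>w'. node 0 w' \<and> e \<in> disc w' \<and> \<not> prefix w w' \<and> \<not> prefix w' w"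
  proof -
    consider "e \<in> cantor" | w' where "dead 0 w'" "e \<in> emb w' ` square"
      using e(1) by (auto simp: solid_def)
    then show ?thesis
    proof cases
      case 1
      then obtain w' where w': "live 0 w'" "length w' = length w" "e \<in> disc w'"
        unfolding cantor_def level_def lives_def by blast
      then have "w' \<noteq> w" using e(2) by blast
      then have "\<not> prefix w w'" "\<not> prefix w' w" using w'(2) by (auto simp: prefix_def)
      then show ?thesis using w' node_live by blast
    next
      case 2
      then have d: "e \<in> disc w'" using emb_square_subset_disc by blast
      then have "\<not> prefix w w'" using disc_prefix[OF _ node_dead[OF 2(1)], of w] e(2) by blast
      moreover have "\<not> prefix w' w" using dead_prefix_eq[OF 2(1) w] d e(2) by blast
      ultimately show ?thesis using d 2(1) node_dead by blast
    qed
  qed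
  then show ?thesis using node_parallel_dist_rad(1)[OF w] z by blast
qed

lemma dead_far_from_dead:
  assumes "dead 0 w" "dead 0 w'" "w \<noteq> w'" "z \<in> disc w" "z' \<in> disc w'"
  shows "20 * rad w \<le> dist z z'" "20 * rad w' \<le> dist z z'"
  using node_parallel_dist_rad[OF node_dead[OF assms(1)] node_dead[OF assms(2)] _ _ assms(4,5)]
    dead_prefix_eq node_dead assms(1-3) by metis+

text \<open>Moving radially away from the centre of a dead disc increases the distance to its square.\<close>

lemma radial_carrot:
  assumes w: "dead 0 w" and x: "x \<notin> solid" and l: "0 \<le> l" "dist x (emb w 0) + l \<le> 8 * rad w"
    and p: "p = x - emb w 0"
  shows "rad w / 4 < cmod p" "carrot x (x + of_real l * (p / of_real (cmod p))) l"
proof -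
  define c r where "c = emb w 0" and "r = rad w"
  have r: "0 < r" by (simp add: r_def)
  have xp: "x = c + p" by (simp add: p c_def)
  have sq: "z \<in> emb w ` square \<longleftrightarrow> \<bar>Re (z - c)\<bar> \<le> r / 4 \<and> \<bar>Im (z - c)\<bar> \<le> r / 4" for z
  proof -
    have "Re ((z - c) / of_real r) = Re (z - c) / r" "Im ((z - c) / of_real r) = Im (z - c) / r" by simp_all
    then show ?thesis unfolding emb_image c_def[symmetric] r_def[symmetric] square_def using r
      by (simp add: abs_divide pos_divide_le_eq)
  qed
  have "x \<notin> emb w ` square" using x w by (auto simp: solid_def)
  then have out: "r / 4 < \<bar>Re p\<bar> \<or> r / 4 < \<bar>Im p\<bar>" using sq[of x] by (auto simp: xp not_le)
  then show "rad w / 4 < cmod p" using abs_Re_le_cmod[of p] abs_Im_le_cmod[of p] by (auto simp: r_def)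
  then have cp: "0 < cmod p" using r unfolding r_def by linarith
  define \<gamma> where "\<gamma> = (\<lambda>t. x + of_real t * (p / of_real (cmod p)))"
  have \<gamma>c: "\<gamma> t - c = of_real (1 + t / cmod p) * p" for t
    by (simp add: \<gamma>_def xp algebra_simps)
  have dd: "dist (\<gamma> s) (\<gamma> t) = \<bar>s - t\<bar>" for s t
  proof -
    have "\<gamma> s - \<gamma> t = of_real (s - t) * (p / of_real (cmod p))" by (simp add: \<gamma>_def left_diff_distrib diff_divide_distrib)
    then have "dist (\<gamma> s) (\<gamma> t) = \<bar>s - t\<bar> * (cmod p / \<bar>cmod p\<bar>)"
      by (simp only: dist_norm norm_mult norm_divide norm_of_real)
    then show ?thesis using cp by simp
  qed
  have "t \<le> 2 * dist (\<gamma> t) e" if t: "t \<in> {0..l}" and e: "e \<in> solid" for t e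
  proof (cases "e \<in> disc w")
    case True
    then have "e \<in> emb w ` square" using solid_Int_dead_disc e w by blast
    then have es: "\<bar>Re (e - c)\<bar> \<le> r / 4" "\<bar>Im (e - c)\<bar> \<le> r / 4" using sq[of e] by auto
    \<comment> \<open>Only the larger coordinate of \<open>p\<close> is followed. It is at least
      half of \<open>cmod p\<close>, so it grows at rate at least 1/2 along the ray; this is the
      factor 2 in \<open>carrot\<close>.\<close>
    have grow: "r / 4 + t / 2 \<le> \<bar>(1 + t / cmod p) * a\<bar>" if "r / 4 < \<bar>a\<bar>" "cmod p \<le> 2 * \<bar>a\<bar>" for a
    proof -
      have "t * cmod p \<le> t * (2 * \<bar>a\<bar>)" using that t by (intro mult_left_mono) auto
      then have "t / 2 \<le> t / cmod p * \<bar>a\<bar>" using cp by (simp add: field_simps)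
      moreover have "\<bar>(1 + t / cmod p) * a\<bar> = \<bar>a\<bar> + t / cmod p * \<bar>a\<bar>"
      proof -
        have "0 \<le> t / cmod p" using t cp by simp
        then have e: "\<bar>1 + t / cmod p\<bar> = 1 + t / cmod p" by linarith
        show ?thesis unfolding abs_mult e by (simp only: distrib_right mult_1_left)
      qed
      ultimately show ?thesis using that by linarith
    qed
    have rm: "Re (of_real a * z) = a * Re z" "Im (of_real a * z) = a * Im z" for a z by simp_all
    have cm: "cmod p \<le> \<bar>Re p\<bar> + \<bar>Im p\<bar>" by (rule cmod_le)
    show ?thesis
    proof (cases "\<bar>Im p\<bar> \<le> \<bar>Re p\<bar>")
      case True
      then have "r / 4 + t / 2 \<le> \<bar>Re (\<gamma> t - c)\<bar>"
        unfolding \<gamma>c rm(1) using out cm by (intro grow) auto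
      moreover have "\<bar>Re (\<gamma> t - c) - Re (e - c)\<bar> \<le> dist (\<gamma> t) e"
        using abs_Re_le_cmod[of "\<gamma> t - e"] by (simp add: dist_norm)
      ultimately show ?thesis using es by linarith
    next
      case False
      then have "r / 4 + t / 2 \<le> \<bar>Im (\<gamma> t - c)\<bar>"
        unfolding \<gamma>c rm(2) using out cm by (intro grow) auto
      moreover have "\<bar>Im (\<gamma> t - c) - Im (e - c)\<bar> \<le> dist (\<gamma> t) e"
        using abs_Im_le_cmod[of "\<gamma> t - e"] by (simp add: dist_norm)
      ultimately show ?thesis using es by linarith
    qed
  next
    case False
    \<comment> \<open>The rest of the solid set is 20 radii from the centre, while the curve stays
      within 8.\<close>
    have "20 * r \<le> dist c e" unfolding r_def c_def 
      by (rule solid_far_from_node[OF node_dead[OF w] e False emb_0_in_disc])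
    moreover have "dist x c \<le> 8 * r - l" using l(2) by (simp add: r_def c_def)
    moreover have "dist (\<gamma> t) x = t" using dd[of t 0] t by (simp add: \<gamma>_def)
    moreover have "dist c e \<le> dist c x + dist x (\<gamma> t) + dist (\<gamma> t) e"
      using dist_triangle[of c e x] dist_triangle[of x e "\<gamma> t"] by linarith
    ultimately have "20 * r \<le> (8 * r - l) + t + dist (\<gamma> t) e" by (simp add: dist_commute)
    moreover have "l \<le> 8 * r" using l(2) zero_le_dist[of x c] unfolding r_def c_def by linarith
    ultimately show ?thesis using t r by simp
  qed
  then show "carrot x (x + of_real l * (p / of_real (cmod p))) l"
    unfolding carrot_def using l(1)
    by (intro conjI exI[of _ \<gamma>] lipschitz_onI) (auto simp: dd dist_real_def, auto simp: \<gamma>_def)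
qed

lemma carrot_refl: "carrot x x 0"
  unfolding carrot_def by (intro conjI exI[of _ "\<lambda>_. x"] lipschitz_onI) auto

lemma cigar_mono:
  assumes "cigar C x y T" "C \<le> C'" shows "cigar C' x y T"
proof -
  obtain \<gamma> where T: "0 \<le> T" and \<gamma>: "\<gamma> 0 = x" "\<gamma> T = y" "1-lipschitz_on {0..T} \<gamma>"
      "\<And>t e. t \<in> {0..T} \<Longrightarrow> e \<in> solid \<Longrightarrow> min t (T - t) \<le> C * dist (\<gamma> t) e"
    using assms(1) by (auto simp: cigar_def)
  have "min t (T - t) \<le> C' * dist (\<gamma> t) e" if "t \<in> {0..T}" "e \<in> solid" for t e
    using \<gamma>(4)[OF that] mult_right_mono[OF assms(2), of "dist (\<gamma> t) e"] by simp
  then show ?thesis unfolding cigar_def using T \<gamma>(1-3) by blast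
qed

text \<open>Brings an end point to a place from which every dead disc looks small, as the detour
  requires. The length is recorded in terms of the square, because the move is affordable only if
  the two end points are not too close together.\<close>

lemma escape:
  assumes x: "x \<notin> solid"
  obtains x' l where "carrot x x' l" "dist x x' \<le> l" "x' \<notin> solid"
    "\<And>w. dead 0 w \<Longrightarrow> 5 * rad w \<le> dist x' (emb w 0)"
    "l = 0 \<or> (\<exists>w. dead 0 w \<and> dist x (emb w 0) < 5 * rad w \<and> l \<le> 5 * rad w)"
proof (cases "\<exists>w. dead 0 w \<and> dist x (emb w 0) < 5 * rad w")
  case False
  then show ?thesis using that[of x 0] carrot_refl x by force
next
  case True
  then obtain w where w: "dead 0 w" "dist x (emb w 0) < 5 * rad w" by blast
  define l where "l = 5 * rad w - dist x (emb w 0)"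
  define p where "p = x - emb w 0"
  have l: "0 < l" "dist x (emb w 0) + l \<le> 8 * rad w" "l \<le> 5 * rad w"
    using w(2) by (auto simp: l_def)
  define x' where "x' = x + of_real l * (p / of_real (cmod p))"
  have cp: "rad w / 4 < cmod p" and car: "carrot x x' l"
    unfolding x'_def using radial_carrot[OF w(1) x _ l(2) p_def] l(1) by auto
  have p0: "0 < cmod p" using cp rad_pos(1)[of w] by linarith
  have xx': "dist x x' = l" using p0 l(1) by (simp add: x'_def dist_norm norm_mult norm_divide)
  have x'c: "dist x' (emb w 0) = 5 * rad w"
  proof -
    have "x' - emb w 0 = of_real (1 + l / cmod p) * p" by (simp add: x'_def p_def algebra_simps)
    then have "dist x' (emb w 0) = \<bar>1 + l / cmod p\<bar> * cmod p"
      unfolding dist_norm by (simp only: norm_mult norm_of_real)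
    also have "\<dots> = cmod p + l" using p0 l(1) by (simp add: algebra_simps)
    finally show ?thesis by (simp add: l_def p_def dist_norm)
  qed
  have "l \<le> 2 * dist x' e" if "e \<in> solid" for e
  proof -
    obtain \<gamma> where "\<gamma> l = x'" "\<And>t e. t \<in> {0..l} \<Longrightarrow> e \<in> solid \<Longrightarrow> t \<le> 2 * dist (\<gamma> t) e"
      using car by (auto simp: carrot_def)
    then show ?thesis using that l(1) by fastforce
  qed
  then have x's: "x' \<notin> solid" using l(1) by fastforce
  have "5 * rad v \<le> dist x' (emb v 0)" if v: "dead 0 v" for v
  proof (cases "v = w")
    case False
    then have "20 * rad w \<le> dist (emb w 0) (emb v 0)" "20 * rad v \<le> dist (emb w 0) (emb v 0)"
      using dead_far_from_dead[OF w(1) v _ emb_0_in_disc emb_0_in_disc] by auto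
    moreover have "dist (emb w 0) (emb v 0) \<le> dist x' (emb w 0) + dist x' (emb v 0)" by (rule dist_triangle3)
    ultimately show ?thesis using x'c rad_pos(1)[of v] by linarith
  qed (simp add: x'c)
  then show ?thesis using that[OF car _ x's] xx' w l(3) by auto
qed

lemma cigar_from_detour:
  fixes \<gamma> :: "real \<Rightarrow> complex"
  assumes \<gamma>: "\<gamma> 0 = x" "\<gamma> (dist x y) = y" "\<And>t t'. dist (\<gamma> t) (\<gamma> t') \<le> 3 * \<bar>t - t'\<bar>"
    and C: "\<And>t e. t \<in> {0..dist x y} \<Longrightarrow> e \<in> solid \<Longrightarrow> min t (dist x y - t) \<le> C * dist (\<gamma> t) e"
  shows "cigar (3 * C) x y (3 * dist x y)"
proof -
  define g where "g = (\<lambda>t. \<gamma> (t / 3))"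
  have "1-lipschitz_on {0..3 * dist x y} g"
  proof (rule lipschitz_onI)
    fix s t
    have "dist (g s) (g t) \<le> 3 * \<bar>s / 3 - t / 3\<bar>" unfolding g_def by (rule \<gamma>(3))
    then show "dist (g s) (g t) \<le> 1 * dist s t" by (simp add: dist_real_def abs_if split: if_splits)
  qed simp
  moreover have "min t (3 * dist x y - t) \<le> 3 * C * dist (g t) e" if "t \<in> {0..3 * dist x y}" "e \<in> solid" for t e
    using C[of "t / 3" e] that by (auto simp: g_def min_def split: if_splits)
  ultimately show ?thesis unfolding cigar_def using \<gamma>(1,2) by (intro conjI exI[of _ g]) (auto simp: g_def)
qed

text \<open>Every point of the solid set lies in a maximal disc that is small compared with its distance
  to both endpoints. Since the parent of such a disc is not small, a curve that avoids all these
  discs is a cigar.\<close>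

lemma cigar_between_far_points:
  assumes x: "x \<notin> solid" "\<And>w. dead 0 w \<Longrightarrow> 5 * rad w \<le> dist x (emb w 0)"
    and y: "y \<notin> solid" "\<And>w. dead 0 w \<Longrightarrow> 5 * rad w \<le> dist y (emb w 0)"
  shows "cigar 40000 x y (3 * dist x y)"
proof -
  define Far where "Far = (\<lambda>w. 5 * rad w \<le> dist x (emb w 0) \<and> 5 * rad w \<le> dist y (emb w 0))"
  show ?thesis
  proof (cases "Far []")
    case True
    \<comment> \<open>Here the whole solid set is one obstacle, inflated so that the nearer end
      point is exactly 5 radii from 0.\<close>
    define \<rho> where "\<rho> = min (cmod x) (cmod y) / 5"
    have \<rho>: "1 \<le> \<rho>" "5 * \<rho> \<le> cmod x" "5 * \<rho> \<le> cmod y" using True by (auto simp: Far_def \<rho>_def)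
    obtain \<gamma> where \<gamma>: "\<gamma> 0 = x" "\<gamma> (dist x y) = y" "\<And>t t'. dist (\<gamma> t) (\<gamma> t') \<le> 3 * \<bar>t - t'\<bar>"
      "\<And>t. 2 * \<rho> \<le> dist (\<gamma> t) 0" "\<And>t. t \<le> dist (\<gamma> t) x" "\<And>t. dist x y - t \<le> dist (\<gamma> t) y"
      by (rule detour[of "{()}" "\<lambda>_. \<rho>" "\<lambda>_. 0" x y]) (use \<rho> in auto)
    have "cigar (3 * 7) x y (3 * dist x y)"
    proof (rule cigar_from_detour[OF \<gamma>(1-3)])
      fix t e assume t: "t \<in> {0..dist x y}" and e: "e \<in> solid"
      have "cmod e \<le> 1" using solid_subset_cball e by auto
      then have d: "\<rho> \<le> dist (\<gamma> t) e" "cmod (\<gamma> t) \<le> dist (\<gamma> t) e + 1"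
        using \<gamma>(4)[of t] \<rho>(1) norm_triangle_ineq2[of "\<gamma> t" e] by (auto simp: dist_norm)
      have "dist (\<gamma> t) x \<le> cmod (\<gamma> t) + cmod x" "dist (\<gamma> t) y \<le> cmod (\<gamma> t) + cmod y"
        by (auto simp: dist_norm norm_triangle_ineq4)
      moreover have "cmod x = 5 * \<rho> \<or> cmod y = 5 * \<rho>" by (auto simp: \<rho>_def min_def)
      ultimately show "min t (dist x y - t) \<le> 7 * dist (\<gamma> t) e"
        using d \<rho>(1) \<gamma>(5,6)[of t] by linarith
    qed
    then show ?thesis by (rule cigar_mono) simp
  next
    case nroot: False
    have "open (- solid)" using closed_solid by (simp add: open_Compl)
    then obtain dx dy where "0 < dx" "ball x dx \<subseteq> - solid" "0 < dy" "ball y dy \<subseteq> - solid"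
      using x(1) y(1) openE by (metis ComplI)
    then obtain \<delta> where \<delta>: "0 < \<delta>" "\<And>e. e \<in> solid \<Longrightarrow> \<delta> \<le> dist x e" "\<And>e. e \<in> solid \<Longrightarrow> \<delta> \<le> dist y e"
      by (intro that[of "min dx dy"]) (auto simp: min_le_iff_disj subset_iff not_less)
    obtain n where n: "rr ^ n < \<delta> / 6" using real_arch_pow_inv[of "\<delta> / 6" rr] \<delta>(1) by auto
    have Far_small: "Far w" if w: "live 0 w" "6 * rad w \<le> \<delta>" for w
    proof -
      obtain e where e: "e \<in> disc w" "e \<in> solid" using solid_Int_live_disc_nonempty[OF w(1)] by blast
      then have "dist (emb w 0) e \<le> rad w" by (simp add: disc_eq)
      then show ?thesis using \<delta>(2,3)[OF e(2)] w(2) dist_triangle[of x e "emb w 0"] dist_triangle[of y e "emb w 0"]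
        unfolding Far_def by linarith
    qed
    \<comment> \<open>Maximal far discs, that is, far words without a far proper prefix. The parent
      of each is not far, so its radius is bounded below by the distance of the end points to the
      solid set, which makes \<open>I\<close> finite.\<close>
    define I where "I = {w. node 0 w \<and> Far w \<and> (\<forall>u. strict_prefix u w \<longrightarrow> \<not> Far u)}"
    have nonempty: "w \<noteq> []" if "w \<in> I" for w using that nroot by (auto simp: I_def)
    have "I \<subseteq> {w. set w \<subseteq> {..<2200} \<and> length w \<le> Suc n}"
    proof
      fix w assume w: "w \<in> I"
      obtain u l where u: "w = u @ [l]" using nonempty[OF w] by (metis append_butlast_last_id)
      then have "live 0 u" "\<not> Far u"
        using w node_append[of 0 u "[l]"] by (auto simp: I_def strict_prefix_def)
      then have "\<delta> < 6 * rad u" using Far_small by force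
      then have "rr ^ n < rr ^ length u" using n unfolding rad_def by linarith
      then have "length u < n" by (metis not_le power_decreasing rr_less_1(2) rr_pos(2))
      moreover have "set w \<subseteq> {..<2200}" using w node_letters[of 0 w] by (simp add: I_def)
      ultimately show "w \<in> {w. set w \<subseteq> {..<2200} \<and> length w \<le> Suc n}" by (simp add: u)
    qed
    then have fin: "finite I" by (rule finite_subset) (rule finite_lists_length_le, simp)
    have sep: "20 * rad w \<le> dist (emb w 0) (emb w' 0)" if w: "w \<in> I" "w' \<in> I" "w \<noteq> w'" for w w'
    proof -
      have "\<not> prefix w w'" "\<not> prefix w' w" using w by (auto simp: I_def strict_prefix_def)
      then show ?thesis using node_parallel_dist_rad(1)[of 0 w w'] w by (auto simp: I_def)
    qed
    have cover: "\<exists>w\<in>I. e \<in> disc w" if e: "e \<in> solid" for e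
    proof -
      have "\<exists>w. node 0 w \<and> e \<in> disc w \<and> Far w"
      proof -
        consider "e \<in> cantor" | w where "dead 0 w" "e \<in> emb w ` square"
          using e by (auto simp: solid_def)
        then show ?thesis
        proof cases
          case 1
          then obtain w where w: "live 0 w" "length w = n" "e \<in> disc w"
            unfolding cantor_def level_def lives_def by blast
          then have "Far w" using n by (intro Far_small) (auto simp: rad_def)
          then show ?thesis using w node_live by blast
        next
          case 2
          \<comment> \<open>A square cannot be subdivided further, so its disc must be far itself;
            this is the assumption on both end points.\<close>
          then show ?thesis using x(2) y(2) node_dead emb_square_subset_disc by (fastforce simp: Far_def)
        qed
      qed
      then obtain w where w: "node 0 w" "e \<in> disc w" "Far w" by blast
      define m where "m = (LEAST m. Far (take m w))"
      have F: "Far (take m w)" unfolding m_def by (rule LeastI[of _ "length w"]) (simp add: w(3))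
      have ml: "m \<le> length w" unfolding m_def by (rule Least_le) (simp add: w(3))
      have "node 0 (take m w)"
        using live_take[OF w(1), of m] w(1) ml node_live by (cases "m < length w") auto
      moreover have "\<not> Far u" if su: "strict_prefix u (take m w)" for u
      proof -
        obtain v where v: "take m w = u @ v" "v \<noteq> []" using su by (auto simp: strict_prefix_def prefix_def)
        then have lu: "length u < m" using ml by (metis append_eq_conv_conj length_append length_greater_0_conv length_take less_add_same_cancel1 min.absorb2)
        then have "u = take (length u) w" using v(1) by (metis append_eq_conv_conj less_imp_le_nat min.absorb1 take_take)
        then show ?thesis using not_less_Least[of "length u" "\<lambda>m. Far (take m w)"] lu by (auto simp: m_def)
      qed
      moreover have "e \<in> disc (take m w)" using disc_prefix[OF take_is_prefix w(1)] w(2) by blast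
      ultimately show ?thesis using F by (auto simp: I_def)
    qed
    obtain \<gamma> where \<gamma>: "\<gamma> 0 = x" "\<gamma> (dist x y) = y" "\<And>t t'. dist (\<gamma> t) (\<gamma> t') \<le> 3 * \<bar>t - t'\<bar>"
      "\<And>t w. w \<in> I \<Longrightarrow> 2 * rad w \<le> dist (\<gamma> t) (emb w 0)" "\<And>t. t \<le> dist (\<gamma> t) x" "\<And>t. dist x y - t \<le> dist (\<gamma> t) y"
    proof (rule detour[of I rad "\<lambda>w. emb w 0" x y])
      show "5 * rad w \<le> dist x (emb w 0)" "5 * rad w \<le> dist y (emb w 0)" if "w \<in> I" for w
        using that by (auto simp: I_def Far_def)
    qed (use fin sep in auto)
    \<comment> \<open>The parent \<open>u\<close> is not far, so an end point is within
      \<open>5 * rad u\<close> of its centre. With \<open>rad u \<le> 2200 * d\<close> the parameter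
      is at most \<open>d + 6 * 2200 * d\<close>.\<close>
    have "cigar (3 * 13201) x y (3 * dist x y)"
    proof (rule cigar_from_detour[OF \<gamma>(1-3)])
      fix t e assume t: "t \<in> {0..dist x y}" and e: "e \<in> solid"
      obtain w where w: "w \<in> I" "e \<in> disc w" using cover[OF e] by blast
      obtain u l where u: "w = u @ [l]" using nonempty[OF w(1)] by (metis append_butlast_last_id)
      define d where "d = dist (\<gamma> t) e"
      have "dist (emb w 0) e \<le> rad w" using w(2) by (simp add: disc_eq)
      then have "rr * rad u \<le> d"
        using \<gamma>(4)[OF w(1), of t] dist_triangle[of "\<gamma> t" "emb w 0" e] by (simp add: d_def u rad_Suc dist_commute)
      then have ru: "rad u \<le> 2200 * d" by (simp add: rr_def)
      have nw: "node 0 w" and nF: "\<not> Far u" using w(1) u by (auto simp: I_def strict_prefix_def)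
      have "e \<in> disc u" using disc_prefix[OF _ nw, of u] w(2) u by auto
      then have eu: "dist (emb u 0) e \<le> rad u" by (simp add: disc_eq)
      from nF have "dist x (emb u 0) < 5 * rad u \<or> dist y (emb u 0) < 5 * rad u" by (auto simp: Far_def)
      then show "min t (dist x y - t) \<le> 13201 * dist (\<gamma> t) e"
      proof
        assume "dist x (emb u 0) < 5 * rad u"
        moreover have "dist (\<gamma> t) x \<le> d + dist (emb u 0) e + dist x (emb u 0)"
          using dist_triangle[of "\<gamma> t" x e] dist_triangle[of e x "emb u 0"] by (simp add: d_def dist_commute)
        ultimately show ?thesis using \<gamma>(5)[of t] ru eu unfolding d_def by linarith
      next
        assume "dist y (emb u 0) < 5 * rad u"
        moreover have "dist (\<gamma> t) y \<le> d + dist (emb u 0) e + dist y (emb u 0)"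
          using dist_triangle[of "\<gamma> t" y e] dist_triangle[of e y "emb u 0"] by (simp add: d_def dist_commute)
        ultimately show ?thesis using \<gamma>(6)[of t] ru eu unfolding d_def by linarith
      qed
    qed
    then show ?thesis by (rule cigar_mono) simp
  qed
qed

text \<open>Both points move radially outwards by \<open>8 * s\<close>. The directions differ by at
  most 1/8, so the tips stay within \<open>2 * s\<close> of each other, while they are at least
  \<open>4 * s\<close> from the solid set; a segment then joins them.\<close>

lemma cigar_near_square:
  assumes w: "dead 0 w" "dist x (emb w 0) < 5 * rad w" and s: "dist x y \<le> rad w / 64"
    and x: "x \<notin> solid" and y: "y \<notin> solid"
  obtains T where "T \<le> 18 * dist x y" "cigar 5 x y T"
proof -
  define s where "s = dist x y"
  define p q where "p = x - emb w 0" and "q = y - emb w 0"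
  define x' y' where "x' = x + of_real (8 * s) * (p / of_real (cmod p))"
    and "y' = y + of_real (8 * s) * (q / of_real (cmod q))"
  have r: "0 < rad w" by simp
  have s: "0 \<le> s" "s \<le> rad w / 64" using s by (auto simp: s_def)
  have yc: "dist y (emb w 0) < 6 * rad w"
    using dist_triangle[of y "emb w 0" x] w(2) s r dist_commute[of x y] unfolding s_def by linarith
  have p: "rad w / 4 < cmod p" and cx: "carrot x x' (8 * s)"
    unfolding x'_def using radial_carrot[OF w(1) x _ _ p_def, of "8 * s"] w(2) s by auto
  have q: "rad w / 4 < cmod q" and cy: "carrot y y' (8 * s)"
    unfolding y'_def using radial_carrot[OF w(1) y _ _ q_def, of "8 * s"] yc s by auto
  have p0: "0 < cmod p" "0 < cmod q" using p q r by linarith+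
  have pq: "p - q = x - y" by (simp add: p_def q_def)
  have eq: "p / of_real (cmod p) - q / of_real (cmod q)
      = (p - q) / of_real (cmod p) + q / of_real (cmod q) * of_real ((cmod q - cmod p) / cmod p)"
    using p0 by (simp add: field_simps)
  have "cmod (p / of_real (cmod p) - q / of_real (cmod q)) \<le> cmod ((p - q) / of_real (cmod p))
      + cmod (q / of_real (cmod q) * of_real ((cmod q - cmod p) / cmod p))"
    unfolding eq by (rule norm_triangle_ineq)
  also have "cmod ((p - q) / of_real (cmod p)) = s / cmod p"
    by (simp add: norm_divide pq s_def dist_norm)
  also have "cmod (q / of_real (cmod q) * of_real ((cmod q - cmod p) / cmod p))
      = cmod q / \<bar>cmod q\<bar> * (\<bar>cmod q - cmod p\<bar> / \<bar>cmod p\<bar>)"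
    by (simp only: norm_mult norm_divide norm_of_real abs_divide)
  also have "\<dots> = \<bar>cmod q - cmod p\<bar> / cmod p" using p0 by simp
  also have "\<bar>cmod q - cmod p\<bar> / cmod p \<le> s / cmod p"
    using norm_triangle_ineq3[of q p] p0 pq by (intro divide_right_mono) (auto simp: s_def dist_norm norm_minus_commute)
  also have "s / cmod p + s / cmod p \<le> 1/8"
  proof -
    have "s \<le> cmod p / 16" using s p by simp
    then have "s / cmod p \<le> 1/16" using p0 by (simp add: pos_divide_le_eq)
    then show ?thesis by linarith
  qed
  finally have u: "cmod (p / of_real (cmod p) - q / of_real (cmod q)) \<le> 1/8" by simp
  have "x' - y' = (x - y) + of_real (8 * s) * (p / of_real (cmod p) - q / of_real (cmod q))"
    by (simp add: x'_def y'_def algebra_simps)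
  then have "dist x' y' \<le> s + 8 * s * cmod (p / of_real (cmod p) - q / of_real (cmod q))"
    unfolding dist_norm s_def using norm_triangle_ineq[of "x - y" "of_real (8 * s) * (p / of_real (cmod p) - q / of_real (cmod q))"]
    by (simp add: norm_mult s_def dist_norm)
  also have "\<dots> \<le> s + 8 * s * (1/8)" using u s by (intro add_left_mono mult_left_mono) auto
  finally have d: "dist x' y' \<le> 2 * s" by simp
  have mid: "cigar 1 x' y' (dist x' y')"
  proof -
    define u where "u = (if x' = y' then 0 else (y' - x') / of_real (dist x' y'))"
    have u: "cmod u \<le> 1" by (simp add: u_def norm_divide dist_norm norm_minus_commute)
    define \<gamma> where "\<gamma> = (\<lambda>t. x' + of_real t * u)"
    have dd: "dist (\<gamma> t) (\<gamma> t') \<le> \<bar>t - t'\<bar>" for t t'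
    proof -
      have "\<gamma> t - \<gamma> t' = of_real (t - t') * u" by (simp add: \<gamma>_def algebra_simps)
      then show ?thesis using u by (simp add: dist_norm norm_mult mult_left_le flip: of_real_diff)
    qed
    have "min t (dist x' y' - t) \<le> 1 * dist (\<gamma> t) e" if t: "t \<in> {0..dist x' y'}" and e: "e \<in> solid" for t e
    proof -
      obtain \<alpha> where "\<alpha> (8 * s) = x'" "\<And>t e. t \<in> {0..8 * s} \<Longrightarrow> e \<in> solid \<Longrightarrow> t \<le> 2 * dist (\<alpha> t) e"
        using cx by (auto simp: carrot_def)
      then have "8 * s \<le> 2 * dist x' e" using e s(1) by fastforce
      moreover have "dist x' (\<gamma> t) \<le> t" using dd[of 0 t] t by (simp add: \<gamma>_def)
      moreover have "dist x' e \<le> dist x' (\<gamma> t) + dist (\<gamma> t) e" by (rule dist_triangle)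
      moreover have "t \<le> 2 * s" using t d by simp
      ultimately show ?thesis by linarith
    qed
    then show ?thesis unfolding cigar_def
      by (intro conjI exI[of _ \<gamma>] lipschitz_onI) (use dd in \<open>auto simp: dist_real_def\<close>, auto simp: \<gamma>_def u_def)
  qed
  have "cigar (2 + 3 * 1) x y (8 * s + dist x' y' + 8 * s)"
    by (rule cigar_join[OF cx mid cy]) simp
  then show ?thesis using that[of "8 * s + dist x' y' + 8 * s"] d by (simp add: s_def)
qed

text \<open>If the distance \<open>s\<close> is at most 1/64 of the radius of a square near one of
  the points, the radial construction applies. Otherwise escaping costs at most
  \<open>5 * 64 = 320\<close> times \<open>s\<close> at either end, and a detour joins the tips;
  \<open>120002 = 2 + 3 * 40000\<close>.\<close>

lemma uniform_domain_solid: "uniform_domain (- solid)"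
proof (rule uniform_domain_cigar[of 120002])
  fix x y assume xy: "x \<notin> solid" "y \<notin> solid"
  define s where "s = dist x y"
  show "\<exists>T. T \<le> 120002 * dist x y \<and> cigar 120002 x y T"
  proof (cases "\<exists>w. dead 0 w \<and> s \<le> rad w / 64 \<and> (dist x (emb w 0) < 5 * rad w \<or> dist y (emb w 0) < 5 * rad w)")
    case True
    then obtain w where w: "dead 0 w" "s \<le> rad w / 64"
      "dist x (emb w 0) < 5 * rad w \<or> dist y (emb w 0) < 5 * rad w" by blast
    from w(3) show ?thesis
    proof
      assume "dist x (emb w 0) < 5 * rad w"
      then obtain T where "T \<le> 18 * dist x y" "cigar 5 x y T"
        using cigar_near_square[OF w(1) _ _ xy] w(2) by (auto simp: s_def)
      then show ?thesis using cigar_mono[of 5 x y T 120002] zero_le_dist[of x y]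
        by (intro exI[of _ T] conjI) (linarith, simp)
    next
      assume "dist y (emb w 0) < 5 * rad w"
      then obtain T where "T \<le> 18 * dist y x" "cigar 5 y x T"
        using cigar_near_square[OF w(1) _ _ xy(2,1)] w(2) by (auto simp: s_def dist_commute)
      then show ?thesis using cigar_mono[OF cigar_sym[of 5 y x T], of 120002] zero_le_dist[of x y] dist_commute[of x y]
        by (intro exI[of _ T] conjI) (linarith, simp)
    qed
  next
    case False
    obtain x' l where x': "carrot x x' l" "dist x x' \<le> l" "x' \<notin> solid"
      "\<And>w. dead 0 w \<Longrightarrow> 5 * rad w \<le> dist x' (emb w 0)"
      "l = 0 \<or> (\<exists>w. dead 0 w \<and> dist x (emb w 0) < 5 * rad w \<and> l \<le> 5 * rad w)"
      using escape[OF xy(1)] by blast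
    obtain y' m where y': "carrot y y' m" "dist y y' \<le> m" "y' \<notin> solid"
      "\<And>w. dead 0 w \<Longrightarrow> 5 * rad w \<le> dist y' (emb w 0)"
      "m = 0 \<or> (\<exists>w. dead 0 w \<and> dist y (emb w 0) < 5 * rad w \<and> m \<le> 5 * rad w)"
      using escape[OF xy(2)] by blast
    have s0: "0 \<le> s" by (simp add: s_def)
    have l: "l \<le> 320 * s" using x'(5) False s0 by force
    have m: "m \<le> 320 * s" using y'(5) False s0 by force
    have "cigar (2 + 3 * 40000) x y (l + 3 * dist x' y' + m)"
      by (rule cigar_join[OF x'(1) cigar_between_far_points[OF x'(3,4) y'(3,4)] y'(1)]) auto
    moreover have "dist x' y' \<le> s + l + m"
      using dist_triangle[of x' y' x] dist_triangle[of x y' y] x'(2) y'(2) by (simp add: s_def dist_commute)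
    then have "l + 3 * dist x' y' + m \<le> 120002 * s" using l m s0 by linarith
    ultimately show ?thesis by (auto simp: s_def)
  qed
qed simp

section \<open>Ahlfors regularity and rectifiability\<close>

definition side :: "nat \<Rightarrow> real \<Rightarrow> complex" where
  "side i t = (if i = 0 then Complex t (1/4) else if i = 1 then Complex t (- 1/4)
     else if i = 2 then Complex (1/4) t else Complex (- 1/4) t)"

text \<open>Arc length parametrisation: division by \<open>rad w\<close> undoes the similarity.
  Sides 0 and 1 are horizontal, 2 and 3 vertical.\<close>

definition edge :: "nat list \<Rightarrow> nat \<Rightarrow> real \<Rightarrow> complex" where
  "edge w i u = emb w (side i (u / rad w))"

lemma rad_ne_0 [simp]: "rad w \<noteq> 0"
  by (simp add: rad_def)

lemma dist_side: "dist (side i s) (side i t) = \<bar>s - t\<bar>"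
  by (auto simp: side_def dist_norm cmod_def)

lemma dist_edge: "dist (edge w i s) (edge w i t) = \<bar>s - t\<bar>"
  by (simp add: edge_def dist_emb dist_side abs_divide flip: diff_divide_distrib)

lemma square_bd_eq: "square_bd = (\<Union>i<4. side i ` {-1/4..1/4})"
proof (intro equalityI subsetI)
  fix z assume "z \<in> square_bd"
  then consider "Im z = 1/4" "\<bar>Re z\<bar> \<le> 1/4" | "Im z = - 1/4" "\<bar>Re z\<bar> \<le> 1/4"
    | "Re z = 1/4" "\<bar>Im z\<bar> \<le> 1/4" | "Re z = - 1/4" "\<bar>Im z\<bar> \<le> 1/4"
    by (auto simp: square_bd_def square_def abs_if split: if_splits)
  then show "z \<in> (\<Union>i<4. side i ` {-1/4..1/4})"
  proof cases
    case 1
    then show ?thesis by (intro UN_I[of 0] image_eqI[of _ _ "Re z"]) (auto simp: side_def complex_eq_iff)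
  next
    case 2
    then show ?thesis by (intro UN_I[of 1] image_eqI[of _ _ "Re z"]) (auto simp: side_def complex_eq_iff)
  next
    case 3
    then show ?thesis by (intro UN_I[of 2] image_eqI[of _ _ "Im z"]) (auto simp: side_def complex_eq_iff)
  next
    case 4
    then show ?thesis by (intro UN_I[of 3] image_eqI[of _ _ "Im z"]) (auto simp: side_def complex_eq_iff)
  qed
qed (auto simp: side_def square_bd_def square_def)

lemma emb_square_bd_eq: "emb w ` square_bd = (\<Union>i<4. edge w i ` {- (rad w / 4)..rad w / 4})"
proof -
  have "emb w ` side i ` {-1/4..1/4} = edge w i ` {- (rad w / 4)..rad w / 4}" for i
  proof (intro equalityI subsetI)
    fix z assume "z \<in> emb w ` side i ` {-1/4..1/4}"
    then obtain t where t: "t \<in> {-1/4..1/4}" "z = emb w (side i t)" by blast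
    have "rad w * (- 1/4) \<le> rad w * t" "rad w * t \<le> rad w * (1/4)"
      using t(1) by (intro mult_left_mono; simp)+
    then show "z \<in> edge w i ` {- (rad w / 4)..rad w / 4}"
      using t(2) by (intro image_eqI[of _ _ "rad w * t"]) (auto simp: edge_def rad_def)
  next
    fix z assume "z \<in> edge w i ` {- (rad w / 4)..rad w / 4}"
    then obtain u where u: "u \<in> {- (rad w / 4)..rad w / 4}" "z = edge w i u" by blast
    then have "u / rad w \<in> {-1/4..1/4}" by (simp add: pos_divide_le_eq pos_le_divide_eq)
    then show "z \<in> emb w ` side i ` {-1/4..1/4}" using u(2) by (auto simp: edge_def)
  qed
  then show ?thesis by (simp add: square_bd_eq image_UN)
qed

lemma edge_measure_le:
  assumes "S \<subseteq> edge w i ` {a..b}" "a \<le> b"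
  shows "hausdorff_measure1 S \<le> ennreal (b - a)"
  by (rule hausdorff_measure1_curve_le[of _ _ "edge w i"]) (use assms in \<open>auto simp: dist_edge\<close>)

lemma edge_coord:
  "i < 2 \<Longrightarrow> Re (edge w i u) = Re (emb w 0) + u" "i < 2 \<Longrightarrow> Im (edge w i u) = Im (edge w i 0)"
  "\<not> i < 2 \<Longrightarrow> Im (edge w i u) = Im (emb w 0) + u" "\<not> i < 2 \<Longrightarrow> Re (edge w i u) = Re (edge w i 0)"
proof -
  have "edge w i u = emb w 0 + of_real (rad w) * side i (u / rad w)" for u
    unfolding edge_def by (rule emb_affine)
  then show "i < 2 \<Longrightarrow> Re (edge w i u) = Re (emb w 0) + u" "i < 2 \<Longrightarrow> Im (edge w i u) = Im (edge w i 0)"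
    "\<not> i < 2 \<Longrightarrow> Im (edge w i u) = Im (emb w 0) + u" "\<not> i < 2 \<Longrightarrow> Re (edge w i u) = Re (edge w i 0)"
    using less_imp_neq[OF rad_pos(1)[of w]] by (auto simp: side_def)
qed

lemma edge_measure_ge:
  assumes "edge w i ` {a..b} \<subseteq> S"
  shows "ennreal (b - a) \<le> hausdorff_measure1 S"
proof (cases "i < 2")
  case True
  have "ennreal ((Re (emb w 0) + b) - (Re (emb w 0) + a)) \<le> hausdorff_measure1 S"
  proof (rule hausdorff_measure1_ge_projection[of S Re])
    show "\<bar>Re x - Re y\<bar> \<le> dist x y" for x y using abs_Re_le_cmod[of "x - y"] by (simp add: dist_norm)
    show "{Re (emb w 0) + a..Re (emb w 0) + b} \<subseteq> Re ` S"
    proof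
      fix t assume t: "t \<in> {Re (emb w 0) + a..Re (emb w 0) + b}"
      then have "edge w i (t - Re (emb w 0)) \<in> S" using assms by (auto simp: image_subset_iff)
      then show "t \<in> Re ` S" using edge_coord(1)[OF True] by (force intro: rev_image_eqI)
    qed
  qed
  then show ?thesis by simp
next
  case False
  have "ennreal ((Im (emb w 0) + b) - (Im (emb w 0) + a)) \<le> hausdorff_measure1 S"
  proof (rule hausdorff_measure1_ge_projection[of S Im])
    show "\<bar>Im x - Im y\<bar> \<le> dist x y" for x y using abs_Im_le_cmod[of "x - y"] by (simp add: dist_norm)
    show "{Im (emb w 0) + a..Im (emb w 0) + b} \<subseteq> Im ` S"
    proof
      fix t assume t: "t \<in> {Im (emb w 0) + a..Im (emb w 0) + b}"
      then have "edge w i (t - Im (emb w 0)) \<in> S" using assms by (auto simp: image_subset_iff)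
      then show "t \<in> Im ` S" using edge_coord(3)[OF False] by (force intro: rev_image_eqI)
    qed
  qed
  then show ?thesis by simp
qed

lemma square_bd_measure_le: "hausdorff_measure1 (emb w ` square_bd) \<le> ennreal (2 * rad w)"
proof -
  have "hausdorff_measure1 (emb w ` square_bd) \<le> (\<Sum>i<4. hausdorff_measure1 (edge w i ` {- (rad w / 4)..rad w / 4}))"
    unfolding emb_square_bd_eq by (rule hausdorff_measure1_UN) simp
  also have "\<dots> \<le> (\<Sum>i<(4::nat). ennreal (rad w / 4 - - (rad w / 4)))"
    by (intro sum_mono edge_measure_le) auto
  also have "\<dots> = ennreal (\<Sum>i<(4::nat). rad w / 4 - - (rad w / 4))"
    by (rule sum_ennreal) simp
  also have "\<dots> = ennreal (2 * rad w)" by simp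
  finally show ?thesis .
qed

lemma square_bd_ball_measure_le:
  assumes "0 < r"
  shows "hausdorff_measure1 (emb w ` square_bd \<inter> ball x r) \<le> ennreal (16 * r)"
proof -
  have le: "hausdorff_measure1 (edge w i ` {- (rad w / 4)..rad w / 4} \<inter> ball x r) \<le> ennreal (4 * r)" for i
  proof (cases "edge w i ` {- (rad w / 4)..rad w / 4} \<inter> ball x r = {}")
    case False
    then obtain u where u: "edge w i u \<in> ball x r" by blast
    have "edge w i ` {- (rad w / 4)..rad w / 4} \<inter> ball x r \<subseteq> edge w i ` {u - 2 * r..u + 2 * r}"
    proof (intro subsetI, elim IntE imageE)
      fix z v assume z: "z \<in> ball x r" "z = edge w i v"
      have "dist (edge w i u) (edge w i v) \<le> 2 * r"
        using u z dist_triangle[of "edge w i u" "edge w i v" x] by (simp add: dist_commute)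
      then show "z \<in> edge w i ` {u - 2 * r..u + 2 * r}" using z(2) by (auto simp: dist_edge abs_le_iff)
    qed
    then have "hausdorff_measure1 (edge w i ` {- (rad w / 4)..rad w / 4} \<inter> ball x r) \<le> ennreal (u + 2 * r - (u - 2 * r))"
      by (rule edge_measure_le) (use assms in simp)
    then show ?thesis by simp
  qed simp
  have "emb w ` square_bd \<inter> ball x r = (\<Union>i<4. edge w i ` {- (rad w / 4)..rad w / 4} \<inter> ball x r)"
    unfolding emb_square_bd_eq by blast
  then have "hausdorff_measure1 (emb w ` square_bd \<inter> ball x r)
      \<le> (\<Sum>i<4. hausdorff_measure1 (edge w i ` {- (rad w / 4)..rad w / 4} \<inter> ball x r))"
    by (simp only:) (rule hausdorff_measure1_UN, simp)
  also have "\<dots> \<le> (\<Sum>i<(4::nat). ennreal (4 * r))" by (intro sum_mono le)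
  also have "\<dots> = ennreal (\<Sum>i<(4::nat). 4 * r)" by (rule sum_ennreal) (use assms in simp)
  also have "\<dots> = ennreal (16 * r)" by simp
  finally show ?thesis .
qed

lemma ediam_disc_le: "ediam (disc w) \<le> ennreal (2 * rad w)"
proof (rule ediam_leI)
  fix x y assume "x \<in> disc w" "y \<in> disc w"
  then show "dist x y \<le> 2 * rad w"
    using dist_triangle3[of x y "emb w 0"] by (simp add: disc_eq)
qed

lemma cantor_measure_zero: "hausdorff_measure1 cantor = 0"
proof -
  have "hausdorff_measure1 cantor \<le> 0"
  proof (rule hausdorff_measure1_le)
    fix \<delta> :: real assume \<delta>: "0 < \<delta>"
    show "hausdorff_pre1 (ennreal \<delta>) cantor \<le> 0"
    proof (rule ennreal_le_epsilon)
      fix e :: real assume e: "0 < e"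
      obtain n1 where n1: "rr ^ n1 < \<delta> / 2" using real_arch_pow_inv[of "\<delta> / 2" rr] \<delta> by auto
      obtain n2 where n2: "(25/44) ^ n2 < e / 2" using real_arch_pow_inv[of "e / 2" "25/44"] e by auto
      define n where "n = max n1 n2"
      have "rr ^ n \<le> rr ^ n1" by (intro power_decreasing) (auto simp: n_def)
      then have a: "2 * rr ^ n \<le> \<delta>" using n1 by linarith
      have "(25/44 :: real) ^ n \<le> (25/44) ^ n2" by (intro power_decreasing) (auto simp: n_def)
      then have b: "2 * live_mass 0 n \<le> e" using n2 live_mass_le[of 0 n] unfolding power_0 mult_1_left by linarith
      have "hausdorff_pre1 (ennreal \<delta>) cantor \<le> (\<Sum>w\<in>lives 0 n. ediam (disc w))"
      proof (rule hausdorff_pre1_finite_cover)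
        show "cantor \<subseteq> (\<Union>w\<in>lives 0 n. disc w)" by (auto simp: cantor_def level_def)
        show "ediam (disc w) \<le> ennreal \<delta>" if "w \<in> lives 0 n" for w
          using ediam_disc_le[of w] that a by (auto simp: lives_def rad_def intro: order_trans ennreal_leI)
      qed simp
      also have "\<dots> \<le> (\<Sum>w\<in>lives 0 n. ennreal (2 * rr ^ n))"
        using ediam_disc_le by (intro sum_mono) (auto simp: lives_def rad_def)
      also have "\<dots> = ennreal (2 * live_mass 0 n)"
        by (simp add: live_mass_def ennreal_of_nat_eq_real_of_nat mult_ac flip: ennreal_mult)
      also have "\<dots> \<le> 0 + ennreal e" using b by (simp add: ennreal_leI)
      finally show "hausdorff_pre1 (ennreal \<delta>) cantor \<le> 0 + ennreal e" .
    qed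
  qed
  then show ?thesis by simp
qed

lemma hausdorff_measure1_cantor_Un: "hausdorff_measure1 (cantor \<union> S) \<le> hausdorff_measure1 S"
  using hausdorff_measure1_Un[of cantor S] by (simp add: cantor_measure_zero)

lemma boundary_dead_disc_subset:
  assumes "dead 0 w" shows "boundary \<inter> disc w \<subseteq> cantor \<union> emb w ` square_bd"
proof
  fix z assume z: "z \<in> boundary \<inter> disc w"
  show "z \<in> cantor \<union> emb w ` square_bd"
  proof (cases "z \<in> cantor")
    case False
    then obtain w' where w': "dead 0 w'" "z \<in> emb w' ` square_bd" using z by (auto simp: boundary_def)
    then have "z \<in> disc w'" using emb_square_subset_disc square_bd_subset by blast
    then have "prefix w w' \<or> prefix w' w"
      using node_disc_inter[OF node_dead[OF assms] node_dead[OF w'(1)]] z by blast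
    then have "w = w'" using dead_prefix_eq node_dead assms w'(1) by metis
    then show ?thesis using w' by simp
  qed simp
qed

text \<open>The squares \<open>n\<close> generations below a live node have total perimeter
  \<open>2 * rad w * dead_mass k n\<close>, and the capture probabilities sum to at most 1.\<close>

lemma boundary_node_disc_measure_le:
  assumes "node 0 w" shows "hausdorff_measure1 (boundary \<inter> disc w) \<le> ennreal (2 * rad w)"
proof (cases "dead 0 w")
  case True
  then have "hausdorff_measure1 (boundary \<inter> disc w) \<le> hausdorff_measure1 (cantor \<union> emb w ` square_bd)"
    by (intro hausdorff_measure1_mono boundary_dead_disc_subset)
  also have "\<dots> \<le> ennreal (2 * rad w)"
    using hausdorff_measure1_cantor_Un square_bd_measure_le order_trans by blast
  finally show ?thesis .
next
  case False
  then have w: "live 0 w" using assms by (simp add: node_def)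
  define k where "k = state 0 w"
  define A where "A = (\<lambda>n. \<Union>v\<in>deads k n. emb (w @ v) ` square_bd)"
  have "boundary \<inter> disc w \<subseteq> cantor \<union> (\<Union>n. A n)"
  proof
    fix z assume z: "z \<in> boundary \<inter> disc w"
    show "z \<in> cantor \<union> (\<Union>n. A n)"
    proof (cases "z \<in> cantor")
      case False
      then obtain w' where w': "dead 0 w'" "z \<in> emb w' ` square_bd" using z by (auto simp: boundary_def)
      then have "z \<in> disc w'" using emb_square_subset_disc square_bd_subset by blast
      then have "prefix w w' \<or> prefix w' w"
        using node_disc_inter[OF assms node_dead[OF w'(1)]] z by blast
      moreover have "w \<noteq> w'" using \<open>\<not> dead 0 w\<close> w'(1) by blast
      then have "\<not> prefix w' w" using dead_prefix_eq[OF w'(1) assms] by blast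
      ultimately obtain v where v: "w' = w @ v" "v \<noteq> []" using \<open>w \<noteq> w'\<close> by (auto simp: prefix_def)
      then have "v \<in> deads k (length v)" using w'(1) by (simp add: dead_append deads_def k_def)
      then show ?thesis using w'(2) v(1) by (auto simp: A_def)
    qed simp
  qed
  then have "hausdorff_measure1 (boundary \<inter> disc w) \<le> hausdorff_measure1 (cantor \<union> (\<Union>n. A n))"
    by (rule hausdorff_measure1_mono)
  also have "\<dots> \<le> hausdorff_measure1 (\<Union>n. A n)" by (rule hausdorff_measure1_cantor_Un)
  also have "\<dots> \<le> (\<Sum>n. hausdorff_measure1 (A n))" by (rule hausdorff_measure1_countable_subadd)
  also have "\<dots> \<le> (\<Sum>n. ennreal (2 * rad w * dead_mass k n))"
  proof (intro suminf_le summableI)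
    fix n
    have "hausdorff_measure1 (A n) \<le> (\<Sum>v\<in>deads k n. hausdorff_measure1 (emb (w @ v) ` square_bd))"
      unfolding A_def by (rule hausdorff_measure1_UN) simp
    also have "\<dots> \<le> (\<Sum>v\<in>deads k n. ennreal (2 * rad w * rr ^ n))"
      by (intro sum_mono order_trans[OF square_bd_measure_le]) (simp add: deads_def rad_def power_add mult_ac)
    also have "\<dots> = ennreal (2 * rad w * dead_mass k n)"
      by (simp add: dead_mass_def ennreal_of_nat_eq_real_of_nat mult_ac flip: ennreal_mult)
    finally show "hausdorff_measure1 (A n) \<le> ennreal (2 * rad w * dead_mass k n)" .
  qed
  also have "\<dots> \<le> ennreal (2 * rad w)"
  proof (rule suminf_le_const[OF summableI])
    fix n
    have "(\<Sum>m<n. ennreal (2 * rad w * dead_mass k m)) = ennreal (\<Sum>m<n. 2 * rad w * dead_mass k m)"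
      by (intro sum_ennreal) simp
    also have "(\<Sum>m<n. 2 * rad w * dead_mass k m) = 2 * rad w * (\<Sum>m<n. dead_mass k m)"
      by (simp add: sum_distrib_left)
    also have "(\<Sum>m<n. dead_mass k m) \<le> (\<Sum>m\<le>n. dead_mass k m)"
      by (intro sum_mono2) auto
    also have "\<dots> \<le> 1" using mass_nonneg(1)[of k n] by (simp add: dead_mass_sum)
    finally show "(\<Sum>m<n. ennreal (2 * rad w * dead_mass k m)) \<le> ennreal (2 * rad w)"
      by (simp add: ennreal_leI mult_left_mono)
  qed
  finally show ?thesis .
qed

lemma dead_square_measure_ge: "ennreal (rad w / 2) \<le> hausdorff_measure1 (emb w ` square_bd)"
proof -
  have "edge w 0 ` {- (rad w / 4)..rad w / 4} \<subseteq> emb w ` square_bd"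
    unfolding emb_square_bd_eq by (rule UN_upper) simp
  then have "ennreal (rad w / 4 - - (rad w / 4)) \<le> hausdorff_measure1 (emb w ` square_bd)"
    by (rule edge_measure_ge)
  then show ?thesis by simp
qed

lemma dead_square_bd_subset: "dead 0 w \<Longrightarrow> emb w ` square_bd \<subseteq> boundary \<inter> disc w"
  using emb_square_subset_disc[of w] image_mono[OF square_bd_subset, of "emb w"] unfolding boundary_def by blast

text \<open>Half of the capture probability is reached at a finite depth, so finitely many squares
  suffice; these have a positive mutual distance, and superadditivity applies. One side per square
  is counted.\<close>

lemma boundary_node_disc_measure_ge:
  assumes "node 0 w" shows "ennreal (rad w / 4) \<le> hausdorff_measure1 (boundary \<inter> disc w)"
proof (cases "dead 0 w")
  case True
  have "emb w ` square_bd \<subseteq> boundary \<inter> disc w" by (rule dead_square_bd_subset[OF True])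
  then have "ennreal (rad w / 2) \<le> hausdorff_measure1 (boundary \<inter> disc w)"
    using dead_square_measure_ge hausdorff_measure1_mono order_trans by blast
  moreover have "ennreal (rad w / 4) \<le> ennreal (rad w / 2)" by (intro ennreal_leI) simp
  ultimately show ?thesis by (rule order_trans[rotated])
next
  case False
  then have w: "live 0 w" using assms by (simp add: node_def)
  define k where "k = state 0 w"
  obtain n where n: "1/2 \<le> (\<Sum>m\<le>n. dead_mass k m)" using ex_dead_mass_ge_half by blast
  define I where "I = (\<Union>m\<le>n. deads k m)"
  have dead: "dead 0 (w @ v)" if "v \<in> I" for v
    using that w dead_append[of v 0 w] by (cases "v = []") (auto simp: I_def deads_def k_def)
  have "(\<Sum>v\<in>I. hausdorff_measure1 (emb (w @ v) ` square_bd)) \<le> hausdorff_measure1 (boundary \<inter> disc w)"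
  proof (rule hausdorff_measure1_separated)
    show "finite I" by (auto simp: I_def)
    show "0 < 20 * (rad w * rr ^ n)" by simp
    show "20 * (rad w * rr ^ n) \<le> dist x y"
      if v: "v \<in> I" "v' \<in> I" "v \<noteq> v'" and xy: "x \<in> emb (w @ v) ` square_bd" "y \<in> emb (w @ v') ` square_bd" for v v' x y
    proof -
      have "rr ^ n \<le> rr ^ length v" using v(1) by (intro power_decreasing) (auto simp: I_def deads_def)
      then have "rad w * rr ^ n \<le> rad (w @ v)" by (simp add: rad_def power_add)
      moreover have "20 * rad (w @ v) \<le> dist x y"
        using dead_far_from_dead(1)[OF dead[OF v(1)] dead[OF v(2)]] v(3) xy emb_square_subset_disc square_bd_subset
        by blast
      ultimately show ?thesis by simp
    qed
    show "emb (w @ v) ` square_bd \<subseteq> boundary \<inter> disc w" if "v \<in> I" for v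
    proof -
      have "disc (w @ v) \<subseteq> disc w" by (rule disc_prefix[OF _ node_dead[OF dead[OF that]]]) simp
      then show ?thesis using dead_square_bd_subset[OF dead[OF that]] by blast
    qed
  qed
  moreover have "ennreal (rad w / 4) \<le> (\<Sum>v\<in>I. hausdorff_measure1 (emb (w @ v) ` square_bd))"
  proof -
    have "(\<Sum>v\<in>I. rad (w @ v) / 2) = (\<Sum>m\<le>n. \<Sum>v\<in>deads k m. rad (w @ v) / 2)"
      unfolding I_def by (rule sum.UNION_disjoint) (simp, simp, auto simp: deads_def)
    also have "\<dots> = (\<Sum>m\<le>n. rad w / 2 * dead_mass k m)"
    proof (rule sum.cong)
      fix m
      have "(\<Sum>v\<in>deads k m. rad (w @ v) / 2) = (\<Sum>v\<in>deads k m. rad w / 2 * rr ^ m)"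
        by (intro sum.cong) (auto simp: deads_def rad_def power_add)
      then show "(\<Sum>v\<in>deads k m. rad (w @ v) / 2) = rad w / 2 * dead_mass k m" by (simp add: dead_mass_def)
    qed simp
    also have "\<dots> = rad w / 2 * (\<Sum>m\<le>n. dead_mass k m)" by (simp add: sum_distrib_left)
    finally have eq: "(\<Sum>v\<in>I. rad (w @ v) / 2) = rad w / 2 * (\<Sum>m\<le>n. dead_mass k m)" .
    have "rad w / 2 * (1/2) \<le> (\<Sum>v\<in>I. rad (w @ v) / 2)"
      unfolding eq by (rule mult_left_mono[OF n]) simp
    then have "ennreal (rad w / 4) \<le> ennreal (\<Sum>v\<in>I. rad (w @ v) / 2)" by (intro ennreal_leI) simp
    also have "\<dots> = (\<Sum>v\<in>I. ennreal (rad (w @ v) / 2))" by (intro sum_ennreal[symmetric]) simp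
    also have "\<dots> \<le> (\<Sum>v\<in>I. hausdorff_measure1 (emb (w @ v) ` square_bd))"
      by (intro sum_mono dead_square_measure_ge)
    finally show ?thesis .
  qed
  ultimately show ?thesis by (rule order_trans[rotated])
qed

lemma scale_index:
  assumes "0 < r" "r \<le> 1"
  obtains n where "rr ^ Suc n < r" "r \<le> rr ^ n"
proof -
  define m where "m = (LEAST m. rr ^ m < r)"
  obtain m0 where "rr ^ m0 < r" using real_arch_pow_inv[OF assms(1), of rr] by auto
  then have m: "rr ^ m < r" unfolding m_def by (rule LeastI)
  then have "m \<noteq> 0" using assms(2) by (cases m) auto
  then obtain n where n: "m = Suc n" by (cases m) auto
  then have "\<not> rr ^ n < r" using not_less_Least[of n "\<lambda>m. rr ^ m < r"] by (simp add: m_def)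
  then show ?thesis using that[of n] m n by auto
qed

text \<open>The dichotomy behind all estimates at scale \<open>rr ^ n\<close>: a boundary point sits
  on a square at least that large, or in a live disc of that size, with a node of the next
  generation for lower bounds.\<close>

lemma boundary_cases:
  assumes x: "x \<in> boundary"
  obtains w where "dead 0 w" "x \<in> emb w ` square_bd" "length w \<le> n"
  | w w' where "live 0 w" "length w = n" "x \<in> disc w" "node 0 w'" "length w' = Suc n" "x \<in> disc w'"
proof -
  have "\<exists>w w'. live 0 w \<and> length w = n \<and> x \<in> disc w \<and> node 0 w' \<and> length w' = Suc n \<and> x \<in> disc w'"
    if "node 0 v" "n < length v" "x \<in> disc v" for v
  proof -
    have "node 0 (take (Suc n) v)"
      using live_take[OF that(1), of "Suc n"] that node_live by (cases "Suc n < length v") auto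
    moreover have "live 0 (take n v)" by (rule live_take[OF that(1,2)])
    moreover have "x \<in> disc (take m v)" for m using disc_prefix[OF take_is_prefix that(1)] that(3) by blast
    ultimately show ?thesis using that(2)
      by (intro exI[of _ "take n v"] exI[of _ "take (Suc n) v"]) auto
  qed
  moreover consider "x \<in> cantor" | w where "dead 0 w" "x \<in> emb w ` square_bd"
    using x by (auto simp: boundary_def)
  then have "(\<exists>w. dead 0 w \<and> x \<in> emb w ` square_bd \<and> length w \<le> n) \<or>
      (\<exists>v. node 0 v \<and> n < length v \<and> x \<in> disc v)"
  proof cases
    case 1
    then obtain v where "live 0 v" "length v = Suc n" "x \<in> disc v"
      unfolding cantor_def level_def lives_def by blast
    then show ?thesis using node_live by (intro disjI2 exI[of _ v]) auto
  next
    case (2 w)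
    then have "x \<in> disc w" using emb_square_subset_disc square_bd_subset by blast
    then show ?thesis using 2 node_dead not_le by blast
  qed
  ultimately show ?thesis using that by blast
qed

lemma boundary_ball_subset_node:
  assumes "node 0 w" "x \<in> disc w" "r \<le> 20 * rad w"
  shows "boundary \<inter> ball x r \<subseteq> disc w"
  using solid_far_from_node[OF assms(1) _ _ assms(2)] boundary_subset_solid assms(3) by fastforce

lemma square_bd_ball_measure_ge:
  assumes x: "x \<in> emb w ` square_bd" and r: "0 < r" "r \<le> 2 * rad w"
  shows "ennreal (r / 8) \<le> hausdorff_measure1 (emb w ` square_bd \<inter> ball x r)"
proof -
  obtain i u where u: "i < 4" "u \<in> {- (rad w / 4)..rad w / 4}" "x = edge w i u"
    using x unfolding emb_square_bd_eq by blast
  \<comment> \<open>The segment is laid off towards the middle of the side, so it does not pass a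
    corner, as \<open>r / 8 \<le> rad w / 4\<close>.\<close>
  define a where "a = (if u \<le> 0 then u else u - r / 8)"
  have "edge w i ` {a..a + r / 8} \<subseteq> emb w ` square_bd \<inter> ball x r"
  proof (intro image_subsetI IntI)
    fix v assume v: "v \<in> {a..a + r / 8}"
    then have "v \<in> {- (rad w / 4)..rad w / 4}" using u(2) r by (auto simp: a_def split: if_splits)
    then show "edge w i v \<in> emb w ` square_bd" unfolding emb_square_bd_eq using u(1) by blast
    show "edge w i v \<in> ball x r"
      unfolding u(3) mem_ball dist_edge using v r by (auto simp: a_def split: if_splits)
  qed
  then have "ennreal (a + r / 8 - a) \<le> hausdorff_measure1 (emb w ` square_bd \<inter> ball x r)"
    by (rule edge_measure_ge)
  then show ?thesis by simp
qed

lemma boundary_ball_measure: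
  assumes x: "x \<in> boundary" and r: "0 < r" "r \<le> 2"
  shows "ennreal (r / 17600) \<le> hausdorff_measure1 (boundary \<inter> ball x r)"
    and "hausdorff_measure1 (boundary \<inter> ball x r) \<le> ennreal (17600 * r)"
proof -
  obtain n where n: "rr ^ Suc n < r / 2" "r / 2 \<le> rr ^ n"
    using scale_index[of "r / 2"] r by auto
  have "ennreal (r / 17600) \<le> hausdorff_measure1 (boundary \<inter> ball x r) \<and>
      hausdorff_measure1 (boundary \<inter> ball x r) \<le> ennreal (17600 * r)"
    using x
  proof (cases rule: boundary_cases[where n = n])
    case (1 w)
    have "rr ^ n \<le> rad w" unfolding rad_def using 1(3) by (intro power_decreasing) auto
    then have rw: "r \<le> 2 * rad w" using n(2) by simp
    have xw: "x \<in> disc w" using 1(2) emb_square_subset_disc square_bd_subset by blast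
    have "emb w ` square_bd \<inter> ball x r \<subseteq> boundary \<inter> ball x r" using 1(1) by (auto simp: boundary_def)
    then have "ennreal (r / 8) \<le> hausdorff_measure1 (boundary \<inter> ball x r)"
      using square_bd_ball_measure_ge[OF 1(2) r(1) rw] hausdorff_measure1_mono order_trans by blast
    moreover have "ennreal (r / 17600) \<le> ennreal (r / 8)" using r by (intro ennreal_leI) auto
    moreover have "boundary \<inter> ball x r \<subseteq> disc w"
      by (rule boundary_ball_subset_node[OF node_dead[OF 1(1)] xw]) (use rw rad_pos(1)[of w] in linarith)
    then have "boundary \<inter> ball x r \<subseteq> cantor \<union> (emb w ` square_bd \<inter> ball x r)"
      using boundary_dead_disc_subset[OF 1(1)] by blast
    then have "hausdorff_measure1 (boundary \<inter> ball x r) \<le> ennreal (16 * r)"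
      using hausdorff_measure1_mono hausdorff_measure1_cantor_Un square_bd_ball_measure_le[OF r(1)] order_trans by meson
    moreover have "ennreal (16 * r) \<le> ennreal (17600 * r)" using r by (intro ennreal_leI) auto
    ultimately show ?thesis by (meson order_trans)
  next
    case (2 w w')
    have "disc w' \<subseteq> ball x r"
    proof
      fix z assume "z \<in> disc w'"
      then have "dist x z \<le> 2 * rad w'"
        using 2(6) dist_triangle3[of x z "emb w' 0"] by (simp add: disc_eq)
      then show "z \<in> ball x r" using n(1) 2(5) by (simp add: rad_def)
    qed
    then have "ennreal (rad w' / 4) \<le> hausdorff_measure1 (boundary \<inter> ball x r)"
      using boundary_node_disc_measure_ge[OF 2(4)] hausdorff_measure1_mono[of "boundary \<inter> disc w'" "boundary \<inter> ball x r"]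
        order_trans by blast
    \<comment> \<open>The node \<open>w'\<close> has radius \<open>rr ^ n / 2200\<close>, at least
      \<open>r / 4400\<close>; a quarter of it gives the constant 17600.\<close>
    moreover have "ennreal (r / 17600) \<le> ennreal (rad w' / 4)"
      using n(2) 2(5) by (intro ennreal_leI) (simp add: rad_def, simp add: rr_def)
    moreover have "boundary \<inter> ball x r \<subseteq> boundary \<inter> disc w"
      using boundary_ball_subset_node[OF node_live[OF 2(1)] 2(3), of r] n(2) 2(2) r by (auto simp: rad_def)
    then have "hausdorff_measure1 (boundary \<inter> ball x r) \<le> ennreal (2 * rad w)"
      using boundary_node_disc_measure_le[OF node_live[OF 2(1)]] hausdorff_measure1_mono order_trans by blast
    moreover have "ennreal (2 * rad w) \<le> ennreal (17600 * r)"
      using n(1) 2(2) r by (intro ennreal_leI) (simp add: rad_def, simp add: rr_def)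
    ultimately show ?thesis by (meson order_trans)
  qed
  then show "ennreal (r / 17600) \<le> hausdorff_measure1 (boundary \<inter> ball x r)"
    "hausdorff_measure1 (boundary \<inter> ball x r) \<le> ennreal (17600 * r)" by auto
qed

lemma boundary_dist_le: "x \<in> boundary \<Longrightarrow> y \<in> boundary \<Longrightarrow> dist x y \<le> 2"
proof -
  assume "x \<in> boundary" "y \<in> boundary"
  then have "x \<in> cball 0 1" "y \<in> cball 0 1" using boundary_subset_solid solid_subset_cball by auto
  then show ?thesis using dist_triangle3[of x y 0] by simp
qed

lemma ediam_boundary_le: "ediam boundary \<le> ennreal 2"
  by (rule ediam_leI) (rule boundary_dist_le)

lemma ahlfors_regular1_boundary: "ahlfors_regular1 boundary"
  unfolding ahlfors_regular1_def
proof (intro conjI exI[of _ 17600] ballI allI impI)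
  have d: "dead 0 [100]" by simp
  have "emb [100] ` square_bd \<subseteq> boundary" using dead_square_bd_subset[OF d] by blast
  moreover have "edge [100] 0 ` {- (rad [100] / 4)..rad [100] / 4} \<subseteq> emb [100] ` square_bd"
    unfolding emb_square_bd_eq by (rule UN_upper) simp
  ultimately have "edge [100] 0 t \<in> boundary" if "t \<in> {- (rad [100] / 4)..rad [100] / 4}" for t
    using that by blast
  then have "edge [100] 0 0 \<in> boundary" "edge [100] 0 (rad [100] / 4) \<in> boundary" by auto
  then have "ennreal (dist (edge [100] 0 0) (edge [100] 0 (rad [100] / 4))) \<le> ediam boundary"
    by (intro dist_le_ediam)
  moreover have "0 < ennreal (dist (edge [100] 0 0) (edge [100] 0 (rad [100] / 4)))"
    unfolding dist_edge by simp
  ultimately show "0 < ediam boundary" by (rule order.strict_trans2[rotated])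
  fix x r assume xr: "x \<in> boundary" "(0::real) < r" "ennreal r < ediam boundary"
  then have "ennreal r \<le> ennreal 2" using ediam_boundary_le by (meson less_imp_le order_trans)
  then have "r \<le> 2" by (subst (asm) ennreal_le_iff) auto
  from boundary_ball_measure[OF xr(1,2) this]
  show "ennreal (r / 17600) \<le> hausdorff_measure1 (boundary \<inter> ball x r)"
    "hausdorff_measure1 (boundary \<inter> ball x r) \<le> ennreal (17600 * r)" .
qed simp

section \<open>Rectifiability\<close>

lemma lipschitz_graph_edge: "lipschitz_graph (range (edge w i))"
proof (cases "i < 2")
  case True
  have "range (edge w i) = range (\<lambda>t. 1 * Complex t (Im (edge w i 0)))"
  proof (intro equalityI subsetI)
    fix z assume "z \<in> range (edge w i)"
    then obtain u where "z = edge w i u" by blast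
    then have "z = Complex (Re (emb w 0) + u) (Im (edge w i 0))"
      using edge_coord(1,2)[OF True, of w u] by (simp add: complex_eq_iff)
    then show "z \<in> range (\<lambda>t. 1 * Complex t (Im (edge w i 0)))" by auto
  next
    fix z assume "z \<in> range (\<lambda>t. 1 * Complex t (Im (edge w i 0)))"
    then obtain t where "z = Complex t (Im (edge w i 0))" by auto
    then have "z = edge w i (t - Re (emb w 0))"
      using edge_coord(1,2)[OF True, of w "t - Re (emb w 0)"] by (simp add: complex_eq_iff)
    then show "z \<in> range (edge w i)" by blast
  qed
  then show ?thesis unfolding lipschitz_graph_def
    by (intro exI[of _ 1] exI[of _ "\<lambda>_. Im (edge w i 0)"] exI[of _ 0]) (auto intro: lipschitz_onI)
next
  case False
  have "range (edge w i) = range (\<lambda>t. \<i> * Complex t (- Re (edge w i 0)))"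
  proof (intro equalityI subsetI)
    fix z assume "z \<in> range (edge w i)"
    then obtain u where "z = edge w i u" by blast
    then have "z = \<i> * Complex (Im (emb w 0) + u) (- Re (edge w i 0))"
      using edge_coord(3,4)[OF False, of w u] by (simp add: complex_eq_iff)
    then show "z \<in> range (\<lambda>t. \<i> * Complex t (- Re (edge w i 0)))" by blast
  next
    fix z assume "z \<in> range (\<lambda>t. \<i> * Complex t (- Re (edge w i 0)))"
    then obtain t where "z = \<i> * Complex t (- Re (edge w i 0))" by auto
    then have "z = edge w i (t - Im (emb w 0))"
      using edge_coord(3,4)[OF False, of w "t - Im (emb w 0)"] by (simp add: complex_eq_iff)
    then show "z \<in> range (edge w i)" by blast
  qed
  then show ?thesis unfolding lipschitz_graph_def
    by (intro exI[of _ \<i>] exI[of _ "\<lambda>_. - Re (edge w i 0)"] exI[of _ 0]) (auto intro: lipschitz_onI)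
qed

lemma rectifiable1_boundary: "rectifiable1 boundary"
  unfolding rectifiable1_def
proof (intro exI[of _ "\<lambda>j. range (edge (fst (from_nat j :: nat list \<times> nat)) (snd (from_nat j :: nat list \<times> nat)))"] conjI allI)
  show "lipschitz_graph (range (edge w i))" for w i by (rule lipschitz_graph_edge)
  let ?G = "\<lambda>j. range (edge (fst (from_nat j :: nat list \<times> nat)) (snd (from_nat j :: nat list \<times> nat)))"
  have range: "range (edge w i) \<subseteq> (\<Union>j. ?G j)" for w i
  proof -
    have "?G (to_nat (w, i)) \<subseteq> (\<Union>j. ?G j)" by (rule UN_upper) simp
    then show ?thesis by (simp only: from_nat_to_nat fst_conv snd_conv)
  qed
  have "boundary - (\<Union>j. ?G j) \<subseteq> cantor"
  proof
    fix z assume z: "z \<in> boundary - (\<Union>j. ?G j)"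
    show "z \<in> cantor"
    proof (rule ccontr)
      assume "z \<notin> cantor"
      then obtain w where "z \<in> emb w ` square_bd" using z by (auto simp: boundary_def)
      then obtain i where "z \<in> range (edge w i)" unfolding emb_square_bd_eq by blast
      then show False using range[of w i] z by blast
    qed
  qed
  then have "hausdorff_measure1 (boundary - (\<Union>j. ?G j)) \<le> hausdorff_measure1 cantor"
    by (rule hausdorff_measure1_mono)
  then show "hausdorff_measure1 (boundary - (\<Union>j. ?G j)) = 0" by (simp only: cantor_measure_zero le_zero_eq)
qed

section \<open>Beta numbers\<close>

lemma beta_line_nonneg: "0 < r \<Longrightarrow> 0 \<le> beta_line S x r L"
  unfolding beta_line_def by (intro real_sqrt_ge_zero mult_nonneg_nonneg) auto

lemma beta_number_sq_le:
  fixes S :: "'a::euclidean_space set"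
  assumes r: "0 < r" and L: "affine L" "aff_dim L = 1"
    and B: "(\<integral>\<^sup>+t\<in>{0..1}. (hausdorff_content1 {y \<in> ball x r \<inter> S. infdist y L > t * r} * ennreal t) \<partial>lborel) \<le> ennreal B"
    and "0 \<le> B"
  shows "(beta_number S x r)\<^sup>2 \<le> B / r"
proof -
  have bb: "bdd_below (beta_line S x r ` {L. affine L \<and> aff_dim L = 1})"
    using beta_line_nonneg[OF r] by (intro bdd_belowI2[of _ 0]) auto
  have "0 \<le> beta_number S x r"
    unfolding beta_number_def using L beta_line_nonneg[OF r] by (intro cINF_greatest) auto
  moreover have "beta_number S x r \<le> beta_line S x r L"
    unfolding beta_number_def using L by (intro cINF_lower bb) auto
  ultimately have "(beta_number S x r)\<^sup>2 \<le> (beta_line S x r L)\<^sup>2" by (intro power_mono)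
  also have "\<dots> = 1 / r * enn2real (\<integral>\<^sup>+t\<in>{0..1}. (hausdorff_content1 {y \<in> ball x r \<inter> S. infdist y L > t * r} * ennreal t) \<partial>lborel)"
    unfolding beta_line_def using r by (intro real_sqrt_pow2 mult_nonneg_nonneg) auto
  also have "\<dots> \<le> 1 / r * B"
    using enn2real_mono[OF B] \<open>0 \<le> B\<close> r by (intro mult_left_mono) auto
  finally show ?thesis by simp
qed

lemma ex_line: "\<exists>L :: complex set. affine L \<and> aff_dim L = 1 \<and> 0 \<in> L"
  by (intro exI[of _ "affine hull {0, 1}"]) (auto simp: hull_inc)

lemma beta_number_sq_le_2:
  fixes S :: "complex set"
  assumes r: "0 < r" shows "(beta_number S x r)\<^sup>2 \<le> 2"
proof -
  obtain L :: "complex set" where L: "affine L" "aff_dim L = 1" using ex_line by blast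
  have "hausdorff_content1 {y \<in> ball x r \<inter> S. infdist y L > t * r} \<le> ennreal (2 * r)" for t
  proof -
    have "ediam {y \<in> ball x r \<inter> S. infdist y L > t * r} \<le> ennreal (2 * r)"
    proof (rule ediam_leI)
      fix y z assume "y \<in> {y \<in> ball x r \<inter> S. infdist y L > t * r}" "z \<in> {y \<in> ball x r \<inter> S. infdist y L > t * r}"
      then show "dist y z \<le> 2 * r" using dist_triangle3[of y z x] by auto
    qed
    then show ?thesis using hausdorff_content1_le_ediam order_trans by blast
  qed
  then have "(\<integral>\<^sup>+t\<in>{0..1}. (hausdorff_content1 {y \<in> ball x r \<inter> S. infdist y L > t * r} * ennreal t) \<partial>lborel)
      \<le> (\<integral>\<^sup>+t. ennreal (2 * r) * indicator {0..1::real} t \<partial>lborel)"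
  proof (intro nn_integral_mono)
    fix t :: real
    have "hausdorff_content1 {y \<in> ball x r \<inter> S. infdist y L > t * r} * ennreal t \<le> ennreal (2 * r) * 1" if "t \<in> {0..1}"
      using that by (intro mult_mono \<open>\<And>t. hausdorff_content1 _ \<le> ennreal (2 * r)\<close>) auto
    then show "hausdorff_content1 {y \<in> ball x r \<inter> S. infdist y L > t * r} * ennreal t * indicator {0..1} t
        \<le> ennreal (2 * r) * indicator {0..1} t" by (auto simp: indicator_def)
  qed
  also have "\<dots> = ennreal (2 * r)" by (subst nn_integral_cmult_indicator) auto
  finally have "(beta_number S x r)\<^sup>2 \<le> 2 * r / r"
    by (rule beta_number_sq_le[OF r L]) (use r in simp)
  then show ?thesis using r by simp
qed

lemma beta_number_eq_0:
  fixes S :: "complex set"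
  assumes r: "0 < r" and L: "affine L" "aff_dim L = 1" "S \<inter> ball x r \<subseteq> L"
  shows "(beta_number S x r)\<^sup>2 = 0"
proof -
  have "hausdorff_content1 {y \<in> ball x r \<inter> S. infdist y L > t * r} * ennreal t * indicator {0..1} t = 0" for t
  proof (cases "t \<in> {0..1}")
    case True
    then have "{y \<in> ball x r \<inter> S. infdist y L > t * r} = {}" using L(3) r by (auto simp: not_less)
    then show ?thesis by (simp only: hausdorff_content1_empty mult_zero_left)
  qed simp
  then have "(\<integral>\<^sup>+t\<in>{0..1}. (hausdorff_content1 {y \<in> ball x r \<inter> S. infdist y L > t * r} * ennreal t) \<partial>lborel) = (\<integral>\<^sup>+t. 0 \<partial>(lborel :: real measure))"
    by (intro nn_integral_cong)
  then have "(\<integral>\<^sup>+t\<in>{0..1}. (hausdorff_content1 {y \<in> ball x r \<inter> S. infdist y L > t * r} * ennreal t) \<partial>lborel) \<le> ennreal 0"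
    by simp
  then have "(beta_number S x r)\<^sup>2 \<le> 0 / r" by (rule beta_number_sq_le[OF r L(1,2)]) simp
  then show ?thesis by simp
qed

text \<open>A line through 0 is within 1 of the boundary, so the integral stops at
  \<open>t = 1 / r\<close>, where the integrand is still at most \<open>2 / r\<close>. The third
  power makes the coarse generations summable.\<close>

lemma beta_number_boundary_large:
  assumes r: "1 \<le> r" shows "(beta_number boundary x r)\<^sup>2 \<le> 2 / r ^ 3"
proof -
  have r0: "0 < r" using r by simp
  obtain L :: "complex set" where L: "affine L" "aff_dim L = 1" "0 \<in> L" using ex_line by blast
  have c: "hausdorff_content1 {y \<in> ball x r \<inter> boundary. infdist y L > t * r} \<le> ennreal 2" for t
  proof -
    have "ediam {y \<in> ball x r \<inter> boundary. infdist y L > t * r} \<le> ediam boundary" by (rule ediam_mono) auto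
    then show ?thesis using hausdorff_content1_le_ediam ediam_boundary_le order_trans by meson
  qed
  have e: "{y \<in> ball x r \<inter> boundary. infdist y L > t * r} = {}" if "1 / r \<le> t" for t
  proof -
    have "1 \<le> t * r" using that r by (simp add: divide_le_eq)
    moreover have "infdist y L \<le> 1" if "y \<in> boundary" for y
      using infdist_le[OF L(3), of y] that boundary_subset_solid solid_subset_cball by fastforce
    ultimately show ?thesis by force
  qed
  have "(\<integral>\<^sup>+t\<in>{0..1}. (hausdorff_content1 {y \<in> ball x r \<inter> boundary. infdist y L > t * r} * ennreal t) \<partial>lborel)
      \<le> (\<integral>\<^sup>+t. ennreal (2 * (1 / r)) * indicator {0..1 / r} t \<partial>lborel)"
  proof (intro nn_integral_mono)
    fix t :: real
    show "hausdorff_content1 {y \<in> ball x r \<inter> boundary. infdist y L > t * r} * ennreal t * indicator {0..1} t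
        \<le> ennreal (2 * (1 / r)) * indicator {0..1 / r} t"
    proof (cases "0 \<le> t \<and> t < 1 / r")
      case True
      have "hausdorff_content1 {y \<in> ball x r \<inter> boundary. infdist y L > t * r} * ennreal t \<le> ennreal 2 * ennreal (1 / r)"
        using True by (intro mult_mono c ennreal_leI) auto
      also have "\<dots> = ennreal (2 * (1 / r))" using r by (intro ennreal_mult[symmetric]) auto
      finally show ?thesis using True by (auto simp: indicator_def)
    next
      case False
      then consider "t < 0" | "1 / r \<le> t" by linarith
      then show ?thesis
      proof cases
        case 2
        show ?thesis by (simp only: e[OF 2] hausdorff_content1_empty mult_zero_left zero_le)
      qed simp
    qed
  qed
  also have "\<dots> = ennreal (2 * (1 / r)) * ennreal (1 / r)"
    using r by (subst nn_integral_cmult_indicator) auto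
  also have "\<dots> = ennreal (2 * (1 / r) * (1 / r))" using r by (intro ennreal_mult[symmetric]) auto
  finally have "(beta_number boundary x r)\<^sup>2 \<le> 2 * (1 / r) * (1 / r) / r"
    by (rule beta_number_sq_le[OF r0 L(1,2)]) (use r in auto)
  then show ?thesis by (simp add: power3_eq_cube)
qed

section \<open>Flatness away from corners\<close>

lemma edge_Re: "Re (edge w i u) = Re (emb w 0) + (if i < 2 then u else if i = 2 then rad w / 4 else - (rad w / 4))"
  and edge_Im: "Im (edge w i u) = Im (emb w 0) + (if i = 0 then rad w / 4 else if i = 1 then - (rad w / 4) else u)"
proof -
  have "edge w i u = emb w 0 + of_real (rad w) * side i (u / rad w)"
    unfolding edge_def by (rule emb_affine)
  then show "Re (edge w i u) = Re (emb w 0) + (if i < 2 then u else if i = 2 then rad w / 4 else - (rad w / 4))"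
    "Im (edge w i u) = Im (emb w 0) + (if i = 0 then rad w / 4 else if i = 1 then - (rad w / 4) else u)"
    by (auto simp: side_def)
qed

lemma edge_same_side:
  assumes ij: "i < 4" "j < 4" and u: "\<bar>u\<bar> + R \<le> rad w / 4"
    and d: "dist (edge w i u) (edge w j v) < R"
  shows "i = j"
proof (rule ccontr)
  assume ne: "i \<noteq> j"
  have re: "\<bar>Re (edge w i u) - Re (edge w j v)\<bar> < R"
    using abs_Re_le_cmod[of "edge w i u - edge w j v"] d by (simp add: dist_norm)
  have im: "\<bar>Im (edge w i u) - Im (edge w j v)\<bar> < R"
    using abs_Im_le_cmod[of "edge w i u - edge w j v"] d by (simp add: dist_norm)
  have u': "u + R \<le> rad w / 4" "R - u \<le> rad w / 4" using u by linarith+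
  have i: "i = 0 \<or> i = 1 \<or> i = 2 \<or> i = 3" and j: "j = 0 \<or> j = 1 \<or> j = 2 \<or> j = 3" using ij by auto
  show False
    using re[unfolded edge_Re abs_less_iff] im[unfolded edge_Im abs_less_iff] u' i j ne
    by (elim disjE) simp_all
qed

lemma edge_in_line: "edge w i u \<in> affine hull {edge w i 0, edge w i 1}"
proof -
  have "edge w i u = (1 - u) *\<^sub>R edge w i 0 + u *\<^sub>R edge w i 1"
    by (simp add: complex_eq_iff edge_Re edge_Im algebra_simps)
  moreover have "(1 - u) + u = 1" by simp
  ultimately show ?thesis unfolding affine_hull_2 by blast
qed

lemma cantor_Int_dead_disc: "dead 0 w \<Longrightarrow> cantor \<inter> disc w = {}"
proof (rule ccontr)
  assume w: "dead 0 w" and "cantor \<inter> disc w \<noteq> {}"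
  then obtain z where z: "z \<in> cantor" "z \<in> disc w" by blast
  then obtain w' where w': "live 0 w'" "length w' = length w" "z \<in> disc w'"
    unfolding cantor_def level_def lives_def by blast
  then have "prefix w w' \<or> prefix w' w"
    using node_disc_inter[OF node_dead[OF w] node_live[OF w'(1)] z(2) w'(3)] by simp
  then have "w = w'" using w'(2) by (auto simp: prefix_def)
  then show False using w w'(1) dead_not_live by blast
qed

definition collinear_at :: "complex \<Rightarrow> real \<Rightarrow> bool" where
  "collinear_at x R \<longleftrightarrow> (\<exists>L. affine L \<and> aff_dim L = 1 \<and> boundary \<inter> ball x R \<subseteq> L)"

text \<open>Each corner occurs twice, as an end of two sides; this only affects constants.\<close>

definition corner :: "nat list \<Rightarrow> nat \<Rightarrow> bool \<Rightarrow> complex" where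
  "corner w i b = edge w i (if b then rad w / 4 else - (rad w / 4))"

text \<open>Within 20 radii only the square itself is visible, and a ball that fits over the middle
  of a side meets no other side. A non-flat ball therefore reaches an end of the side.\<close>

lemma not_collinear_near_corner:
  assumes w: "dead 0 w" and x: "x \<in> emb w ` square_bd" and R: "0 < R" "R \<le> 20 * rad w"
    and nc: "\<not> collinear_at x R"
  shows "\<exists>i<4. \<exists>b. dist x (corner w i b) < R"
proof -
  obtain i u where u: "i < 4" "u \<in> {- (rad w / 4)..rad w / 4}" "x = edge w i u"
    using x unfolding emb_square_bd_eq by blast
  have xw: "x \<in> disc w" using x emb_square_subset_disc square_bd_subset by blast
  show ?thesis
  proof (cases "\<bar>u\<bar> + R \<le> rad w / 4")
    case True
    have "boundary \<inter> ball x R \<subseteq> affine hull {edge w i 0, edge w i 1}"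
    proof
      fix y assume y: "y \<in> boundary \<inter> ball x R"
      then have "y \<in> disc w" using boundary_ball_subset_node[OF node_dead[OF w] xw R(2)] by blast
      then have "y \<in> emb w ` square_bd"
        using boundary_dead_disc_subset[OF w] cantor_Int_dead_disc[OF w] y by blast
      then obtain j v where v: "j < 4" "v \<in> {- (rad w / 4)..rad w / 4}" "y = edge w j v"
        unfolding emb_square_bd_eq by blast
      have "i = j"
        using edge_same_side[OF u(1) v(1) True] v(3) y u(3) by auto
      then show "y \<in> affine hull {edge w i 0, edge w i 1}" using edge_in_line v(3) by simp
    qed
    moreover have "edge w i 0 \<noteq> edge w i 1" using dist_edge[of w i 0 1] by auto
    ultimately have "collinear_at x R"
      unfolding collinear_at_def by (intro exI[of _ "affine hull {edge w i 0, edge w i 1}"]) auto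
    then show ?thesis using nc by blast
  next
    case False
    then have "dist x (corner w i (0 \<le> u)) < R"
      using u by (auto simp: corner_def dist_edge)
    then show ?thesis using u(1) by blast
  qed
qed

text \<open>Packing: lower regularity gives each point its own piece of the boundary of length at
  least \<open>t / 17600\<close>, and the pieces are separated subsets of \<open>Y\<close>.\<close>

lemma separated_card_le:
  assumes P: "finite P" "P \<subseteq> boundary" and t: "0 < t" "t \<le> 2"
    and sep: "\<And>x y. x \<in> P \<Longrightarrow> y \<in> P \<Longrightarrow> x \<noteq> y \<Longrightarrow> 3 * t \<le> dist x y"
    and Y: "\<And>x. x \<in> P \<Longrightarrow> boundary \<inter> ball x t \<subseteq> Y" and M: "hausdorff_measure1 Y \<le> ennreal M" "0 \<le> M"
  shows "real (card P) * t \<le> 17600 * M"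
proof -
  have "ennreal (real (card P) * (t / 17600)) = (\<Sum>x\<in>P. ennreal (t / 17600))"
    using t by (simp add: ennreal_of_nat_eq_real_of_nat flip: ennreal_mult)
  also have "\<dots> \<le> (\<Sum>x\<in>P. hausdorff_measure1 (boundary \<inter> ball x t))"
    using P(2) t by (intro sum_mono boundary_ball_measure(1)) auto
  also have "\<dots> \<le> hausdorff_measure1 Y"
  proof (rule hausdorff_measure1_separated[OF P(1) t(1)])
    fix x y a b assume xy: "x \<in> P" "y \<in> P" "x \<noteq> y" and ab: "a \<in> boundary \<inter> ball x t" "b \<in> boundary \<inter> ball y t"
    then show "t \<le> dist a b"
      using sep[OF xy] dist_triangle[of x y a] dist_triangle[of a y b] by (auto simp: dist_commute)
  qed (use Y in blast)
  also note M(1)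
  finally show ?thesis using M(2) t by (subst (asm) ennreal_le_iff) auto
qed

text \<open>Arises from the corners of squares of all depths \<open>m \<le> n\<close>, seen at scale
  \<open>rr ^ n\<close>. The sequence with ratio \<open>rr\<close> decays so fast that the
  convolution costs only a constant.\<close>

lemma geometric_mix: "(\<Sum>m\<le>n. (25/44) ^ m * rr ^ (n - m)) \<le> 2 * (25/44) ^ n"
proof (induction n)
  case (Suc n)
  have "(\<Sum>m\<le>Suc n. (25/44) ^ m * rr ^ (Suc n - m)) = (\<Sum>m\<le>n. rr * ((25/44) ^ m * rr ^ (n - m))) + (25/44) ^ Suc n"
    by (simp add: Suc_diff_le mult_ac)
  also have "(\<Sum>m\<le>n. rr * ((25/44) ^ m * rr ^ (n - m))) = rr * (\<Sum>m\<le>n. (25/44) ^ m * rr ^ (n - m))"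
    by (rule sum_distrib_left[symmetric])
  also have "\<dots> \<le> rr * (2 * (25/44) ^ n)" using Suc by (intro mult_left_mono) auto
  also have "\<dots> \<le> (25/44) ^ Suc n" by (simp add: rr_def)
  finally show ?case by simp
qed simp

lemma card_deads_le: "real (card (deads 0 m)) * rr ^ m \<le> 44/25 * (25/44) ^ m"
proof (cases m)
  case 0
  then show ?thesis using dead_mass_0[of 0] by (simp add: dead_mass_def)
next
  case (Suc j)
  have "dead_mass 0 (Suc j) \<le> live_mass 0 j" using mass_split[of 0 j] mass_nonneg(1)[of 0 "Suc j"] by linarith
  also have "\<dots> \<le> (25/44) ^ j" using live_mass_le[of 0 j] by simp
  finally show ?thesis by (simp add: Suc dead_mass_def)
qed

text \<open>The set contains a neighbourhood of all boundary points that are non-collinear at scale \<open>R\<close>.\<close>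

lemma bad_set_measure:
  assumes R: "0 < R" "R / 2 \<le> rr ^ n"
  shows "hausdorff_measure1 ((\<Union>w\<in>lives 0 n. boundary \<inter> disc w) \<union>
      (\<Union>m\<le>n. \<Union>w\<in>deads 0 m. \<Union>(i, b)\<in>{..<4} \<times> UNIV. emb w ` square_bd \<inter> ball (corner w i b) (2 * R)))
    \<le> ennreal (2000 * (25/44) ^ n)"
proof -
  have A: "hausdorff_measure1 (\<Union>w\<in>lives 0 n. boundary \<inter> disc w) \<le> ennreal (2 * (25/44) ^ n)"
  proof -
    have "hausdorff_measure1 (\<Union>w\<in>lives 0 n. boundary \<inter> disc w) \<le> (\<Sum>w\<in>lives 0 n. hausdorff_measure1 (boundary \<inter> disc w))"
      by (rule hausdorff_measure1_UN) simp
    also have "\<dots> \<le> (\<Sum>w\<in>lives 0 n. ennreal (2 * rr ^ n))"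
    proof (rule sum_mono)
      fix w assume "w \<in> lives 0 n"
      then show "hausdorff_measure1 (boundary \<inter> disc w) \<le> ennreal (2 * rr ^ n)"
        using boundary_node_disc_measure_le[OF node_live, of w] by (simp add: lives_def rad_def)
    qed
    also have "\<dots> = ennreal (2 * live_mass 0 n)"
      by (simp add: live_mass_def ennreal_of_nat_eq_real_of_nat mult_ac flip: ennreal_mult)
    also have "\<dots> \<le> ennreal (2 * (25/44) ^ n)" using live_mass_le[of 0 n] by (intro ennreal_leI) simp
    finally show ?thesis .
  qed
  \<comment> \<open>Four sides with two ends each, and length \<open>16 * (2 * R)\<close> per
    ball.\<close>
  have one: "hausdorff_measure1 (\<Union>(i, b)\<in>{..<4} \<times> UNIV. emb w ` square_bd \<inter> ball (corner w i b) (2 * R)) \<le> ennreal (256 * R)" for w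
  proof -
    have "hausdorff_measure1 (\<Union>(i, b)\<in>{..<4} \<times> UNIV. emb w ` square_bd \<inter> ball (corner w i b) (2 * R))
        \<le> (\<Sum>p\<in>{..<4::nat} \<times> (UNIV::bool set). hausdorff_measure1 (emb w ` square_bd \<inter> ball (corner w (fst p) (snd p)) (2 * R)))"
      unfolding case_prod_unfold by (rule hausdorff_measure1_UN) simp
    also have "\<dots> \<le> (\<Sum>p\<in>{..<4::nat} \<times> (UNIV::bool set). ennreal (16 * (2 * R)))"
      using R by (intro sum_mono square_bd_ball_measure_le) simp
    also have "\<dots> = ennreal (\<Sum>p\<in>{..<4::nat} \<times> (UNIV::bool set). 16 * (2 * R))"
      by (rule sum_ennreal) (use R in simp)
    also have "(\<Sum>p\<in>{..<4::nat} \<times> (UNIV::bool set). 16 * (2 * R)) = 256 * R"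
      by (simp add: card_cartesian_product)
    finally show ?thesis .
  qed
  have B: "hausdorff_measure1 (\<Union>m\<le>n. \<Union>w\<in>deads 0 m. \<Union>(i, b)\<in>{..<4} \<times> UNIV. emb w ` square_bd \<inter> ball (corner w i b) (2 * R))
      \<le> ennreal (1804 * (25/44) ^ n)"
  proof -
    have "hausdorff_measure1 (\<Union>m\<le>n. \<Union>w\<in>deads 0 m. \<Union>(i, b)\<in>{..<4} \<times> UNIV. emb w ` square_bd \<inter> ball (corner w i b) (2 * R))
        \<le> (\<Sum>m\<le>n. \<Sum>w\<in>deads 0 m. hausdorff_measure1 (\<Union>(i, b)\<in>{..<4} \<times> UNIV. emb w ` square_bd \<inter> ball (corner w i b) (2 * R)))"
      by (intro order_trans[OF hausdorff_measure1_UN] sum_mono hausdorff_measure1_UN) auto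
    also have "\<dots> \<le> (\<Sum>m\<le>n. \<Sum>w\<in>deads 0 m. ennreal (256 * R))" by (intro sum_mono one)
    also have "\<dots> = (\<Sum>m\<le>n. ennreal (real (card (deads 0 m)) * (256 * R)))"
      using R by (simp add: ennreal_of_nat_eq_real_of_nat flip: ennreal_mult)
    also have "\<dots> = ennreal (\<Sum>m\<le>n. real (card (deads 0 m)) * (256 * R))"
      by (rule sum_ennreal) (use R in simp)
    also have "\<dots> \<le> ennreal (1804 * (25/44) ^ n)"
    proof (rule ennreal_leI)
      have "(\<Sum>m\<le>n. real (card (deads 0 m)) * (256 * R)) \<le> (\<Sum>m\<le>n. 902 * ((25/44) ^ m * rr ^ (n - m)))"
      proof (rule sum_mono)
        fix m assume m: "m \<in> {..n}"
        have "real (card (deads 0 m)) * (256 * R) \<le> real (card (deads 0 m)) * (256 * (2 * rr ^ n))"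
          using R by (intro mult_left_mono) auto
        also have "rr ^ n = rr ^ m * rr ^ (n - m)" using m by (simp flip: power_add)
        also have "real (card (deads 0 m)) * (256 * (2 * (rr ^ m * rr ^ (n - m))))
            = 512 * rr ^ (n - m) * (real (card (deads 0 m)) * rr ^ m)" by simp
        also have "\<dots> \<le> 512 * rr ^ (n - m) * (44/25 * (25/44) ^ m)"
          by (intro mult_left_mono card_deads_le) simp
        also have "\<dots> = 512 * (44/25) * ((25/44) ^ m * rr ^ (n - m))" by simp
        also have "\<dots> \<le> 902 * ((25/44) ^ m * rr ^ (n - m))" by (intro mult_right_mono) auto
        finally show "real (card (deads 0 m)) * (256 * R) \<le> 902 * ((25/44) ^ m * rr ^ (n - m))" .
      qed
      also have "\<dots> = 902 * (\<Sum>m\<le>n. (25/44) ^ m * rr ^ (n - m))" by (rule sum_distrib_left[symmetric])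
      also have "\<dots> \<le> 902 * (2 * (25/44) ^ n)" by (intro mult_left_mono geometric_mix) simp
      finally show "(\<Sum>m\<le>n. real (card (deads 0 m)) * (256 * R)) \<le> 1804 * (25/44) ^ n" by simp
    qed
    finally show ?thesis .
  qed
  have "ennreal (2 * (25/44) ^ n) + ennreal (1804 * (25/44) ^ n) = ennreal (1806 * (25/44) ^ n)"
    by (simp flip: ennreal_plus)
  also have "\<dots> \<le> ennreal (2000 * (25/44) ^ n)" by (intro ennreal_leI) simp
  finally show ?thesis using order_trans[OF hausdorff_measure1_Un add_mono[OF A B]] order_trans by blast
qed

text \<open>For a net of mesh \<open>t\<close> the tripled cube ball has radius
  \<open>15 * t\<close>. Balls of radius \<open>t / 4\<close> around the non-flat points meet the
  boundary only in the bad set, so packing turns its measure into a count.\<close>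

lemma noncollinear_card_le:
  assumes P: "finite P" "P \<subseteq> boundary" and t: "0 < t" "15 * t / 2 \<le> rr ^ n"
    and sep: "\<And>x y. x \<in> P \<Longrightarrow> y \<in> P \<Longrightarrow> x \<noteq> y \<Longrightarrow> t \<le> dist x y"
    and nc: "\<And>x. x \<in> P \<Longrightarrow> \<not> collinear_at x (15 * t)"
  shows "real (card P) * t \<le> 140800000 * (25/44) ^ n"
proof -
  define Y where "Y = (\<Union>w\<in>lives 0 n. boundary \<inter> disc w) \<union>
      (\<Union>m\<le>n. \<Union>w\<in>deads 0 m. \<Union>(i, b)\<in>{..<4} \<times> UNIV. emb w ` square_bd \<inter> ball (corner w i b) (2 * (15 * t)))"
  have "rr ^ n \<le> 1" by (rule power_le_one) (simp_all add: rr_def)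
  then have t4: "t / 4 \<le> 2" using t by linarith
  have Y: "boundary \<inter> ball x (t / 4) \<subseteq> Y" if x: "x \<in> P" for x
  proof -
    have xb: "x \<in> boundary" using x P(2) by blast
    from xb show ?thesis
    proof (cases rule: boundary_cases[of x n])
      case (1 w)
      have "rr ^ n \<le> rad w"
        unfolding rad_def using 1(3) by (intro power_decreasing) (simp_all add: rr_def)
      then have R: "15 * t \<le> 20 * rad w" using t by linarith
      obtain i b where ib: "i < 4" "dist x (corner w i b) < 15 * t"
        using not_collinear_near_corner[OF 1(1,2) _ R nc[OF x]] t(1) by auto
      have xw: "x \<in> disc w" using 1(2) emb_square_subset_disc square_bd_subset by blast
      show ?thesis
      proof
        fix y assume y: "y \<in> boundary \<inter> ball x (t / 4)"
        then have yR: "y \<in> boundary \<inter> ball x (15 * t)" using t(1) by auto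
        then have "y \<in> disc w" using boundary_ball_subset_node[OF node_dead[OF 1(1)] xw R] by blast
        then have "y \<in> emb w ` square_bd"
          using boundary_dead_disc_subset[OF 1(1)] cantor_Int_dead_disc[OF 1(1)] y by blast
        moreover have "dist (corner w i b) y < 2 * (15 * t)"
          using ib(2) yR dist_triangle3[of "corner w i b" y x] by simp
        ultimately have "y \<in> emb w ` square_bd \<inter> ball (corner w i b) (2 * (15 * t))" by simp
        moreover have "w \<in> deads 0 (length w)" using 1(1) by (simp add: deads_def)
        ultimately show "y \<in> Y"
          unfolding Y_def using ib(1) 1(3)
          by (intro UnI2 UN_I[of "length w"] UN_I[of w] UN_I[of "(i, b)"]) auto
      qed
    next
      case (2 w w')
      have "t / 4 \<le> 20 * rad w" using t 2(2) unfolding rad_def by simp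
      then have "boundary \<inter> ball x (t / 4) \<subseteq> disc w"
        by (rule boundary_ball_subset_node[OF node_live[OF 2(1)] 2(3)])
      moreover have "w \<in> lives 0 n" using 2(1,2) by (simp add: lives_def)
      ultimately show ?thesis unfolding Y_def by blast
    qed
  qed
  have "real (card P) * (t / 4) \<le> 17600 * (2000 * (25/44) ^ n)"
  proof (rule separated_card_le[OF P])
    show "3 * (t / 4) \<le> dist x y" if "x \<in> P" "y \<in> P" "x \<noteq> y" for x y
      using sep[OF that] t(1) by linarith
    show "hausdorff_measure1 Y \<le> ennreal (2000 * (25/44) ^ n)"
      unfolding Y_def using t by (intro bad_set_measure) auto
  qed (use Y t(1) t4 in auto)
  then show ?thesis by simp
qed

text \<open>The exponent 14 is chosen so that \<open>(25/44) ^ 14 \<le> rr\<close> and \<open>1/1000 \<le> (2/3) ^ 14\<close>.\<close>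

lemma mass_decay_in_scale:
  assumes t: "rr ^ Suc n < 15 * t / 2" "t \<le> (1/1000) ^ k"
  shows "(25/44) ^ n \<le> 3 * (2/3 :: real) ^ k"
proof -
  have "((25/44 :: real) ^ n) ^ Suc 13 = ((25/44) ^ 14) ^ n" by (simp flip: power_mult add: mult.commute)
  also have "\<dots> \<le> rr ^ n" by (intro power_mono) (simp_all add: rr_def power_divide)
  \<comment> \<open>One division by \<open>rr\<close> recovers \<open>rr ^ n\<close>:
    \<open>16500 = 2200 * 15 / 2\<close>.\<close>
  also have "\<dots> \<le> 16500 * t" using t(1) by (simp add: rr_def)
  also have "\<dots> \<le> 16500 * (1/1000) ^ k" using t(2) by simp
  also have "\<dots> \<le> 3 ^ 14 * ((2/3) ^ 14) ^ k" by (intro mult_mono power_mono) (simp_all add: power_divide)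
  also have "\<dots> = (3 * (2/3) ^ k) ^ Suc 13" by (simp add: power_mult_distrib mult.commute flip: power_mult)
  finally show ?thesis by (rule power_le_imp_le_base) simp
qed

text \<open>Flat points contribute 0 and every other one at most \<open>2 * (5 * t)\<close>, so the
  count of non-flat points decides.\<close>

lemma beta_generation_fine:
  assumes P: "finite P" "P \<subseteq> boundary" and t: "0 < t" "t \<le> (1/1000) ^ k" "0 < k"
    and sep: "\<And>x y. x \<in> P \<Longrightarrow> y \<in> P \<Longrightarrow> x \<noteq> y \<Longrightarrow> t \<le> dist x y"
  shows "(\<Sum>x\<in>P. (beta_number boundary x (15 * t))\<^sup>2 * (5 * t)) \<le> 10 ^ 10 * (2/3) ^ k"
proof -
  have "(1/1000 :: real) ^ k \<le> (1/1000) ^ 1" using t(3) by (intro power_decreasing) auto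
  then have "15 * t / 2 \<le> 1" using t(2) by simp
  then obtain n where n: "rr ^ Suc n < 15 * t / 2" "15 * t / 2 \<le> rr ^ n"
    using scale_index[of "15 * t / 2"] t(1) by auto
  define P' where "P' = {x \<in> P. \<not> collinear_at x (15 * t)}"
  have P': "finite P'" "P' \<subseteq> P" using P by (auto simp: P'_def)
  have "(\<Sum>x\<in>P. (beta_number boundary x (15 * t))\<^sup>2 * (5 * t)) = (\<Sum>x\<in>P'. (beta_number boundary x (15 * t))\<^sup>2 * (5 * t))"
  proof (rule sum.mono_neutral_right[OF P(1) P'(2)], rule ballI)
    fix x assume "x \<in> P - P'"
    then obtain L where L: "affine L" "aff_dim L = 1" "boundary \<inter> ball x (15 * t) \<subseteq> L"
      by (auto simp: P'_def collinear_at_def)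
    have "(beta_number boundary x (15 * t))\<^sup>2 = 0" by (rule beta_number_eq_0[OF _ L]) (use t in simp)
    then show "(beta_number boundary x (15 * t))\<^sup>2 * (5 * t) = 0" by simp
  qed
  also have "\<dots> \<le> (\<Sum>x\<in>P'. 2 * (5 * t))"
    using t by (intro sum_mono mult_right_mono beta_number_sq_le_2) auto
  also have "\<dots> = 10 * (real (card P') * t)" by simp
  also have "\<dots> \<le> 10 * (140800000 * (25/44) ^ n)"
  proof (intro mult_left_mono noncollinear_card_le[OF P'(1) _ t(1) n(2)])
    show "P' \<subseteq> boundary" using P P' by blast
    show "t \<le> dist x y" if "x \<in> P'" "y \<in> P'" "x \<noteq> y" for x y using sep that P' by blast
  qed (auto simp: P'_def)
  also have "\<dots> \<le> 10 * (140800000 * (3 * (2/3) ^ k))"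
    by (intro mult_left_mono mass_decay_in_scale[OF n(1) t(2)]) auto
  also have "\<dots> \<le> 10 ^ 10 * (2/3) ^ k" by simp
  finally show ?thesis .
qed

text \<open>A net of mesh at least 1 has boundedly many points, and a term decays like
  \<open>1 / t ^ 2\<close>; one factor \<open>1 / t\<close> supplies the geometric rate.\<close>

lemma beta_generation_coarse:
  assumes P: "finite P" "P \<subseteq> boundary" and t: "1 \<le> t" "1 / t \<le> (1/1000) ^ k"
    and sep: "\<And>x y. x \<in> P \<Longrightarrow> y \<in> P \<Longrightarrow> x \<noteq> y \<Longrightarrow> t \<le> dist x y"
  shows "(\<Sum>x\<in>P. (beta_number boundary x (15 * t))\<^sup>2 * (5 * t)) \<le> 10 ^ 10 * (2/3) ^ k"
proof -
  have "boundary \<subseteq> disc []" using boundary_subset_solid solid_subset_cball by (auto simp: disc_eq rad_def)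
  then have "boundary = boundary \<inter> disc []" by blast
  then have M: "hausdorff_measure1 boundary \<le> ennreal 2"
    using boundary_node_disc_measure_le[of "[]"] by (simp add: rad_def node_live)
  have "real (card P) * (1/3) \<le> 17600 * 2"
  proof (rule separated_card_le[OF P])
    show "3 * (1/3) \<le> dist x y" if "x \<in> P" "y \<in> P" "x \<noteq> y" for x y
      using sep[OF that] t(1) by linarith
    show "boundary \<inter> ball x (1/3) \<subseteq> boundary" for x by blast
  qed (use M in auto)
  then have c: "real (card P) \<le> 105600" by simp
  have "(\<Sum>x\<in>P. (beta_number boundary x (15 * t))\<^sup>2 * (5 * t)) \<le> (\<Sum>x\<in>P. 2 / (15 * t) ^ 3 * (5 * t))"
    using t by (intro sum_mono mult_right_mono beta_number_boundary_large) auto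
  also have "\<dots> = real (card P) * (2 / 675 * ((1 / t) * (1 / t)))"
    using t(1) by (simp add: power3_eq_cube)
  also have "\<dots> \<le> 105600 * (2 / 675 * ((1/1000) ^ k * 1))"
    using t c by (intro mult_mono) auto
  also have "\<dots> \<le> 105600 * (2 / 675 * ((2/3) ^ k * 1))"
    by (intro mult_left_mono mult_right_mono power_mono) auto
  also have "\<dots> \<le> 10 ^ 10 * (2/3) ^ k" by simp
  finally show ?thesis .
qed

lemma beta_generation_le:
  assumes \<rho>: "0 < \<rho>" "\<rho> < 1/1000" and P: "finite P" "P \<subseteq> boundary"
    and sep: "\<And>x y. x \<in> P \<Longrightarrow> y \<in> P \<Longrightarrow> x \<noteq> y \<Longrightarrow> \<rho> powi k \<le> dist x y"
  shows "(\<Sum>x\<in>P. (beta_number boundary x (3 * cube_side \<rho> k))\<^sup>2 * cube_side \<rho> k) \<le> 10 ^ 10 * (2/3) ^ nat \<bar>k\<bar>"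
proof -
  have c: "cube_side \<rho> k = 5 * \<rho> powi k" "3 * cube_side \<rho> k = 15 * \<rho> powi k" by (simp_all add: cube_side_def)
  have pow: "\<rho> ^ m \<le> (1/1000) ^ m" for m using \<rho> by (intro power_mono) auto
  show ?thesis
  proof (cases "0 < k")
    case True
    define m where "m = nat k"
    have k: "k = int m" "0 < m" using True by (auto simp: m_def)
    have "\<rho> powi k \<le> (1/1000) ^ m" using pow[of m] by (simp add: k)
    then show ?thesis
      unfolding c using beta_generation_fine[OF P _ _ k(2) sep] \<rho> by (simp add: k(1))
  next
    case False
    define m where "m = nat (- k)"
    have k: "k = - int m" using False by (auto simp: m_def)
    have t: "\<rho> powi k = 1 / \<rho> ^ m" by (simp add: k power_int_minus inverse_eq_divide)
    have "1 / (\<rho> powi k) \<le> (1/1000) ^ m" using pow[of m] by (simp add: t)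
    moreover have "1 \<le> \<rho> powi k" using \<rho> by (simp add: t power_le_one)
    ultimately show ?thesis
      unfolding c using beta_generation_coarse[OF P _ _ sep] by (simp add: k)
  qed
qed

lemma sum_two_sided_geometric:
  assumes "finite K" shows "(\<Sum>k\<in>K. (2/3 :: real) ^ nat \<bar>k\<bar>) \<le> 5"
proof -
  have sym: "(\<Sum>k\<in>{- int m..int m}. (2/3 :: real) ^ nat \<bar>k\<bar>) = 5 - 4 * (2/3) ^ m" for m
  proof (induction m)
    case (Suc m)
    have e: "{- int (Suc m)..int (Suc m)} = insert (- int (Suc m)) (insert (int (Suc m)) {- int m..int m})" by auto
    show ?case unfolding e using Suc by (simp add: nat_add_distrib)
  qed simp
  define m where "m = Max (insert 0 (nat ` abs ` K))"
  have "k \<in> {- int m..int m}" if "k \<in> K" for k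
  proof -
    have "nat \<bar>k\<bar> \<le> m" unfolding m_def using that assms by (intro Max_ge) auto
    then show ?thesis by auto
  qed
  then have "(\<Sum>k\<in>K. (2/3 :: real) ^ nat \<bar>k\<bar>) \<le> (\<Sum>k\<in>{- int m..int m}. (2/3) ^ nat \<bar>k\<bar>)"
    by (intro sum_mono2) auto
  then show ?thesis unfolding sym using zero_le_power[of "2/3 :: real" m] by linarith
qed

text \<open>A cube contains its centre, so disjointness within a generation makes the centre map
  injective and turns sums over cubes into sums over net points.\<close>

lemma cubes_centre:
  assumes cd: "christ_david_cubes \<rho> X N D c" and \<rho>: "0 < \<rho>"
  shows "c k ` D k \<subseteq> X" "inj_on (c k) (D k)"
    and "Q \<in> D k \<Longrightarrow> Q' \<in> D k \<Longrightarrow> c k Q \<noteq> c k Q' \<Longrightarrow> \<rho> powi k \<le> dist (c k Q) (c k Q')"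
proof -
  have net: "maximal_net X (\<rho> powi k) (c k ` D k)" and dis: "disjoint (D k)"
    and core: "\<And>Q. Q \<in> D k \<Longrightarrow> X \<inter> ball (c k Q) (1/500 * cube_side \<rho> k) \<subseteq> Q"
    using cd unfolding christ_david_cubes_def by auto
  show sub: "c k ` D k \<subseteq> X" using net unfolding maximal_net_def by blast
  have own: "c k Q \<in> Q" if "Q \<in> D k" for Q
  proof -
    have "0 < 1/500 * cube_side \<rho> k" using \<rho> by (simp add: cube_side_def)
    then have "c k Q \<in> X \<inter> ball (c k Q) (1/500 * cube_side \<rho> k)" using sub that by auto
    then show ?thesis using core[OF that] by blast
  qed
  show "inj_on (c k) (D k)"
  proof (rule inj_onI)
    fix Q Q' assume Q: "Q \<in> D k" "Q' \<in> D k" "c k Q = c k Q'"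
    then have "Q \<inter> Q' \<noteq> {}" using own[OF Q(1)] own[OF Q(2)] by auto
    then show "Q = Q'" using dis Q(1,2) unfolding disjoint_def by blast
  qed
  show "\<rho> powi k \<le> dist (c k Q) (c k Q')" if "Q \<in> D k" "Q' \<in> D k" "c k Q \<noteq> c k Q'"
    using net that unfolding maximal_net_def by blast
qed

lemma beta_total_boundary_finite:
  assumes \<rho>: "0 < \<rho>" "\<rho> < 1/1000" and cd: "christ_david_cubes \<rho> boundary N D c"
  shows "beta_total \<rho> boundary D c < \<infinity>"
proof -
  define b where "b k Q = (beta_number boundary (c k Q) (3 * cube_side \<rho> k))\<^sup>2 * cube_side \<rho> k" for k Q
  have b0: "0 \<le> b k Q" for k Q using \<rho> by (simp add: b_def cube_side_def)
  \<comment> \<open>An infinite sum in \<open>ennreal\<close> is the supremum of its finite partial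
    sums, so a bound uniform in finite families \<open>G\<close> suffices.\<close>
  have fin: "(\<Sum>(k, Q)\<in>G. ennreal (b k Q)) \<le> ennreal (5 * 10 ^ 10)"
    if G: "finite G" "G \<subseteq> (SIGMA k:UNIV. D k)" for G
  proof -
    define K where "K = fst ` G"
    define H where "H k = {Q. (k, Q) \<in> G}" for k
    have fH: "finite (H k)" for k
      by (rule finite_subset[of _ "snd ` G"]) (use G in \<open>force simp: H_def\<close>)+
    have HD: "H k \<subseteq> D k" for k using G by (auto simp: H_def)
    have gen: "(\<Sum>Q\<in>H k. b k Q) \<le> 10 ^ 10 * (2/3) ^ nat \<bar>k\<bar>" for k
    proof -
      have "inj_on (c k) (H k)" using cubes_centre(2)[OF cd \<rho>(1)] HD inj_on_subset by blast
      then have "(\<Sum>Q\<in>H k. b k Q) = (\<Sum>x\<in>c k ` H k. (beta_number boundary x (3 * cube_side \<rho> k))\<^sup>2 * cube_side \<rho> k)"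
        by (simp add: sum.reindex b_def)
      also have "\<dots> \<le> 10 ^ 10 * (2/3) ^ nat \<bar>k\<bar>"
      proof (rule beta_generation_le[OF \<rho>])
        show "c k ` H k \<subseteq> boundary" using cubes_centre(1)[OF cd \<rho>(1)] HD by blast
        show "\<rho> powi k \<le> dist x y" if "x \<in> c k ` H k" "y \<in> c k ` H k" "x \<noteq> y" for x y
          using cubes_centre(3)[OF cd \<rho>(1)] HD that by blast
      qed (use fH in simp)
      finally show ?thesis .
    qed
    have GS: "G = Sigma K H" unfolding K_def H_def by force
    have "(\<Sum>(k, Q)\<in>G. ennreal (b k Q)) = ennreal (\<Sum>(k, Q)\<in>G. b k Q)"
      unfolding case_prod_unfold by (rule sum_ennreal) (rule b0)
    also have "(\<Sum>(k, Q)\<in>G. b k Q) = (\<Sum>k\<in>K. \<Sum>Q\<in>H k. b k Q)"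
      unfolding GS by (rule sum.Sigma[symmetric]) (use G fH in \<open>auto simp: K_def\<close>)
    also have "ennreal \<dots> \<le> ennreal (5 * 10 ^ 10)"
    proof (rule ennreal_leI)
      have "(\<Sum>k\<in>K. \<Sum>Q\<in>H k. b k Q) \<le> (\<Sum>k\<in>K. 10 ^ 10 * (2/3) ^ nat \<bar>k\<bar>)" by (intro sum_mono gen)
      also have "\<dots> = 10 ^ 10 * (\<Sum>k\<in>K. (2/3) ^ nat \<bar>k\<bar>)" by (rule sum_distrib_left[symmetric])
      also have "\<dots> \<le> 10 ^ 10 * 5" using G by (intro mult_left_mono sum_two_sided_geometric) (auto simp: K_def)
      finally show "(\<Sum>k\<in>K. \<Sum>Q\<in>H k. b k Q) \<le> 5 * 10 ^ 10" by simp
    qed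
    finally show ?thesis .
  qed
  have "(\<Sum>\<^sub>\<infinity>(k, Q)\<in>(SIGMA k:UNIV. D k). ennreal (b k Q))
      = (SUP G\<in>{G. finite G \<and> G \<subseteq> (SIGMA k:UNIV. D k)}. \<Sum>(k, Q)\<in>G. ennreal (b k Q))"
    by (rule nonneg_infsum_complete) auto
  also have "\<dots> \<le> ennreal (5 * 10 ^ 10)" by (rule SUP_least) (use fin in blast)
  finally have "beta_total \<rho> boundary D c \<le> ennreal 2 + ennreal (5 * 10 ^ 10)"
    unfolding beta_total_def b_def by (rule add_mono[OF ediam_boundary_le])
  also have "\<dots> < \<infinity>" by simp
  finally show ?thesis .
qed

text \<open>The witness \<open>- solid\<close> is the same for every \<open>\<rho>\<close>.
  Independence of the pole is built in: the harmonic measure of \<open>cantor\<close> is shown to be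
  positive at each point of the domain.\<close>

theorem theorem4:
  fixes \<rho> :: real
  assumes "0 < \<rho>" and "\<rho> < 1/1000"
  shows "\<exists>\<Omega> :: complex set.
    planar_domain \<Omega> \<and>
    ahlfors_regular1 (frontier \<Omega>) \<and>
    (\<forall>N D c. christ_david_cubes \<rho> (frontier \<Omega>) N D c \<longrightarrow> beta_total \<rho> (frontier \<Omega>) D c < \<infinity>) \<and>
    uniform_domain \<Omega> \<and>
    rectifiable1 (frontier \<Omega>) \<and>
    (\<exists>E \<in> sets borel. E \<subseteq> frontier \<Omega> \<and>
       (\<forall>z\<in>\<Omega>. harmonic_measure \<Omega> z E > 0) \<and> hausdorff_measure1 E = 0)"
proof (intro exI[of _ "- solid"] conjI allI impI)
  have fr: "frontier (- solid) = boundary" by (simp add: frontier_complement frontier_solid)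
  show pd: "planar_domain (- solid)" using uniform_domain_solid by (simp add: uniform_domain_def)
  show "ahlfors_regular1 (frontier (- solid))" unfolding fr by (rule ahlfors_regular1_boundary)
  show "beta_total \<rho> (frontier (- solid)) D c < \<infinity>" if "christ_david_cubes \<rho> (frontier (- solid)) N D c" for N D c
    using beta_total_boundary_finite[OF assms] that unfolding fr by blast
  show "uniform_domain (- solid)" by (rule uniform_domain_solid)
  show "rectifiable1 (frontier (- solid))" unfolding fr by (rule rectifiable1_boundary)
  show "\<exists>E \<in> sets borel. E \<subseteq> frontier (- solid) \<and>
       (\<forall>z\<in>- solid. harmonic_measure (- solid) z E > 0) \<and> hausdorff_measure1 E = 0"
  proof (intro bexI[of _ cantor] conjI ballI)
    show "cantor \<subseteq> frontier (- solid)" unfolding fr boundary_def by blast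
    show "harmonic_measure (- solid) z cantor > 0" if "z \<in> - solid" for z
      by (rule harmonic_measure_cantor_pos[OF pd that])
    show "hausdorff_measure1 cantor = 0" by (rule cantor_measure_zero)
    show "cantor \<in> sets borel" using closed_cantor by (rule borel_closed)
  qed
qed

end
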